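(* Let $E$ be a properly embedded Bryant annular end in $\mathbb{H}^3$. If $E$ is conformally the punctured disk $D^*$ and the hyperbolic Gauss map $G$ extends meromorphically to the puncture $0$, then $\partial_\infty E=\{G(0)\}$, where $G(0)\in S_\infty$ is the value of (the extended) $G$ at the puncture.
   Context: $\mathbb{H}^3$ is hyperbolic 3-space, $S_\infty$ its sphere at infinity, and $\partial_\infty X\subset S_\infty$ denotes the set of accumulation points at infinity of $X\subset\mathbb{H}^3$. A Bryant surface is a surface in $\mathbb{H}^3$ of constant mean curvature one (mean curvature = average of the principal curvatures). A properly embedded Bryant annular end is a Bryant surface $E$ with compact boundary $\partial E$, properly embedded in $\mathbb{H}^3$, homeomorphic to $S^1\times[1,\infty)$. The hyperbolic Gauss map $G:E\to S_\infty\cong\mathbb{C}\cup\{\infty\}$ sends $q$ to the endpoint at infinity of the geodesic ray from $q$ in the direction of the mean curvature vector; it is meromorphic for the conformal structure of the induced metric. $D^*=\{z\in\mathbb{C}:0<|z|\le 1\}$. *)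

theory Defs
  imports "HOL-Complex_Analysis.Complex_Analysis"
begin

section \<open>Hyperbolic 3-space\<close>

text \<open>
  The upper half-space model, with metric \<open>(|dz|\<^sup>2 + dt\<^sup>2) / t\<^sup>2\<close>. A point is a pair \<open>(z, t)\<close>,
  and so is a tangent vector, through its Euclidean components.
\<close>

definition H3 :: "(complex \<times> real) set" where
  "H3 = {p. snd p > 0}"

definition hyp_inner :: "complex \<times> real \<Rightarrow> complex \<times> real \<Rightarrow> complex \<times> real \<Rightarrow> real" where
  "hyp_inner p v w = (v \<bullet> w) / (snd p)\<^sup>2"

text \<open>
  The Christoffel term of the Levi-Civita connection: \<open>\<nabla>\<^sub>v W = D\<^sub>v W + hyp_christoffel p v W\<close>.
  For a conformally flat metric \<open>exp (2 f) \<langle>_, _\<rangle>\<close> it is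
  \<open>df(v) w + df(w) v - \<langle>v, w\<rangle> grad f\<close>; here \<open>f = - ln t\<close>.
\<close>

definition hyp_christoffel ::
  "complex \<times> real \<Rightarrow> complex \<times> real \<Rightarrow> complex \<times> real \<Rightarrow> complex \<times> real" where
  "hyp_christoffel p v w =
     (1 / snd p) *\<^sub>R ((v \<bullet> w) *\<^sub>R (0, 1) - snd v *\<^sub>R w - snd w *\<^sub>R v)"

definition geodesic_ray ::
  "complex \<times> real \<Rightarrow> complex \<times> real \<Rightarrow> (real \<Rightarrow> complex \<times> real) \<Rightarrow> bool" where
  "geodesic_ray q v \<gamma> \<longleftrightarrow>
     \<gamma> 0 = q \<and>
     (\<exists>\<gamma>'. \<gamma>' 0 = v \<and>
        (\<forall>s\<ge>0. \<gamma> s \<in> H3 \<and>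
           (\<gamma> has_vector_derivative \<gamma>' s) (at s within {0..}) \<and>
           (\<gamma>' has_vector_derivative - hyp_christoffel (\<gamma> s) (\<gamma>' s) (\<gamma>' s)) (at s within {0..})))"

text \<open>
  The sphere at infinity is \<open>\<complex> \<union> {\<infinity>}\<close>: \<open>Some z\<close> is the point \<open>(z, 0)\<close> of the boundary plane and
  \<open>None\<close> is \<open>\<infinity>\<close>. The filter below is the trace on \<^const>\<open>H3\<close> of the neighbourhoods of an ideal
  point in the compactification of \<^const>\<open>H3\<close> by its sphere at infinity.
\<close>

type_synonym sphere_at_infinity = "complex option"

definition ideal_nhds :: "sphere_at_infinity \<Rightarrow> (complex \<times> real) filter" where
  "ideal_nhds \<xi> =
     (case \<xi> of Some z \<Rightarrow> inf (nhds (z, 0)) (principal H3)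
              | None \<Rightarrow> inf at_infinity (principal H3))"

definition boundary_at_infinity :: "(complex \<times> real) set \<Rightarrow> sphere_at_infinity set" where
  "boundary_at_infinity A = {\<xi>. \<exists>\<^sub>F p in ideal_nhds \<xi>. p \<in> A}"


section \<open>Embedded surfaces with boundary\<close>

fun Ck_on :: "nat \<Rightarrow> 'a::euclidean_space set \<Rightarrow> ('a \<Rightarrow> 'b::euclidean_space) \<Rightarrow> bool" where
  "Ck_on 0 U f \<longleftrightarrow> continuous_on U f"
| "Ck_on (Suc k) U f \<longleftrightarrow>
     (\<forall>x\<in>U. f differentiable at x) \<and> (\<forall>v. Ck_on k U (\<lambda>x. frechet_derivative f (at x) v))"

definition smooth_on :: "'a::euclidean_space set \<Rightarrow> ('a \<Rightarrow> 'b::euclidean_space) \<Rightarrow> bool" where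
  "smooth_on U f \<longleftrightarrow> (\<forall>k. Ck_on k U f)"

text \<open>
  Parameters range over \<open>\<complex>\<close> viewed as the real plane. Only the part of a patch over the closed upper
  half-plane lies on the surface; smoothness on all of \<open>U\<close> is smoothness up to the boundary.
\<close>

definition surface_patch ::
  "(complex \<times> real) set \<Rightarrow> complex set \<Rightarrow> (complex \<Rightarrow> complex \<times> real) \<Rightarrow> bool" where
  "surface_patch E U X \<longleftrightarrow>
     open U \<and> smooth_on U X \<and>
     (\<forall>u \<in> U \<inter> {u. Im u \<ge> 0}. inj (frechet_derivative X (at u))) \<and>
     (\<exists>Y. homeomorphism (U \<inter> {u. Im u \<ge> 0}) (X ` (U \<inter> {u. Im u \<ge> 0})) X Y) \<and>
     openin (top_of_set E) (X ` (U \<inter> {u. Im u \<ge> 0}))"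

definition embedded_surface :: "(complex \<times> real) set \<Rightarrow> bool" where
  "embedded_surface E \<longleftrightarrow>
     E \<subseteq> H3 \<and> (\<forall>q\<in>E. \<exists>U X u. surface_patch E U X \<and> u \<in> U \<and> Im u \<ge> 0 \<and> X u = q)"

definition surface_boundary :: "(complex \<times> real) set \<Rightarrow> (complex \<times> real) set" where
  "surface_boundary E = {q. \<exists>U X u. surface_patch E U X \<and> u \<in> U \<and> Im u = 0 \<and> X u = q}"


section \<open>Mean curvature\<close>

definition first_ff :: "(complex \<Rightarrow> complex \<times> real) \<Rightarrow> complex \<Rightarrow> complex \<Rightarrow> complex \<Rightarrow> real" where
  "first_ff X u a b =
     hyp_inner (X u) (frechet_derivative X (at u) a) (frechet_derivative X (at u) b)"

definition unit_normal :: "(complex \<Rightarrow> complex \<times> real) \<Rightarrow> complex \<Rightarrow> complex \<times> real \<Rightarrow> bool" where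
  "unit_normal X u N \<longleftrightarrow>
     hyp_inner (X u) N N = 1 \<and> (\<forall>a. hyp_inner (X u) (frechet_derivative X (at u) a) N = 0)"

definition second_ff ::
  "(complex \<Rightarrow> complex \<times> real) \<Rightarrow> complex \<Rightarrow> complex \<times> real \<Rightarrow> complex \<Rightarrow> complex \<Rightarrow> real" where
  "second_ff X u N a b =
     hyp_inner (X u)
       (frechet_derivative (\<lambda>w. frechet_derivative X (at w) b) (at u) a +
        hyp_christoffel (X u) (frechet_derivative X (at u) a) (frechet_derivative X (at u) b))
       N"

text \<open>
  The principal curvatures are the eigenvalues, with multiplicity, of the second fundamental form
  with respect to the first: its diagonal entries in an orthonormal basis of principal directions.
\<close>

definition principal_curvatures ::
  "(complex \<Rightarrow> complex \<times> real) \<Rightarrow> complex \<Rightarrow> complex \<times> real \<Rightarrow> real \<Rightarrow> real \<Rightarrow> bool" where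
  "principal_curvatures X u N \<kappa>1 \<kappa>2 \<longleftrightarrow>
     (\<exists>a b. first_ff X u a a = 1 \<and> first_ff X u b b = 1 \<and> first_ff X u a b = 0 \<and>
            second_ff X u N a b = 0 \<and> second_ff X u N a a = \<kappa>1 \<and> second_ff X u N b b = \<kappa>2)"

definition has_mean_curvature ::
  "(complex \<times> real) set \<Rightarrow> complex \<times> real \<Rightarrow> complex \<times> real \<Rightarrow> real \<Rightarrow> bool" where
  "has_mean_curvature E q N h \<longleftrightarrow>
     (\<exists>U X u. surface_patch E U X \<and> u \<in> U \<and> Im u \<ge> 0 \<and> X u = q \<and> unit_normal X u N \<and>
        (\<exists>\<kappa>1 \<kappa>2. principal_curvatures X u N \<kappa>1 \<kappa>2 \<and> h = (\<kappa>1 + \<kappa>2) / 2))"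

text \<open>Changing the sign of \<open>N\<close> changes the sign of \<open>h\<close>, so the mean curvature vector is unique.\<close>

definition mean_curvature_vector ::
  "(complex \<times> real) set \<Rightarrow> complex \<times> real \<Rightarrow> complex \<times> real" where
  "mean_curvature_vector E q = (THE V. \<exists>N h. has_mean_curvature E q N h \<and> V = h *\<^sub>R N)"


section \<open>Bryant annular ends\<close>

definition bryant_surface :: "(complex \<times> real) set \<Rightarrow> bool" where
  "bryant_surface E \<longleftrightarrow>
     embedded_surface E \<and>
     (\<exists>N. continuous_on E N \<and> (\<forall>q\<in>E. has_mean_curvature E q (N q) 1))"

definition bryant_annular_end :: "(complex \<times> real) set \<Rightarrow> bool" where
  "bryant_annular_end E \<longleftrightarrow>
     bryant_surface E \<and>
     compact (surface_boundary E) \<and>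
     (\<forall>K. compact K \<and> K \<subseteq> H3 \<longrightarrow> compact (E \<inter> K)) \<and>
     E homeomorphic (sphere (0::complex) 1 \<times> {1::real..})"

definition hyperbolic_gauss_map ::
  "(complex \<times> real) set \<Rightarrow> complex \<times> real \<Rightarrow> sphere_at_infinity" where
  "hyperbolic_gauss_map E q =
     (THE \<xi>. \<exists>\<gamma>. geodesic_ray q (mean_curvature_vector E q) \<gamma> \<and>
                 filterlim \<gamma> (ideal_nhds \<xi>) at_top)"

definition punctured_disk :: "complex set" where
  "punctured_disk = {z. 0 < norm z \<and> norm z \<le> 1}"

text \<open>
  Equivalence of surfaces with boundary, conformal in the interior and continuous up to the boundary.
  Either orientation of the disk is allowed.
\<close>

definition conformal_parametrization ::
  "(complex \<times> real) set \<Rightarrow> (complex \<Rightarrow> complex \<times> real) \<Rightarrow> bool" where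
  "conformal_parametrization E \<phi> \<longleftrightarrow>
     (\<exists>\<psi>. homeomorphism punctured_disk E \<phi> \<psi>) \<and>
     smooth_on (interior punctured_disk) \<phi> \<and>
     (\<forall>z \<in> interior punctured_disk. \<exists>c>0. \<forall>a b. first_ff \<phi> z a b = c * (a \<bullet> b))"

text \<open>
  Meromorphy near \<open>z\<close> of a map into the Riemann sphere. The first disjunct is the constant map
  \<open>\<infinity>\<close>, which no complex-valued meromorphic function represents; horospheres centred at \<open>\<infinity>\<close> have
  this Gauss map.
\<close>

definition sphere_meromorphic_at :: "(complex \<Rightarrow> complex option) \<Rightarrow> complex \<Rightarrow> bool" where
  "sphere_meromorphic_at F z \<longleftrightarrow>
     (\<forall>\<^sub>F w in nhds z. F w = None) \<or>
     (\<exists>r>0. \<exists>g. g nicely_meromorphic_on ball z r \<and>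
        (\<forall>w \<in> ball z r. F w = (if is_pole g w then None else Some (g w))))"

end

theory Submission
  imports Defs
begin

text \<open>
  The proof plays the direction of the normals against the separation of space by the surface.
  
  Suppose an ideal point \<open>\<xi> \<noteq> G 0\<close> lies in the ideal boundary, and move \<open>G 0\<close> to \<open>\<infinity>\<close> by an inversion, so that
  \<open>\<xi>\<close> becomes a point \<open>(b, 0)\<close> of the boundary plane. Every compact part of the end stays away from
  \<open>(b, 0)\<close>, so a point of the end near \<open>(b, 0)\<close> is \<open>\<phi> z\<close> with \<open>z\<close> near the puncture. The normal there points
  to \<open>G z\<close>, which is near \<open>\<infinity>\<close>. A geodesic that leaves a point of small height \<open>t\<close> for a remote point of the
  boundary starts almost vertically: its direction differs from the vertical by at most a small
  multiple of \<open>t\<close> (\<open>ideal_direction_near_vertical\<close>). Hence near \<open>(b, 0)\<close> the surface is nearly horizontal and all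
  its normals point upwards. Choose two points of the end near \<open>(b, 0)\<close>, the second at less than half
  the height of the first. The straight segment from the lower point to the upper one is steeper than
  the surface at every point where they meet, so it crosses the surface only from below to above, and
  it does so at both of its ends.
  
  That cannot happen on an embedded surface which separates. Remove from \<open>H3\<close> the image of the unit
  circle, which is compact. What is left of the end is a closed two-sided surface in the remaining
  open set, and collapsing a neighbourhood of it transversally onto a circle gives a continuous map
  \<open>f\<close> to the unit circle with \<open>f = 1\<close> exactly on the surface, which turns in the positive sense when
  the surface is crossed along its normal (\<open>phase_of_two_sided_set\<close>). The complement of a ball in space
  is simply connected, so outside a larger compact set \<open>f\<close> has a continuous argument \<open>h\<close>
  (\<open>logarithm_off_compact\<close>). On the connected set \<open>\<phi> {z. 0 < |z| < e}\<close> the argument is a multiple of \<open>2 \<pi>\<close>,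
  hence constant (\<open>end_phase\<close>). Along the segment \<open>h\<close> takes this constant value at both ends and increases
  through it whenever it takes it, which is absurd (\<open>no_two_upward_crossings\<close>). So \<open>G 0\<close> is the only
  possible ideal boundary point. There is at least one, because the end is not compact
  (\<open>boundary_nonempty\<close>).
  
  Two facts tie this argument to the definitions. The mean curvature vector does not depend on the
  patch used to compute it, because two immersed patches of the same embedded surface agree to second
  order at a common point (\<open>second_order_contact\<close>, \<open>mean_curvature_vector_eq\<close>). And the geodesic equation
  of the half-space model can be integrated, which expresses a unit vector through the ideal endpoint
  of its geodesic ray (\<open>hyperbolic_gauss_map_direction\<close>).
\<close>

section \<open>Second-order contact of parametrizations\<close>

definition hessian :: "('a::euclidean_space \<Rightarrow> 'b::euclidean_space) \<Rightarrow> 'a \<Rightarrow> 'a \<Rightarrow> 'a \<Rightarrow> 'b" where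
  "hessian F x a b = frechet_derivative (\<lambda>w. frechet_derivative F (at w) b) (at x) a"

definition twice_differentiable_on :: "'a::euclidean_space set \<Rightarrow> ('a \<Rightarrow> 'b::euclidean_space) \<Rightarrow> bool" where
  "twice_differentiable_on U F \<longleftrightarrow> open U \<and>
     (\<forall>x\<in>U. F differentiable at x \<and> (\<forall>v. (\<lambda>w. frechet_derivative F (at w) v) differentiable at x))"

lemma smooth_on_imp_twice_differentiable_on:
  assumes "smooth_on U F" and "open U"
  shows "twice_differentiable_on U F"
proof -
  have "Ck_on (Suc (Suc 0)) U F" using assms(1) unfolding smooth_on_def by blast
  then show ?thesis using assms(2) by (simp add: twice_differentiable_on_def)
qed

lemma twice_differentiable_onD:
  assumes "twice_differentiable_on U F" and "x \<in> U"
  shows "(F has_derivative frechet_derivative F (at x)) (at x)"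
    and "((\<lambda>w. frechet_derivative F (at w) v) has_derivative (\<lambda>a. hessian F x a v)) (at x)"
    and "linear (frechet_derivative F (at x))"
    and "linear (\<lambda>a. hessian F x a v)"
proof -
  have d: "F differentiable at x" "(\<lambda>w. frechet_derivative F (at w) v) differentiable at x"
    using assms by (auto simp: twice_differentiable_on_def)
  show 1: "(F has_derivative frechet_derivative F (at x)) (at x)"
    using d(1) by (simp add: frechet_derivative_works)
  show 2: "((\<lambda>w. frechet_derivative F (at w) v) has_derivative (\<lambda>a. hessian F x a v)) (at x)"
    using d(2) unfolding hessian_def by (simp add: frechet_derivative_works)
  show "linear (frechet_derivative F (at x))" "linear (\<lambda>a. hessian F x a v)"
    using 1 2 has_derivative_bounded_linear bounded_linear.linear by blast+
qed

lemma linear_hessian_right: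
  assumes "twice_differentiable_on U F" and "x \<in> U"
  shows "linear (hessian F x a)"
proof -
  note D = twice_differentiable_onD[OF assms(1)]
  have "open U" using assms(1) by (simp add: twice_differentiable_on_def)
  have comb: "hessian F x a (c *\<^sub>R v + w) = c *\<^sub>R hessian F x a v + hessian F x a w" for c v w
  proof -
    have "((\<lambda>y. c *\<^sub>R frechet_derivative F (at y) v + frechet_derivative F (at y) w) has_derivative
        (\<lambda>a. c *\<^sub>R hessian F x a v + hessian F x a w)) (at x)"
      by (intro derivative_intros D(2) assms)
    then have "((\<lambda>y. frechet_derivative F (at y) (c *\<^sub>R v + w)) has_derivative
        (\<lambda>a. c *\<^sub>R hessian F x a v + hessian F x a w)) (at x)"
      by (rule has_derivative_transform_within_open[OF _ \<open>open U\<close> assms(2)])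
        (use D(3) in \<open>simp add: linear_add linear_cmul\<close>)
    then have "frechet_derivative (\<lambda>y. frechet_derivative F (at y) (c *\<^sub>R v + w)) (at x)
        = (\<lambda>a. c *\<^sub>R hessian F x a v + hessian F x a w)"
      by (rule frechet_derivative_at[symmetric])
    then show ?thesis by (simp add: hessian_def fun_eq_iff)
  qed
  have z: "hessian F x a 0 = 0" using comb[of 1 0 0] by simp
  show ?thesis
    by (rule linearI) (use comb[of 1] comb[of _ _ 0] z in auto)
qed

text \<open>
  Along the segment from \<open>z\<close> to \<open>z + h\<close> the remainder has derivative
  \<open>D F (z + \<tau> h) h - D F z h - \<tau> (hessian F z h h)\<close>. This is small because the gradient is differentiable
  at the one point \<open>z\<close>; expanding \<open>h\<close> in the basis makes the estimate uniform in the direction of \<open>h\<close>.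
\<close>

lemma second_order_taylor:
  assumes F: "twice_differentiable_on U F" and z: "z \<in> U" and e: "e > 0"
  shows "\<exists>d>0. \<forall>h. norm h < d \<longrightarrow>
    norm (F (z + h) - F z - frechet_derivative F (at z) h - (1 / 2) *\<^sub>R hessian F z h h) \<le> e * (norm h)\<^sup>2"
proof -
  note D = twice_differentiable_onD[OF F]
  let ?D = "\<lambda>x. frechet_derivative F (at x)"
  have "open U" using F by (simp add: twice_differentiable_on_def)
  define e' where "e' = e / DIM('a)"
  have e': "e' > 0" using e by (simp add: e'_def)
  have "\<exists>d>0. \<forall>k. norm k < d \<longrightarrow> norm (?D (z + k) b - ?D z b - hessian F z k b) \<le> e' * norm k" for b
  proof -
    obtain d where "d > 0" "\<And>y. norm (y - z) < d \<Longrightarrow>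
        norm (?D y b - ?D z b - hessian F z (y - z) b) \<le> e' * norm (y - z)"
      using D(2)[OF z, of b] e' unfolding has_derivative_at_alt by metis
    from this(1) this(2)[of "z + _"] show ?thesis by (intro exI[of _ d]) auto
  qed
  then obtain d where d: "\<And>b. d b > 0"
    "\<And>b k. norm k < d b \<Longrightarrow> norm (?D (z + k) b - ?D z b - hessian F z k b) \<le> e' * norm k"
    by metis
  obtain r where r: "r > 0" "ball z r \<subseteq> U" using \<open>open U\<close> z open_contains_ball by blast
  define d0 where "d0 = min r (Min (d ` Basis))"
  have d0: "d0 > 0" "d0 \<le> r" "\<And>b. b \<in> Basis \<Longrightarrow> d0 \<le> d b"
    using r d(1) by (auto simp: d0_def min_le_iff_disj)
  show ?thesis
  proof (intro exI[of _ d0] conjI allI impI d0(1))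
    fix h :: 'a assume h: "norm h < d0"
    define R where "R = (\<lambda>\<tau>::real. F (z + \<tau> *\<^sub>R h) - \<tau> *\<^sub>R ?D z h - (\<tau>\<^sup>2 / 2) *\<^sub>R hessian F z h h)"
    define R' where "R' = (\<lambda>\<tau>::real. ?D (z + \<tau> *\<^sub>R h) h - ?D z h - \<tau> *\<^sub>R hessian F z h h)"
    have inU: "z + \<tau> *\<^sub>R h \<in> U" and small: "norm (\<tau> *\<^sub>R h) \<le> norm h" if "\<tau> \<in> {0..1}" for \<tau>
    proof -
      show s: "norm (\<tau> *\<^sub>R h) \<le> norm h" using that by (simp add: mult_left_le_one_le)
      then have "norm (\<tau> *\<^sub>R h) < r" using h d0(2) by linarith
      then show "z + \<tau> *\<^sub>R h \<in> U" using r(2) by (auto simp: dist_norm subset_iff)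
    qed
    have dR: "(R has_derivative (\<lambda>x. x *\<^sub>R R' \<tau>)) (at \<tau> within {0..1})" if "\<tau> \<in> {0..1}" for \<tau>
    proof -
      have 1: "((\<lambda>\<tau>. F (z + \<tau> *\<^sub>R h)) has_derivative (\<lambda>x. ?D (z + \<tau> *\<^sub>R h) (x *\<^sub>R h))) (at \<tau> within {0..1})"
        by (rule has_derivative_compose[where f = "\<lambda>\<tau>. z + \<tau> *\<^sub>R h" and g = F, OF _ D(1)[OF inU[OF that]]])
          (auto intro!: derivative_eq_intros)
      show ?thesis
        unfolding R_def R'_def
        by (rule derivative_eq_intros 1 refl)+
          (auto simp: linear_cmul[OF D(3)[OF inU[OF that]]] algebra_simps)
    qed
    have bR: "norm (R' \<tau>) \<le> e * (norm h)\<^sup>2" if "\<tau> \<in> {0..1}" for \<tau>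
    proof -
      have "R' \<tau> = (\<Sum>b\<in>Basis. (h \<bullet> b) *\<^sub>R (?D (z + \<tau> *\<^sub>R h) b - ?D z b - hessian F z (\<tau> *\<^sub>R h) b))"
      proof -
        have exp: "L h = (\<Sum>b\<in>Basis. (h \<bullet> b) *\<^sub>R L b)" if "linear L" for L :: "'a \<Rightarrow> 'b"
          using linear_sum[OF that, of "\<lambda>b. (h \<bullet> b) *\<^sub>R b" Basis] linear_cmul[OF that]
          by (simp add: euclidean_representation)
        have "hessian F z (\<tau> *\<^sub>R h) b = \<tau> *\<^sub>R hessian F z h b" for b
          using linear_cmul[OF D(4)[OF z]] by blast
        then show ?thesis
          unfolding R'_def exp[OF D(3)[OF inU[OF that]]] exp[OF D(3)[OF z]] exp[OF linear_hessian_right[OF F z]]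
          by (simp add: scaleR_sum_right sum_subtractf[symmetric] scaleR_diff_right mult.commute)
      qed
      also have "norm \<dots> \<le> (\<Sum>b\<in>(Basis::'a set). e' * (norm h)\<^sup>2)"
      proof (rule sum_norm_le)
        fix b :: 'a assume b: "b \<in> Basis"
        have "norm (\<tau> *\<^sub>R h) < d b" using small[OF that] h d0(3)[OF b] by linarith
        from d(2)[OF this] have "norm (?D (z + \<tau> *\<^sub>R h) b - ?D z b - hessian F z (\<tau> *\<^sub>R h) b) \<le> e' * norm (\<tau> *\<^sub>R h)" .
        also have "\<dots> \<le> e' * norm h" using small[OF that] e' by (simp add: mult_left_mono)
        finally have 1: "norm (?D (z + \<tau> *\<^sub>R h) b - ?D z b - hessian F z (\<tau> *\<^sub>R h) b) \<le> e' * norm h" .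
        have 2: "\<bar>h \<bullet> b\<bar> \<le> norm h" using Basis_le_norm[OF b] .
        have "\<bar>h \<bullet> b\<bar> * norm (?D (z + \<tau> *\<^sub>R h) b - ?D z b - hessian F z (\<tau> *\<^sub>R h) b) \<le> norm h * (e' * norm h)"
          by (rule mult_mono[OF 2 1]) auto
        then show "norm ((h \<bullet> b) *\<^sub>R (?D (z + \<tau> *\<^sub>R h) b - ?D z b - hessian F z (\<tau> *\<^sub>R h) b)) \<le> e' * (norm h)\<^sup>2"
          by (simp add: power2_eq_square mult_ac)
      qed
      also have "\<dots> = e * (norm h)\<^sup>2" by (simp add: e'_def)
      finally show ?thesis .
    qed
    have "norm (R 1 - R 0) \<le> e * (norm h)\<^sup>2 * norm (1 - 0 :: real)"
    proof (rule differentiable_bound[OF _ dR])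
      fix \<tau> :: real assume "\<tau> \<in> {0..1}"
      then show "onorm (\<lambda>x. x *\<^sub>R R' \<tau>) \<le> e * (norm h)\<^sup>2"
        using bR by (intro onorm_le) (auto simp: mult.commute[of _ "\<bar>_\<bar>"] intro!: mult_left_mono)
    qed auto
    then show "norm (F (z + h) - F z - ?D z h - (1 / 2) *\<^sub>R hessian F z h h) \<le> e * (norm h)\<^sup>2"
      by (simp add: R_def algebra_simps)
  qed
qed

text \<open>
  Two parametrizations that meet along a sequence tending to \<open>X u = \<phi> z\<close> from the direction \<open>a\<close> have the
  same tangent vector there and, after projection to the normal of \<open>\<phi>\<close>, the same second derivative.
  Only points \<open>u + s a\<close> with \<open>s > 0\<close> enter, so that patches can be compared at points where just half
  of their domain belongs to the surface. The immersion \<open>\<phi>\<close> is bounded below to first order, which turns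
  convergence of the image points into convergence of the difference quotients \<open>(y n - z) / s n\<close>.
\<close>

lemma second_order_contact:
  fixes X \<phi> :: "complex \<Rightarrow> complex \<times> real"
  assumes X: "twice_differentiable_on U X" "u \<in> U" and \<phi>: "twice_differentiable_on W \<phi>" "z \<in> W"
    and inj: "inj (frechet_derivative \<phi> (at z))"
    and s: "\<And>n. s n > 0" "s \<longlonglongrightarrow> 0" and y: "y \<longlonglongrightarrow> z"
    and eq: "\<And>n. X (u + s n *\<^sub>R a) = \<phi> (y n)" "X u = \<phi> z"
  obtains w where "frechet_derivative \<phi> (at z) w = frechet_derivative X (at u) a"
    and "\<And>N. (\<And>k. frechet_derivative \<phi> (at z) k \<bullet> N = 0) \<Longrightarrow> hessian X u a a \<bullet> N = hessian \<phi> z w w \<bullet> N"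
proof -
  let ?D = "frechet_derivative \<phi> (at z)" and ?DX = "frechet_derivative X (at u)"
  note DX = twice_differentiable_onD[OF X] and D = twice_differentiable_onD[OF \<phi>]
  have snz: "s n \<noteq> 0" for n using s(1)[of n] by simp
  define k where "k = (\<lambda>n. (1 / s n) *\<^sub>R (y n - z))"
  have yk: "y n = z + s n *\<^sub>R k n" for n using s(1)[of n] by (simp add: k_def)
  have sk0: "(\<lambda>n. s n *\<^sub>R k n) \<longlonglongrightarrow> 0"
    using tendsto_diff[OF y tendsto_const[of z]] by (simp add: yk)
  have sa0: "(\<lambda>n. s n *\<^sub>R a) \<longlonglongrightarrow> 0"
    using tendsto_scaleR[OF s(2) tendsto_const[of a]] by simp
  have TX: "\<forall>\<^sub>F n in sequentially. norm (X (u + s n *\<^sub>R a) - X u - ?DX (s n *\<^sub>R a) - (1 / 2) *\<^sub>R hessian X u (s n *\<^sub>R a) (s n *\<^sub>R a)) \<le> e * (norm (s n *\<^sub>R a))\<^sup>2"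
    if e: "e > 0" for e
  proof -
    obtain d where "d > 0" and d: "\<And>h. norm h < d \<Longrightarrow> norm (X (u + h) - X u - ?DX h - (1 / 2) *\<^sub>R hessian X u h h) \<le> e * (norm h)\<^sup>2"
      using second_order_taylor[OF X e] by blast
    show ?thesis using tendstoD[OF sa0 \<open>d > 0\<close>] by eventually_elim (rule d, simp)
  qed
  have T\<phi>: "\<forall>\<^sub>F n in sequentially. norm (\<phi> (z + s n *\<^sub>R k n) - \<phi> z - ?D (s n *\<^sub>R k n) - (1 / 2) *\<^sub>R hessian \<phi> z (s n *\<^sub>R k n) (s n *\<^sub>R k n)) \<le> e * (norm (s n *\<^sub>R k n))\<^sup>2"
    if e: "e > 0" for e
  proof -
    obtain d where "d > 0" and d: "\<And>h. norm h < d \<Longrightarrow> norm (\<phi> (z + h) - \<phi> z - ?D h - (1 / 2) *\<^sub>R hessian \<phi> z h h) \<le> e * (norm h)\<^sup>2"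
      using second_order_taylor[OF \<phi> e] by blast
    show ?thesis using tendstoD[OF sk0 \<open>d > 0\<close>] by eventually_elim (rule d, simp)
  qed
  define Q where "Q = (\<lambda>n. (1 / s n) *\<^sub>R (X (u + s n *\<^sub>R a) - X u))"
  have Q\<phi>: "Q n = (1 / s n) *\<^sub>R (\<phi> (z + s n *\<^sub>R k n) - \<phi> z)" for n
    by (simp add: Q_def eq yk[symmetric])
  have Qlim: "Q \<longlonglongrightarrow> ?DX a"
  proof -
    have "((\<lambda>h. norm (X (u + h) - X u - ?DX h) / norm h) \<longlongrightarrow> 0) (at 0)"
      using DX(1) unfolding has_derivative_at by blast
    moreover have "norm (X (u + h) - X u - ?DX h) / norm h
        = norm ((1 / norm h) *\<^sub>R (X (u + h) - X u - ?DX h))" for h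
      by simp
    ultimately have l: "((\<lambda>h. (1 / norm h) *\<^sub>R (X (u + h) - X u - ?DX h)) \<longlongrightarrow> 0) (at 0)"
      by (simp only: tendsto_norm_zero_iff)
    show ?thesis
    proof (cases "a = 0")
      case True
      then show ?thesis using linear_0[OF DX(3)] by (simp add: Q_def)
    next
      case False
      have "filterlim (\<lambda>n. s n *\<^sub>R a) (at 0) sequentially"
        using sa0 snz False by (simp add: filterlim_at)
      from filterlim_compose[OF l this]
      have "(\<lambda>n. norm a *\<^sub>R ((1 / norm (s n *\<^sub>R a)) *\<^sub>R (X (u + s n *\<^sub>R a) - X u - ?DX (s n *\<^sub>R a)))) \<longlonglongrightarrow> norm a *\<^sub>R 0"
        by (intro tendsto_intros)
      moreover have "norm a *\<^sub>R ((1 / norm (s n *\<^sub>R a)) *\<^sub>R (X (u + s n *\<^sub>R a) - X u - ?DX (s n *\<^sub>R a))) = Q n - ?DX a" for n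
        using s(1)[of n] False by (simp add: Q_def linear_cmul[OF DX(3)] scaleR_diff_right)
      ultimately show ?thesis by (simp add: LIM_zero_iff)
    qed
  qed
  obtain B where B: "B > 0" "\<And>h. B * norm h \<le> norm (?D h)"
    using linear_inj_bounded_below_pos[OF D(3) inj] by metis
  have l\<phi>: "\<forall>\<^sub>F n in sequentially. norm (Q n - ?D (k n)) \<le> e * norm (k n)" if e: "e > 0" for e
  proof -
    have "(\<phi> has_derivative ?D) (at z)" by (rule D(1))
    then obtain d where "d > 0" and d: "\<And>x. norm (x - z) < d \<Longrightarrow> norm (\<phi> x - \<phi> z - ?D (x - z)) \<le> e * norm (x - z)"
      using e unfolding has_derivative_at_alt by blast
    show ?thesis using tendstoD[OF sk0 \<open>d > 0\<close>]
    proof eventually_elim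
      case (elim n)
      have "norm (\<phi> (z + s n *\<^sub>R k n) - \<phi> z - ?D (s n *\<^sub>R k n)) \<le> e * norm (s n *\<^sub>R k n)"
        using d[of "z + s n *\<^sub>R k n"] elim by simp
      moreover have "Q n - ?D (k n) = (1 / s n) *\<^sub>R (\<phi> (z + s n *\<^sub>R k n) - \<phi> z - ?D (s n *\<^sub>R k n))"
        using s(1)[of n] by (simp add: Q\<phi> linear_cmul[OF D(3)] scaleR_diff_right)
      ultimately show ?case using s(1)[of n] by (simp add: divide_le_eq mult_ac)
    qed
  qed
  have bdd: "\<forall>\<^sub>F n in sequentially. norm (k n) \<le> (norm (?DX a) + 1) * 2 / B"
  proof -
    have 1: "\<forall>\<^sub>F n in sequentially. norm (Q n - ?D (k n)) \<le> (B / 2) * norm (k n)"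
      using B by (intro l\<phi>) auto
    have 2: "\<forall>\<^sub>F n in sequentially. dist (Q n) (?DX a) < 1" by (rule tendstoD[OF Qlim]) simp
    show ?thesis using 1 2
    proof eventually_elim
      case (elim n)
      have "B * norm (k n) \<le> norm (?D (k n))" by (rule B(2))
      also have "\<dots> \<le> norm (Q n) + norm (Q n - ?D (k n))" by norm
      also have "norm (Q n) \<le> norm (?DX a) + 1" using elim(2) by norm
      finally have "(B / 2) * norm (k n) \<le> norm (?DX a) + 1" using elim(1) by simp
      then show ?case using B(1) by (simp add: field_simps)
    qed
  qed
  define C where "C = (norm (?DX a) + 1) * 2 / B"
  have C: "C > 0" using B(1) by (simp add: C_def add_nonneg_pos)
  have Dk: "(\<lambda>n. ?D (k n)) \<longlonglongrightarrow> ?DX a"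
  proof -
    have "(\<lambda>n. Q n - ?D (k n)) \<longlonglongrightarrow> 0"
    proof (rule tendstoI)
      fix e :: real assume e: "e > 0"
      have "\<forall>\<^sub>F n in sequentially. norm (Q n - ?D (k n)) \<le> (e / (2 * C)) * norm (k n)"
        using e C by (intro l\<phi>) auto
      then show "\<forall>\<^sub>F n in sequentially. dist (Q n - ?D (k n)) 0 < e"
        using bdd
      proof eventually_elim
        case (elim n)
        have "(e / (2 * C)) * norm (k n) \<le> (e / (2 * C)) * C"
          using elim(2)[folded C_def] e C by (intro mult_left_mono) auto
        also have "\<dots> < e" using e C by simp
        finally show ?case using elim(1) by simp
      qed
    qed
    from tendsto_diff[OF Qlim this] show ?thesis by simp
  qed
  \<comment> \<open>A left inverse of the differential recovers the limit of the quotients from the limit of their images.\<close>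
  obtain L where L: "linear L" "L \<circ> ?D = id"
    using linear_injective_left_inverse[OF D(3) inj] by blast
  define w where "w = L (?DX a)"
  have bL: "bounded_linear L" "bounded_linear ?D" using L(1) D(3) linear_conv_bounded_linear by blast+
  have kw: "k \<longlonglongrightarrow> w"
    using bounded_linear.tendsto[OF bL(1) Dk] fun_cong[OF L(2)] by (simp add: w_def)
  have Dw: "?D w = ?DX a"
    using LIMSEQ_unique[OF bounded_linear.tendsto[OF bL(2) kw] Dk] .
  have "hessian X u a a \<bullet> N = hessian \<phi> z w w \<bullet> N" if N: "\<And>k. ?D k \<bullet> N = 0" for N
  proof -
    have hX: "hessian X u (c *\<^sub>R a) (c *\<^sub>R a) = c\<^sup>2 *\<^sub>R hessian X u a a" for c
      by (simp add: linear_cmul[OF DX(4)] linear_cmul[OF linear_hessian_right[OF X]] power2_eq_square)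
    have h\<phi>: "hessian \<phi> z (c *\<^sub>R v) (c *\<^sub>R v) = c\<^sup>2 *\<^sub>R hessian \<phi> z v v" for c v
      by (simp add: linear_cmul[OF D(4)] linear_cmul[OF linear_hessian_right[OF \<phi>]] power2_eq_square)
    define q where "q = (\<lambda>n. (2 / (s n)\<^sup>2) * ((X (u + s n *\<^sub>R a) - X u) \<bullet> N))"
    have key: "\<bar>(2 / c\<^sup>2) * (P \<bullet> N) - H \<bullet> N\<bar> \<le> 2 * e * b * norm N"
      if "norm (P - E - (1 / 2) *\<^sub>R (c\<^sup>2 *\<^sub>R H)) \<le> e * (c\<^sup>2 * b)" "E \<bullet> N = 0" "c > 0"
      for P E H :: "complex \<times> real" and c e b :: real
    proof -
      have "(2 / c\<^sup>2) * (P \<bullet> N) - H \<bullet> N = (2 / c\<^sup>2) * ((P - E - (1 / 2) *\<^sub>R (c\<^sup>2 *\<^sub>R H)) \<bullet> N)"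
        using that(2,3) by (simp add: inner_diff_left inner_add_left field_simps)
      also have "\<bar>\<dots>\<bar> = (2 / c\<^sup>2) * \<bar>(P - E - (1 / 2) *\<^sub>R (c\<^sup>2 *\<^sub>R H)) \<bullet> N\<bar>"
        using that(3) by (simp add: abs_mult)
      also have "\<dots> \<le> (2 / c\<^sup>2) * (e * (c\<^sup>2 * b) * norm N)"
      proof (rule mult_left_mono)
        show "\<bar>(P - E - (1 / 2) *\<^sub>R (c\<^sup>2 *\<^sub>R H)) \<bullet> N\<bar> \<le> e * (c\<^sup>2 * b) * norm N"
          by (rule order_trans[OF Cauchy_Schwarz_ineq2 mult_right_mono[OF that(1) norm_ge_zero]])
      qed simp
      also have "\<dots> = 2 * e * b * norm N" using that(3) by simp
      finally show ?thesis .
    qed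
    have "q \<longlonglongrightarrow> hessian X u a a \<bullet> N"
    proof (rule LIM_zero_cancel, rule tendsto_rabs_zero_cancel, rule tendstoI)
      fix e :: real assume e: "e > 0"
      define e' where "e' = e / (2 * ((norm a)\<^sup>2 * norm N + 1))"
      have pos: "2 * ((norm a)\<^sup>2 * norm N + 1) > 0" by (simp add: add_nonneg_pos)
      have e': "e' > 0" using e pos by (simp add: e'_def)
      from TX[OF e'] show "\<forall>\<^sub>F n in sequentially. dist \<bar>q n - hessian X u a a \<bullet> N\<bar> 0 < e"
      proof eventually_elim
        case (elim n)
        have "?DX (s n *\<^sub>R a) \<bullet> N = 0" using N[of w] by (simp add: linear_cmul[OF DX(3)] Dw)
        from key[OF _ this s(1)[of n]] elim
        have "\<bar>q n - hessian X u a a \<bullet> N\<bar> \<le> 2 * e' * (norm a)\<^sup>2 * norm N"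
          by (simp add: q_def hX power_mult_distrib)
        also have "\<dots> < e' * (2 * ((norm a)\<^sup>2 * norm N + 1))" using e' by (simp add: algebra_simps)
        also have "\<dots> = e" using pos by (simp add: e'_def)
        finally show ?case by simp
      qed
    qed
    moreover have "q \<longlonglongrightarrow> hessian \<phi> z w w \<bullet> N"
    proof -
      have "(\<lambda>n. q n - hessian \<phi> z (k n) (k n) \<bullet> N) \<longlonglongrightarrow> 0"
      proof (rule tendsto_rabs_zero_cancel, rule tendstoI)
        fix e :: real assume e: "e > 0"
        define e' where "e' = e / (2 * (C\<^sup>2 * norm N + 1))"
        have pos: "2 * (C\<^sup>2 * norm N + 1) > 0" by (simp add: add_nonneg_pos)
        have e': "e' > 0" using e pos by (simp add: e'_def)
        from T\<phi>[OF e'] bdd show "\<forall>\<^sub>F n in sequentially. dist \<bar>q n - hessian \<phi> z (k n) (k n) \<bullet> N\<bar> 0 < e"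
        proof eventually_elim
          case (elim n)
          have "?D (s n *\<^sub>R k n) \<bullet> N = 0" by (rule N)
          from key[OF _ this s(1)[of n]] elim(1)
          have "\<bar>q n - hessian \<phi> z (k n) (k n) \<bullet> N\<bar> \<le> 2 * e' * (norm (k n))\<^sup>2 * norm N"
            by (simp add: q_def h\<phi> power_mult_distrib eq yk[symmetric])
          also have "\<dots> \<le> 2 * e' * C\<^sup>2 * norm N"
            using elim(2)[folded C_def] e' by (intro mult_right_mono mult_left_mono power_mono) auto
          also have "\<dots> < e' * (2 * (C\<^sup>2 * norm N + 1))" using e' by (simp add: algebra_simps)
          also have "\<dots> = e" using pos by (simp add: e'_def)
          finally show ?case by simp
        qed
      qed
      moreover have "(\<lambda>n. hessian \<phi> z (k n) (k n) \<bullet> N) \<longlonglongrightarrow> hessian \<phi> z w w \<bullet> N"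
      proof -
        have "bounded_bilinear (\<lambda>a b. hessian \<phi> z a b)"
          unfolding bilinear_conv_bounded_bilinear[symmetric] bilinear_def
          using D(4) linear_hessian_right[OF \<phi>] by blast
        from bounded_bilinear.tendsto[OF this kw kw] show ?thesis by (intro tendsto_intros)
      qed
      ultimately show ?thesis using tendsto_add by fastforce
    qed
    ultimately show ?thesis by (rule LIMSEQ_unique)
  qed
  with Dw show ?thesis by (rule that)
qed

section \<open>Uniqueness of the mean curvature vector\<close>

lemma second_ff_hessian:
  "second_ff X u N a b = hyp_inner (X u)
     (hessian X u a b + hyp_christoffel (X u) (frechet_derivative X (at u) a) (frechet_derivative X (at u) b)) N"
  by (simp add: second_ff_def hessian_def)

lemma interior_punctured_disk: "interior punctured_disk = {z. 0 < norm z \<and> norm z < 1}"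
proof (rule interior_unique)
  show "{z :: complex. 0 < norm z \<and> norm z < 1} \<subseteq> punctured_disk" by (auto simp: punctured_disk_def)
  show "open {z :: complex. 0 < norm z \<and> norm z < 1}"
    by (intro open_Collect_conj open_Collect_less continuous_intros)
  fix T assume T: "T \<subseteq> punctured_disk" "open T"
  then have "T \<subseteq> interior (cball 0 1)" by (intro interior_maximal) (auto simp: punctured_disk_def)
  then show "T \<subseteq> {z. 0 < norm z \<and> norm z < 1}" using T(1) by (auto simp: punctured_disk_def)
qed

text \<open>
  A basis of the plane that is orthonormal for \<open>c \<langle>_, _\<rangle>\<close> is a rotated and possibly reflected multiple of
  \<open>1, \<i>\<close>. The mixed terms of the two vectors cancel.
\<close>

lemma isotropic_trace:
  fixes B :: "complex \<Rightarrow> complex \<Rightarrow> real"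
  assumes B: "bilinear B" and c: "c > 0"
    and v: "c * (v \<bullet> v) = 1" "c * (w \<bullet> w) = 1" "c * (v \<bullet> w) = 0"
  shows "B v v + B w w = (B 1 1 + B \<i> \<i>) / c"
proof -
  have exp: "B p q = Re p * Re q * B 1 1 + Re p * Im q * B 1 \<i> + Im p * Re q * B \<i> 1 + Im p * Im q * B \<i> \<i>" for p q
  proof -
    have p: "p = Re p *\<^sub>R 1 + Im p *\<^sub>R \<i>" for p :: complex by (simp add: complex_eq_iff)
    have "B p q = B (Re p *\<^sub>R 1 + Im p *\<^sub>R \<i>) (Re q *\<^sub>R 1 + Im q *\<^sub>R \<i>)" using p by metis
    then show ?thesis
      by (simp add: bilinear_ladd[OF B] bilinear_radd[OF B] bilinear_lmul[OF B] bilinear_rmul[OF B] algebra_simps)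
  qed
  define a b where "a = Re v" and "b = Im v"
  define p q where "p = Re w" and "q = Im w"
  have 1: "c * (a\<^sup>2 + b\<^sup>2) = 1" "c * (p\<^sup>2 + q\<^sup>2) = 1"
    using v(1,2) by (simp_all add: inner_complex_def a_def b_def p_def q_def power2_eq_square)
  have 2: "a * p + b * q = 0"
    using v(3) c by (simp add: inner_complex_def a_def b_def p_def q_def)
  have "a\<^sup>2 = q\<^sup>2 \<and> b\<^sup>2 = p\<^sup>2 \<and> a * b = - (p * q)"
  proof -
    have e: "a\<^sup>2 + b\<^sup>2 = 1 / c" "p\<^sup>2 + q\<^sup>2 = 1 / c" using 1 c by (simp_all add: field_simps)
    have "a\<^sup>2 * (p\<^sup>2 + q\<^sup>2) = q\<^sup>2 * (a\<^sup>2 + b\<^sup>2)" using 2 by algebra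
    then have A: "a\<^sup>2 = q\<^sup>2" using e c by simp
    have "a * b * (p\<^sup>2 + q\<^sup>2) = - (p * q) * (a\<^sup>2 + b\<^sup>2)" using 2 by algebra
    then have "(a * b) * (1 / c) = - (p * q) * (1 / c)" unfolding e .
    then have "a * b = - (p * q)" using c by (simp only: mult_cancel_right) simp
    with A e show ?thesis by simp
  qed
  moreover from this 1 have "a\<^sup>2 + p\<^sup>2 = 1 / c" "b\<^sup>2 + q\<^sup>2 = 1 / c" using c by (simp_all add: field_simps)
  ultimately have 3: "a * a + p * p = 1 / c" "b * b + q * q = 1 / c" "a * b + p * q = 0"
    by (simp_all add: power2_eq_square)
  have "B v v + B w w = (a * a + p * p) * B 1 1 + (a * b + p * q) * (B 1 \<i> + B \<i> 1) + (b * b + q * q) * B \<i> \<i>"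
    unfolding exp[of v v] exp[of w w] by (simp add: a_def b_def p_def q_def algebra_simps)
  then show ?thesis unfolding 3 by (simp add: add_divide_distrib)
qed

locale parametrized_end =
  fixes E :: "(complex \<times> real) set" and \<phi> :: "complex \<Rightarrow> complex \<times> real" and \<psi> :: "complex \<times> real \<Rightarrow> complex"
  assumes subset_H3: "E \<subseteq> H3"
    and homeo: "homeomorphism punctured_disk E \<phi> \<psi>"
    and smooth: "smooth_on (interior punctured_disk) \<phi>"
    and conformal: "\<And>z. z \<in> interior punctured_disk \<Longrightarrow> \<exists>c>0. \<forall>a b. first_ff \<phi> z a b = c * (a \<bullet> b)"
begin

lemma twice_differentiable: "twice_differentiable_on (interior punctured_disk) \<phi>"
  by (rule smooth_on_imp_twice_differentiable_on[OF smooth open_interior])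

lemma \<phi>_in: "z \<in> punctured_disk \<Longrightarrow> \<phi> z \<in> E" and \<psi>_\<phi>: "z \<in> punctured_disk \<Longrightarrow> \<psi> (\<phi> z) = z"
  and \<psi>_in: "q \<in> E \<Longrightarrow> \<psi> q \<in> punctured_disk" and \<phi>_\<psi>: "q \<in> E \<Longrightarrow> \<phi> (\<psi> q) = q"
  using homeo unfolding homeomorphism_def by auto

lemma inj_tangent:
  assumes z: "z \<in> interior punctured_disk"
  shows "inj (frechet_derivative \<phi> (at z))"
proof -
  have lin: "linear (frechet_derivative \<phi> (at z))" by (rule twice_differentiable_onD[OF twice_differentiable z])
  obtain c where "c > 0" and c: "\<And>a b. first_ff \<phi> z a b = c * (a \<bullet> b)" using conformal[OF z] by blast
  show ?thesis
    unfolding linear_injective_0[OF lin]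
  proof (intro allI impI)
    fix a assume "frechet_derivative \<phi> (at z) a = 0"
    then have "first_ff \<phi> z a a = 0" by (simp add: first_ff_def hyp_inner_def)
    with c[of a a] \<open>c > 0\<close> show "a = 0" by simp
  qed
qed

text \<open>
  The point of a patch in direction \<open>a\<close> is carried back to the disk by \<open>\<psi>\<close>, whose continuity makes the
  resulting sequence converge to \<open>z\<close>. A patch lies on the surface only over the closed upper half-plane;
  if \<open>a\<close> points out of it then \<open>- a\<close> does not, and both have the same second derivative.
\<close>

lemma patch_second_order:
  assumes z: "z \<in> interior punctured_disk" and X: "surface_patch E U X" "u \<in> U" "Im u \<ge> 0" "X u = \<phi> z"
  obtains w where "frechet_derivative \<phi> (at z) w = frechet_derivative X (at u) a"
    and "\<And>N. (\<And>k. frechet_derivative \<phi> (at z) k \<bullet> N = 0) \<Longrightarrow> hessian X u a a \<bullet> N = hessian \<phi> z w w \<bullet> N"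
proof -
  have oU: "open U" and sm: "smooth_on U X" and op: "openin (top_of_set E) (X ` (U \<inter> {u. Im u \<ge> 0}))"
    using X(1) by (auto simp: surface_patch_def)
  have XE: "X y \<in> E" if "y \<in> U" "Im y \<ge> 0" for y
    using openin_imp_subset[OF op] that by blast
  have C2: "twice_differentiable_on U X" by (rule smooth_on_imp_twice_differentiable_on[OF sm oU])
  note DX = twice_differentiable_onD[OF C2 X(2)] and D = twice_differentiable_onD[OF twice_differentiable z]
  have zd: "z \<in> punctured_disk" using z interior_subset by blast
  have upper: "\<exists>w. frechet_derivative \<phi> (at z) w = frechet_derivative X (at u) b \<and>
    (\<forall>N. (\<forall>k. frechet_derivative \<phi> (at z) k \<bullet> N = 0) \<longrightarrow> hessian X u b b \<bullet> N = hessian \<phi> z w w \<bullet> N)"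
    if b: "Im b \<ge> 0" for b
  proof -
    obtain r where r: "r > 0" "ball u r \<subseteq> U" using oU X(2) open_contains_ball by blast
    define s where "s = (\<lambda>n. r / (norm b + 1) * inverse (real (Suc (Suc n))))"
    have s: "s n > 0" for n using r by (simp add: s_def add_nonneg_pos)
    have "(\<lambda>n. r / (norm b + 1) * inverse (real (Suc (Suc n)))) \<longlonglongrightarrow> r / (norm b + 1) * 0"
      by (intro tendsto_intros LIMSEQ_Suc[OF LIMSEQ_inverse_real_of_nat])
    then have s0: "s \<longlonglongrightarrow> 0" by (simp add: s_def)
    have inU: "u + s n *\<^sub>R b \<in> U" "Im (u + s n *\<^sub>R b) \<ge> 0" for n
    proof -
      have "norm (s n *\<^sub>R b) = s n * norm b" using s[of n] by simp
      also have "\<dots> \<le> s n * (norm b + 1)" using s[of n] by simp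
      also have "\<dots> = r * inverse (real (Suc (Suc n)))" by (simp add: s_def add_nonneg_eq_0_iff)
      also have "\<dots> < r * 1"
        using r by (intro mult_strict_left_mono) (simp_all add: inverse_less_1_iff)
      finally have "norm (s n *\<^sub>R b) < r" by simp
      then show "u + s n *\<^sub>R b \<in> U" using r(2) by (auto simp: dist_norm subset_iff)
      show "Im (u + s n *\<^sub>R b) \<ge> 0" using X(3) b s[of n] by simp
    qed
    define y where "y = (\<lambda>n. \<psi> (X (u + s n *\<^sub>R b)))"
    have yX: "X (u + s n *\<^sub>R b) = \<phi> (y n)" for n using \<phi>_\<psi>[OF XE[OF inU]] by (simp add: y_def)
    have "(\<lambda>n. u + s n *\<^sub>R b) \<longlonglongrightarrow> u + 0 *\<^sub>R b" by (intro tendsto_intros s0)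
    then have "(\<lambda>n. X (u + s n *\<^sub>R b)) \<longlonglongrightarrow> X u"
      using has_derivative_continuous[OF DX(1)] by (auto intro: isCont_tendsto_compose)
    moreover have "continuous_on E \<psi>" using homeo by (simp add: homeomorphism_def)
    ultimately have "y \<longlonglongrightarrow> \<psi> (X u)"
      unfolding y_def using XE inU X
      by (intro continuous_on_tendsto_compose[of E \<psi>]) (auto simp: \<phi>_in[OF zd])
    then have y: "y \<longlonglongrightarrow> z" by (simp add: X(4) \<psi>_\<phi>[OF zd])
    show ?thesis
      using second_order_contact[OF C2 X(2) twice_differentiable z inj_tangent[OF z] s s0 y yX X(4)] by metis
  qed
  show ?thesis
  proof (cases "Im a \<ge> 0")
    case True then show ?thesis using upper that by blast
  next
    case False
    then obtain w where w: "frechet_derivative \<phi> (at z) w = frechet_derivative X (at u) (- a)"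
      "\<And>N. (\<And>k. frechet_derivative \<phi> (at z) k \<bullet> N = 0) \<Longrightarrow> hessian X u (- a) (- a) \<bullet> N = hessian \<phi> z w w \<bullet> N"
      using upper[of "- a"] by auto
    have "hessian X u (- a) (- a) = hessian X u a a"
      by (simp add: linear_neg[OF DX(4)] linear_neg[OF linear_hessian_right[OF C2 X(2)]])
    moreover have "hessian \<phi> z (- w) (- w) = hessian \<phi> z w w"
      by (simp add: linear_neg[OF D(4)] linear_neg[OF linear_hessian_right[OF twice_differentiable z]])
    ultimately show ?thesis
      using that[of "- w"] w by (simp add: linear_neg[OF D(3)] linear_neg[OF DX(3)])
  qed
qed

text \<open>
  A vector of Euclidean length \<open>t\<close> at height \<open>t\<close> is a hyperbolic unit vector.
\<close>

definition tangent_normal :: "complex \<Rightarrow> complex \<times> real \<Rightarrow> bool" where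
  "tangent_normal z N \<longleftrightarrow> norm N = snd (\<phi> z) \<and> (\<forall>k. frechet_derivative \<phi> (at z) k \<bullet> N = 0)"

lemma tangent_if_orthogonal_to_normal:
  assumes z: "z \<in> interior punctured_disk"
    and N: "\<And>k. frechet_derivative \<phi> (at z) k \<bullet> N = 0" "N \<noteq> 0"
    and v: "v \<bullet> N = 0"
  obtains w where "v = frechet_derivative \<phi> (at z) w"
proof -
  note D = twice_differentiable_onD[OF twice_differentiable z]
  let ?R = "range (frechet_derivative \<phi> (at z))"
  have R: "subspace ?R" using D(3) by (simp add: linear_subspace_image)
  have "dim ?R = dim (UNIV :: complex set)" by (rule dim_image_eq[OF D(3)]) (use inj_tangent[OF z] in auto)
  then have dR: "dim ?R = 2" by simp
  have "dim {x. N \<bullet> x = 0} = DIM(complex \<times> real) - 1" by (rule dim_hyperplane[OF N(2)])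
  then have dH: "dim {x. N \<bullet> x = 0} = 2" by simp
  have "?R = {x. N \<bullet> x = 0}"
    by (rule subspace_dim_equal[OF R subspace_hyperplane]) (use N(1) dR dH in \<open>auto simp: inner_commute\<close>)
  then have "v \<in> ?R" using v by (simp add: inner_commute)
  then show ?thesis using that by blast
qed

lemma tangent_normal_unique:
  assumes z: "z \<in> interior punctured_disk" and N: "tangent_normal z N" "tangent_normal z N'"
  shows "N' = N \<or> N' = - N"
proof -
  have pos: "snd (\<phi> z) > 0" using \<phi>_in[of z] z interior_subset subset_H3 by (auto simp: H3_def)
  have n: "norm N = snd (\<phi> z)" "norm N' = snd (\<phi> z)" and N0: "N \<noteq> 0"
    using N pos by (auto simp: tangent_normal_def)
  define c where "c = (N' \<bullet> N) / (N \<bullet> N)"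
  define v where "v = N' - c *\<^sub>R N"
  have "v \<bullet> N = 0" using N0 by (simp add: v_def c_def inner_diff_left)
  obtain w where w: "v = frechet_derivative \<phi> (at z) w"
  proof (rule tangent_if_orthogonal_to_normal[OF z _ N0 \<open>v \<bullet> N = 0\<close>])
    show "frechet_derivative \<phi> (at z) k \<bullet> N = 0" for k using N(1) by (simp add: tangent_normal_def)
  qed
  have "v \<bullet> v = v \<bullet> N' - c * (v \<bullet> N)" by (simp add: v_def inner_diff_right)
  also have "\<dots> = 0" using N w by (simp add: tangent_normal_def)
  finally have "N' = c *\<^sub>R N" by (simp add: v_def)
  moreover from this have "\<bar>c\<bar> = 1" using n pos by simp
  ultimately show ?thesis by (auto simp: abs_if split: if_splits)
qed

definition second_ff_trace :: "complex \<Rightarrow> complex \<times> real \<Rightarrow> real" where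
  "second_ff_trace z N = (second_ff \<phi> z N 1 1 + second_ff \<phi> z N \<i> \<i>) / first_ff \<phi> z 1 1"

text \<open>
  By \<open>patch_second_order\<close> any patch has the tangent plane of \<open>\<phi>\<close>, and its second fundamental form on principal
  directions is that of \<open>\<phi>\<close> on the corresponding vectors. These are orthonormal for the first fundamental form
  of \<open>\<phi>\<close>, so conformality lets the trace be computed from \<open>1, \<i>\<close>, independently of the patch.
\<close>

lemma has_mean_curvatureD:
  assumes z: "z \<in> interior punctured_disk" and mc: "has_mean_curvature E (\<phi> z) N h"
  shows "tangent_normal z N" and "h = second_ff_trace z N / 2"
proof -
  note D = twice_differentiable_onD[OF twice_differentiable z]
  let ?D = "frechet_derivative \<phi> (at z)"
  obtain U X u \<kappa>1 \<kappa>2 where X: "surface_patch E U X" "u \<in> U" "Im u \<ge> 0" "X u = \<phi> z"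
    and N: "unit_normal X u N" and pc: "principal_curvatures X u N \<kappa>1 \<kappa>2" and h: "h = (\<kappa>1 + \<kappa>2) / 2"
    using mc unfolding has_mean_curvature_def by blast
  have pos: "snd (\<phi> z) > 0" using \<phi>_in[of z] z interior_subset subset_H3 by (auto simp: H3_def)
  let ?DX = "frechet_derivative X (at u)"
  have C2: "twice_differentiable_on U X" and injX: "inj ?DX"
    using X smooth_on_imp_twice_differentiable_on by (auto simp: surface_patch_def)
  note DX = twice_differentiable_onD[OF C2 X(2)]
  have "norm N = snd (\<phi> z)"
  proof -
    have "(N \<bullet> N) / (snd (\<phi> z))\<^sup>2 = 1" using N unfolding unit_normal_def hyp_inner_def X by blast
    then have "(norm N)\<^sup>2 = (snd (\<phi> z))\<^sup>2"
      unfolding dot_square_norm by (metis divide_eq_1_iff)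
    then show ?thesis using pos by (metis less_imp_le norm_ge_zero power2_eq_imp_eq)
  qed
  moreover have normal: "?D k \<bullet> N = 0" for k
  proof -
    have RX: "?DX a \<in> range ?D" for a by (rule patch_second_order[OF z X, of a]) (metis rangeI)
    have sX: "subspace (range ?DX)" "subspace (range ?D)" using DX(3) D(3) by (simp_all add: linear_subspace_image)
    have "dim (range ?DX) = dim (UNIV :: complex set)" by (rule dim_image_eq[OF DX(3)]) (use injX in auto)
    moreover have "dim (range ?D) = dim (UNIV :: complex set)"
      by (rule dim_image_eq[OF D(3)]) (use inj_tangent[OF z] in auto)
    ultimately have "range ?DX = range ?D"
      by (intro subspace_dim_equal sX) (use RX in auto)
    then obtain a where "?D k = ?DX a" by blast
    moreover have "?DX a \<bullet> N = 0" using N pos by (simp add: unit_normal_def hyp_inner_def X)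
    ultimately show ?thesis by simp
  qed
  ultimately show "tangent_normal z N" by (simp add: tangent_normal_def)
  obtain a b where ab: "first_ff X u a a = 1" "first_ff X u b b = 1" "first_ff X u a b = 0"
    and \<kappa>: "second_ff X u N a a = \<kappa>1" "second_ff X u N b b = \<kappa>2"
    using pc unfolding principal_curvatures_def by blast
  obtain v where v: "?D v = ?DX a" "hessian X u a a \<bullet> N = hessian \<phi> z v v \<bullet> N"
    using patch_second_order[OF z X, of a] normal by metis
  obtain w where w: "?D w = ?DX b" "hessian X u b b \<bullet> N = hessian \<phi> z w w \<bullet> N"
    using patch_second_order[OF z X, of b] normal by metis
  have vw: "first_ff \<phi> z v v = 1" "first_ff \<phi> z w w = 1" "first_ff \<phi> z v w = 0"
    using ab by (simp_all add: first_ff_def v w X)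
  have sv: "second_ff \<phi> z N v v = \<kappa>1" "second_ff \<phi> z N w w = \<kappa>2"
    using \<kappa> by (simp_all add: second_ff_hessian hyp_inner_def inner_add_left v w X)
  obtain c where c: "c > 0" "\<And>a b. first_ff \<phi> z a b = c * (a \<bullet> b)" using conformal[OF z] by blast
  have ff: "second_ff \<phi> z N a b = (1 / (snd (\<phi> z))\<^sup>2) * (hessian \<phi> z a b \<bullet> N)
      + (snd N / (snd (\<phi> z)) ^ 3) * (?D a \<bullet> ?D b)" for a b
  proof -
    have e: "(0, 1) \<bullet> N = snd N" by (simp add: inner_prod_def)
    have "second_ff \<phi> z N a b = (hessian \<phi> z a b \<bullet> N + (1 / snd (\<phi> z)) * ((?D a \<bullet> ?D b) * snd N)) / (snd (\<phi> z))\<^sup>2"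
      unfolding second_ff_hessian hyp_inner_def hyp_christoffel_def inner_add_left inner_diff_left inner_scaleR_left e normal
      by simp
    moreover have "(x + (1 / t) * (y * n)) / t\<^sup>2 = (1 / t\<^sup>2) * x + (n / t ^ 3) * y" for x y t n :: real
      by (simp add: add_divide_distrib power2_eq_square power3_eq_cube mult_ac)
    ultimately show ?thesis by simp
  qed
  obtain \<alpha> \<beta> where ff': "\<And>a b. second_ff \<phi> z N a b = \<alpha> * (hessian \<phi> z a b \<bullet> N) + \<beta> * (?D a \<bullet> ?D b)"
    using ff by blast
  have "bilinear (second_ff \<phi> z N)"
    unfolding bilinear_def ff'
    using D(3,4) linear_hessian_right[OF twice_differentiable z]
    by (auto intro!: linearI simp: linear_add linear_cmul linear_add[OF D(4)] linear_cmul[OF D(4)]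
        inner_add_left inner_add_right distrib_left)
  from isotropic_trace[OF this c(1), of v w] vw
  have "\<kappa>1 + \<kappa>2 = (second_ff \<phi> z N 1 1 + second_ff \<phi> z N \<i> \<i>) / c"
    by (simp add: c(2) sv)
  also have "c = first_ff \<phi> z 1 1" by (simp add: c(2) inner_complex_def)
  finally show "h = second_ff_trace z N / 2" by (simp add: h second_ff_trace_def)
qed

text \<open>
  The only freedom left is the sign of the normal, and \<open>h *\<^sub>R N\<close> is even in \<open>N\<close>.
\<close>

lemma mean_curvature_vector_eq:
  assumes z: "z \<in> interior punctured_disk" and mc: "has_mean_curvature E (\<phi> z) N h"
  shows "mean_curvature_vector E (\<phi> z) = h *\<^sub>R N"
  unfolding mean_curvature_vector_def
proof (rule the_equality)
  show "\<exists>N' h'. has_mean_curvature E (\<phi> z) N' h' \<and> h *\<^sub>R N = h' *\<^sub>R N'" using mc by blast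
  fix V assume "\<exists>N' h'. has_mean_curvature E (\<phi> z) N' h' \<and> V = h' *\<^sub>R N'"
  then obtain N' h' where N': "has_mean_curvature E (\<phi> z) N' h'" and V: "V = h' *\<^sub>R N'" by blast
  have "second_ff \<phi> z (- N) a b = - second_ff \<phi> z N a b" for a b
    by (simp add: second_ff_def hyp_inner_def)
  then have "second_ff_trace z (- N) = - second_ff_trace z N"
    by (simp only: second_ff_trace_def minus_divide_left minus_add_distrib)
  moreover have "N' = N \<or> N' = - N"
    using tangent_normal_unique[OF z has_mean_curvatureD(1)[OF z mc] has_mean_curvatureD(1)[OF z N']] .
  ultimately have "N' = N \<or> N' = - N" by blast
  then show "V = h *\<^sub>R N"
  proof
    assume "N' = - N"
    moreover from this have "h' = - h"
      using has_mean_curvatureD(2)[OF z mc] has_mean_curvatureD(2)[OF z N'] \<open>second_ff_trace z (- N) = - second_ff_trace z N\<close>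
      by simp
    ultimately show ?thesis using V by simp
  qed (use has_mean_curvatureD(2)[OF z mc] has_mean_curvatureD(2)[OF z N'] V in simp)
qed

end

section \<open>Geodesic rays of the half-space model\<close>

text \<open>
  The Euclidean unit vector at \<open>p\<close> that points along the hyperbolic geodesic from \<open>p\<close> to \<open>\<xi>\<close>: it is normal to
  the horosphere through \<open>p\<close> based at \<open>\<xi>\<close>, a Euclidean sphere touching the boundary plane at \<open>g\<close>, or a horizontal plane.
\<close>

definition ideal_direction :: "sphere_at_infinity \<Rightarrow> complex \<times> real \<Rightarrow> complex \<times> real" where
  "ideal_direction \<xi> p =
     (case \<xi> of None \<Rightarrow> (0, 1)
      | Some g \<Rightarrow> (0, 1) + (2 * snd p / (norm ((g, 0) - p))\<^sup>2) *\<^sub>R ((g, 0) - p))"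

lemma norm_Pair_sq: "(norm (x, t))\<^sup>2 = (norm x)\<^sup>2 + (norm t)\<^sup>2"
  by (simp add: norm_Pair)

text \<open>
  Solving the formula for the endpoint: a vector \<open>(a, b)\<close> of length \<open>t\<close> at \<open>(x, t)\<close> points to
  \<open>x + t a / (t - b)\<close>, the stereographic projection of its direction.
\<close>

lemma exists_ideal_direction:
  assumes "q \<in> H3" and "norm v = snd q"
  obtains \<xi> where "v = snd q *\<^sub>R ideal_direction \<xi> q"
proof -
  obtain x t where q: "q = (x, t)" by (cases q)
  have t: "t > 0" using assms q by (simp add: H3_def)
  obtain a b where v: "v = (a, b)" by (cases v)
  have ab: "(norm a)\<^sup>2 + b\<^sup>2 = t\<^sup>2"
    using assms(2) q v norm_Pair_sq[of a b] by simp
  show ?thesis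
  proof (cases "b = t")
    case True
    with ab have "a = 0" by simp
    then have "v = snd q *\<^sub>R ideal_direction None q"
      using True q v by (simp add: ideal_direction_def)
    then show ?thesis by (rule that)
  next
    case False
    have b: "t - b \<noteq> 0" using False by simp
    define d where "d = (t / (t - b)) *\<^sub>R a"
    have nd: "(norm d)\<^sup>2 = t\<^sup>2 * (t + b) / (t - b)"
    proof -
      have "(norm d)\<^sup>2 = (t / (t - b))\<^sup>2 * (norm a)\<^sup>2"
        by (simp add: d_def power_mult_distrib power_divide)
      also have "(norm a)\<^sup>2 = (t - b) * (t + b)" using ab by (simp add: algebra_simps power2_eq_square)
      also have "(t / (t - b))\<^sup>2 * ((t - b) * (t + b)) = t\<^sup>2 * (t + b) / (t - b)"
        using b by (simp add: power2_eq_square)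
      finally show ?thesis .
    qed
    have D: "(norm ((x + d, 0) - q))\<^sup>2 = 2 * t ^ 3 / (t - b)"
    proof -
      have "(norm ((x + d, 0) - q))\<^sup>2 = (norm d)\<^sup>2 + t\<^sup>2" by (simp add: q norm_Pair_sq)
      then show ?thesis
        unfolding nd using b by (simp add: field_simps power2_eq_square power3_eq_cube)
    qed
    have c: "2 * t / (norm ((x + d, 0) - q))\<^sup>2 = (t - b) / t\<^sup>2"
      unfolding D using t b by (simp add: field_simps power2_eq_square power3_eq_cube)
    have "snd q *\<^sub>R ideal_direction (Some (x + d)) q = t *\<^sub>R ((0, 1) + ((t - b) / t\<^sup>2) *\<^sub>R ((x + d, 0) - q))"
      using c by (simp add: ideal_direction_def q)
    also have "\<dots> = (((t - b) / t) *\<^sub>R d, t - (t - b))"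
      using t by (simp add: q field_simps power2_eq_square)
    also have "\<dots> = v" using t b by (simp add: v d_def)
    finally have "v = snd q *\<^sub>R ideal_direction (Some (x + d)) q" by simp
    then show ?thesis by (rule that)
  qed
qed

lemma has_vector_derivative_scaleR_Pair:
  fixes a b :: "real \<Rightarrow> real" and c d :: complex
  assumes "(a has_real_derivative a') (at s within S)" and "(b has_real_derivative b') (at s within S)"
  shows "((\<lambda>s. (c - a s *\<^sub>R d, b s)) has_vector_derivative (- a' *\<^sub>R d, b')) (at s within S)"
    and "((\<lambda>s. (a s *\<^sub>R d, b s)) has_vector_derivative (a' *\<^sub>R d, b')) (at s within S)"
  using assms unfolding has_real_derivative_iff_has_vector_derivative[of b]
  by (auto intro!: derivative_eq_intros)

text \<open>
  The rays are explicit: a vertical half-line, or a semicircle orthogonal to the boundary plane, with height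
  \<open>D t / P\<close> where \<open>P\<close> is a combination of \<open>exp s\<close> and \<open>exp (- s)\<close>.
\<close>

lemma geodesic_ray_towards:
  assumes "q \<in> H3"
  obtains \<gamma> where "geodesic_ray q (snd q *\<^sub>R ideal_direction \<xi> q) \<gamma>"
    and "filterlim \<gamma> (ideal_nhds \<xi>) at_top"
proof -
  obtain x t where q: "q = (x, t)" by (cases q)
  have t: "t > 0" using assms q by (simp add: H3_def)
  show ?thesis
  proof (cases \<xi>)
    case None
    define \<gamma> where "\<gamma> = (\<lambda>s. (x, t * exp s))"
    define \<gamma>' where "\<gamma>' = (\<lambda>s. (0::complex, t * exp s))"
    have "geodesic_ray q (snd q *\<^sub>R ideal_direction \<xi> q) \<gamma>"
      unfolding geodesic_ray_def
    proof (intro conjI exI[of _ \<gamma>'] allI impI)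
      fix s :: real
      have d: "((\<lambda>s. t * exp s) has_vector_derivative t * exp s) (at s within {0..})"
        unfolding has_real_derivative_iff_has_vector_derivative[symmetric]
        by (auto intro!: derivative_eq_intros)
      show "\<gamma> s \<in> H3" using t by (simp add: H3_def \<gamma>_def)
      show "(\<gamma> has_vector_derivative \<gamma>' s) (at s within {0..})"
        unfolding \<gamma>_def \<gamma>'_def by (intro derivative_intros d)
      show "(\<gamma>' has_vector_derivative - hyp_christoffel (\<gamma> s) (\<gamma>' s) (\<gamma>' s)) (at s within {0..})"
        proof -
        have "- hyp_christoffel (\<gamma> s) (\<gamma>' s) (\<gamma>' s) = (0, t * exp s)"
          using t by (simp add: hyp_christoffel_def \<gamma>_def \<gamma>'_def)
        then show ?thesis
          unfolding \<gamma>'_def by (auto intro!: derivative_intros d)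
      qed
    qed (auto simp: \<gamma>_def \<gamma>'_def q None ideal_direction_def)
    moreover have "filterlim \<gamma> (ideal_nhds \<xi>) at_top"
      unfolding None ideal_nhds_def option.case
    proof (rule filterlim_inf[THEN iffD2], intro conjI)
      have "filterlim (\<lambda>s. t * exp s) at_top at_top"
        using t by (intro filterlim_tendsto_pos_mult_at_top[OF tendsto_const] exp_at_top) auto
      then have "filterlim (\<lambda>s. norm (\<gamma> s)) at_top at_top"
      proof (rule filterlim_at_top_mono)
        show "\<forall>\<^sub>F s in at_top. t * exp s \<le> norm (\<gamma> s)"
          unfolding \<gamma>_def using norm_snd_le[of "(x, t * exp s)" for s] t
          by (auto intro!: always_eventually simp: abs_mult) (smt (verit) exp_ge_zero mult_nonneg_nonneg real_norm_def snd_conv norm_snd_le)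
      qed
      then show "filterlim \<gamma> at_infinity at_top" by (rule filterlim_norm_at_top_imp_at_infinity)
      show "filterlim \<gamma> (principal H3) at_top"
        using t by (auto simp: filterlim_principal H3_def \<gamma>_def)
    qed
    ultimately show ?thesis by (rule that)
  next
    case (Some g)
    define d where "d = g - x"
    define D where "D = (norm d)\<^sup>2 + t\<^sup>2"
    define P where "P = (\<lambda>s. t\<^sup>2 * exp s + (norm d)\<^sup>2 * exp (- s))"
    define M where "M = (\<lambda>s. t\<^sup>2 * exp s - (norm d)\<^sup>2 * exp (- s))"
    have D: "D > 0" using t by (simp add: D_def add_nonneg_pos)
    have P: "P s > 0" for s using t by (simp add: P_def add_pos_nonneg)
    have P0: "P 0 = D" "M 0 = t\<^sup>2 - (norm d)\<^sup>2" by (simp_all add: P_def M_def D_def)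
    have dP: "(P has_real_derivative M s) (at s within A)" for s A
      unfolding P_def M_def by (auto intro!: derivative_eq_intros)
    have dM: "(M has_real_derivative P s) (at s within A)" for s A
      unfolding P_def M_def by (auto intro!: derivative_eq_intros)
    have PM: "(P s)\<^sup>2 = (M s)\<^sup>2 + 4 * t\<^sup>2 * (norm d)\<^sup>2" for s
    proof -
      have "exp s * exp (- s) = 1" by (simp add: exp_minus)
      then show ?thesis unfolding P_def M_def by algebra
    qed
    define \<gamma> where "\<gamma> = (\<lambda>s. (g - (D * exp (- s) / P s) *\<^sub>R d, D * t / P s))"
    define \<gamma>' where "\<gamma>' = (\<lambda>s. ((2 * t\<^sup>2 * D / (P s)\<^sup>2) *\<^sub>R d, - D * t * M s / (P s)\<^sup>2))"
    have "geodesic_ray q (snd q *\<^sub>R ideal_direction \<xi> q) \<gamma>"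
      unfolding geodesic_ray_def
    proof (intro conjI exI[of _ \<gamma>'] allI impI)
      show "\<gamma> 0 = q" using D by (simp add: \<gamma>_def q P0 d_def)
      have "(norm ((g, 0) - q))\<^sup>2 = D" by (simp add: q D_def d_def norm_Pair_sq)
      then have "snd q *\<^sub>R ideal_direction \<xi> q = t *\<^sub>R ((0, 1) + (2 * t / D) *\<^sub>R (d, - t))"
        by (simp add: ideal_direction_def Some q d_def)
      also have "\<dots> = \<gamma>' 0"
        using D by (simp add: \<gamma>'_def P0 power2_eq_square field_simps) (simp add: D_def power2_eq_square algebra_simps)
      finally show "\<gamma>' 0 = snd q *\<^sub>R ideal_direction \<xi> q" by simp
      fix s :: real
      show "\<gamma> s \<in> H3" using t D P[of s] by (simp add: H3_def \<gamma>_def)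
      have e: "D * (exp (- s) * M s) + D * (exp (- s) * P s) = 2 * t\<^sup>2 * D"
      proof -
        have "exp s * exp (- s) = 1" by (simp add: exp_minus)
        then show ?thesis unfolding P_def M_def by algebra
      qed
      have "((\<lambda>s. D * exp (- s) / P s) has_real_derivative (- 2 * t\<^sup>2 * D / (P s)\<^sup>2)) (at s within {0..})"
      proof -
        have "((\<lambda>s. D * exp (- s) / P s) has_real_derivative
            - (D * (exp (- s) * M s) + D * (exp (- s) * P s)) / (P s)\<^sup>2) (at s within {0..})"
          using P[of s] by (auto intro!: derivative_eq_intros dP simp: field_simps power2_eq_square)
        then show ?thesis unfolding e by simp
      qed
      moreover have "((\<lambda>s. D * t / P s) has_real_derivative (- D * t * M s / (P s)\<^sup>2)) (at s within {0..})"
        using P[of s] by (auto intro!: derivative_eq_intros dP simp: field_simps power2_eq_square)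
      ultimately show "(\<gamma> has_vector_derivative \<gamma>' s) (at s within {0..})"
        unfolding \<gamma>_def \<gamma>'_def
        by (rule has_vector_derivative_scaleR_Pair(1)[THEN has_vector_derivative_eq_rhs]) simp
      have d1: "((\<lambda>s. 2 * t\<^sup>2 * D / (P s)\<^sup>2) has_real_derivative (- 4 * t\<^sup>2 * D * M s / (P s) ^ 3)) (at s within {0..})"
        using P[of s] by (auto intro!: derivative_eq_intros dP simp: field_simps power2_eq_square power3_eq_cube)
      have d2: "((\<lambda>s. - D * t * M s / (P s)\<^sup>2) has_real_derivative (D * t * ((M s)\<^sup>2 - 4 * t\<^sup>2 * (norm d)\<^sup>2) / (P s) ^ 3)) (at s within {0..})"
      proof -
        have *: "4 * t\<^sup>2 * (norm d)\<^sup>2 = (P s)\<^sup>2 - (M s)\<^sup>2" using PM[of s] by simp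
        show ?thesis unfolding * using P[of s]
          by (auto intro!: derivative_eq_intros dP dM simp: field_simps power2_eq_square power3_eq_cube)
      qed
      have "- hyp_christoffel (\<gamma> s) (\<gamma>' s) (\<gamma>' s)
            = ((- 4 * t\<^sup>2 * D * M s / (P s) ^ 3) *\<^sub>R d, D * t * ((M s)\<^sup>2 - 4 * t\<^sup>2 * (norm d)\<^sup>2) / (P s) ^ 3)"
      proof -
        have nz: "P s \<noteq> 0" "D \<noteq> 0" "t \<noteq> 0" using P[of s] D t by auto
        have dd: "d \<bullet> d = (norm d)\<^sup>2" by (simp add: power2_norm_eq_inner)
        show ?thesis
          unfolding hyp_christoffel_def \<gamma>_def \<gamma>'_def
          using nz by (simp add: dd inner_prod_def power2_eq_square power3_eq_cube scaleR_left_distrib[symmetric])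
            (simp add: field_simps)
      qed
      then show "(\<gamma>' has_vector_derivative - hyp_christoffel (\<gamma> s) (\<gamma>' s) (\<gamma>' s)) (at s within {0..})"
        unfolding \<gamma>'_def by (simp only: has_vector_derivative_scaleR_Pair(2)[OF d1 d2])
    qed
    moreover have "filterlim \<gamma> (ideal_nhds \<xi>) at_top"
      unfolding Some ideal_nhds_def option.case
    proof (rule filterlim_inf[THEN iffD2], intro conjI)
      have lim: "((\<lambda>s. inverse (P s)) \<longlongrightarrow> 0) at_top"
      proof (rule tendsto_inverse_0_at_top, rule filterlim_at_top_mono)
        show "filterlim (\<lambda>s. t\<^sup>2 * exp s) at_top at_top"
          using t by (intro filterlim_tendsto_pos_mult_at_top[OF tendsto_const] exp_at_top) auto
        show "\<forall>\<^sub>F s in at_top. t\<^sup>2 * exp s \<le> P s" by (simp add: P_def)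
      qed
      have lim2: "((\<lambda>s::real. exp (- s)) \<longlongrightarrow> 0) at_top"
        using exp_at_bot filterlim_compose filterlim_uminus_at_bot_at_top by blast
      have "((\<lambda>s. (g - (D * exp (- s) * inverse (P s)) *\<^sub>R d, D * t * inverse (P s))) \<longlongrightarrow> (g - (D * 0 * 0) *\<^sub>R d, D * t * 0)) at_top"
        by (intro tendsto_intros lim lim2)
      then show "filterlim \<gamma> (nhds (g, 0)) at_top"
        by (simp add: \<gamma>_def divide_inverse)
      show "filterlim \<gamma> (principal H3) at_top"
        using t D P by (auto simp: filterlim_principal H3_def \<gamma>_def)
    qed
    ultimately show ?thesis by (rule that)
  qed
qed

text \<open>
  Along a geodesic \<open>(x, t)\<close> of unit speed the horizontal momentum \<open>x' / t\<^sup>2\<close> is conserved, and \<open>w = 1 / t\<close> satisfies the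
  linear equation \<open>w'' = w\<close>. Hence \<open>(w + w') exp (- s)\<close> and \<open>(w - w') exp s\<close> are constant, which determines the height.
\<close>

lemma geodesic_ray_first_integrals:
  assumes geo: "geodesic_ray q v \<gamma>" and unit: "hyp_inner q v v = 1" and s: "s \<ge> 0"
  shows "((\<lambda>s. fst (\<gamma> s)) has_vector_derivative ((snd (\<gamma> s))\<^sup>2 / (snd q)\<^sup>2) *\<^sub>R fst v) (at s within {0..})"
    and "2 / snd (\<gamma> s) = (1 / snd q - snd v / (snd q)\<^sup>2) * exp s + (1 / snd q + snd v / (snd q)\<^sup>2) * exp (- s)"
proof -
  obtain \<gamma>' where \<gamma>0: "\<gamma> 0 = q" "\<gamma>' 0 = v" and H: "\<And>s. s \<ge> 0 \<Longrightarrow> \<gamma> s \<in> H3"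
    and d\<gamma>: "\<And>s. s \<ge> 0 \<Longrightarrow> (\<gamma> has_vector_derivative \<gamma>' s) (at s within {0..})"
    and d\<gamma>': "\<And>s. s \<ge> 0 \<Longrightarrow> (\<gamma>' has_vector_derivative - hyp_christoffel (\<gamma> s) (\<gamma>' s) (\<gamma>' s)) (at s within {0..})"
    using geo unfolding geodesic_ray_def by blast
  define t where "t = (\<lambda>s. snd (\<gamma> s))"
  define a where "a = (\<lambda>s. fst (\<gamma>' s))"
  define b where "b = (\<lambda>s. snd (\<gamma>' s))"
  have t: "t s > 0" if "s \<ge> 0" for s using H[OF that] by (simp add: H3_def t_def)
  have dx: "((\<lambda>s. fst (\<gamma> s)) has_vector_derivative a s) (at s within {0..})" if "s \<ge> 0" for s
    using d\<gamma>[OF that] unfolding a_def by (rule bounded_linear.has_vector_derivative[OF bounded_linear_fst])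
  have dt: "(t has_real_derivative b s) (at s within {0..})" if "s \<ge> 0" for s
    using bounded_linear.has_vector_derivative[OF bounded_linear_snd d\<gamma>[OF that]]
    unfolding b_def t_def has_real_derivative_iff_has_vector_derivative .
  have chr: "- hyp_christoffel (\<gamma> s) (\<gamma>' s) (\<gamma>' s)
      = ((2 * b s / t s) *\<^sub>R a s, ((b s)\<^sup>2 - (norm (a s))\<^sup>2) / t s)" if "s \<ge> 0" for s
  proof -
    have "\<gamma>' s = (a s, b s)" "\<gamma> s = (fst (\<gamma> s), t s)" by (simp_all add: a_def b_def t_def)
    then show ?thesis
      using t[OF that] unfolding hyp_christoffel_def
      by (simp add: prod_eq_iff inner_prod_def power2_norm_eq_inner[symmetric] scaleR_left_distrib[symmetric])
        (simp add: field_simps power2_eq_square complex_eq_iff)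
  qed
  have da: "(a has_vector_derivative (2 * b s / t s) *\<^sub>R a s) (at s within {0..})" if "s \<ge> 0" for s
    using bounded_linear.has_vector_derivative[OF bounded_linear_fst d\<gamma>'[OF that]]
    unfolding chr[OF that] a_def by simp
  have db: "(b has_real_derivative ((b s)\<^sup>2 - (norm (a s))\<^sup>2) / t s) (at s within {0..})" if "s \<ge> 0" for s
    using bounded_linear.has_vector_derivative[OF bounded_linear_snd d\<gamma>'[OF that]]
    unfolding chr[OF that] b_def has_real_derivative_iff_has_vector_derivative by simp
  have const: "f s = f 0" if "\<And>s. s \<ge> 0 \<Longrightarrow> (f has_real_derivative 0) (at s within {0..})" "s \<ge> 0"
    for f :: "real \<Rightarrow> real" and s
  proof -
    have "\<exists>c. \<forall>x\<in>{0..}. f x = c"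
      by (rule has_field_derivative_zero_constant) (use that in auto)
    then show ?thesis using that(2) by force
  qed
  define m where "m = (\<lambda>s. (norm (a s))\<^sup>2)"
  have dn: "(m has_real_derivative 4 * b s / t s * m s) (at s within {0..})"
    if "s \<ge> 0" for s
  proof -
    have "((\<lambda>s. a s \<bullet> a s) has_derivative
        (\<lambda>x. a s \<bullet> (x *\<^sub>R ((2 * b s / t s) *\<^sub>R a s)) + (x *\<^sub>R ((2 * b s / t s) *\<^sub>R a s)) \<bullet> a s)) (at s within {0..})"
      by (rule has_derivative_inner; rule da[OF that, unfolded has_vector_derivative_def])
    then show ?thesis
      unfolding has_field_derivative_def m_def power2_norm_eq_inner
      by (rule has_derivative_eq_rhs) (auto simp: field_simps)
  qed
  have db': "(b has_real_derivative ((b s)\<^sup>2 - m s) / t s) (at s within {0..})" if "s \<ge> 0" for s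
    using db[OF that] by (simp add: m_def)
  have energy: "(m s + (b s)\<^sup>2) / (t s)\<^sup>2 = 1" if "s \<ge> 0" for s
  proof -
    have "((\<lambda>s. (m s + (b s)\<^sup>2) / (t s)\<^sup>2) has_real_derivative 0) (at s within {0..})" if "s \<ge> 0" for s
      using t[OF that] by (auto intro!: derivative_eq_intros dn[OF that] db'[OF that] dt[OF that]
        simp: field_simps power2_eq_square)
    from const[OF this that] have "(m s + (b s)\<^sup>2) / (t s)\<^sup>2 = (m 0 + (b 0)\<^sup>2) / (t 0)\<^sup>2" .
    also have "\<dots> = 1"
    proof -
      have "v \<bullet> v = m 0 + (b 0)\<^sup>2"
        by (simp add: inner_prod_def m_def a_def b_def \<gamma>0 dot_square_norm power2_eq_square[of "snd v"])
      with unit show ?thesis unfolding hyp_inner_def t_def \<gamma>0 by (simp only:)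
    qed
    finally show ?thesis .
  qed
  have n2: "(norm (a s))\<^sup>2 = (t s)\<^sup>2 - (b s)\<^sup>2" if "s \<ge> 0" for s
    using energy[OF that] t[OF that] by (simp add: m_def field_simps)
  have db2: "(b has_real_derivative (2 * (b s)\<^sup>2 - (t s)\<^sup>2) / t s) (at s within {0..})" if "s \<ge> 0" for s
    using db[OF that] n2[OF that] by simp
  have mom: "(1 / (t s)\<^sup>2) *\<^sub>R a s = (1 / (t 0)\<^sup>2) *\<^sub>R a 0" if "s \<ge> 0" for s
  proof -
    have "((\<lambda>s. (1 / (t s)\<^sup>2) *\<^sub>R a s) has_vector_derivative 0) (at s within {0..})" if "s \<ge> 0" for s
    proof -
      have "((\<lambda>s. 1 / (t s)\<^sup>2) has_real_derivative (- 2 * b s / (t s) ^ 3)) (at s within {0..})"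
        using t[OF that] by (auto intro!: derivative_eq_intros dt[OF that] simp: field_simps power2_eq_square power3_eq_cube)
      from has_vector_derivative_scaleR[OF this da[OF that]] show ?thesis
        by (rule has_vector_derivative_eq_rhs)
          (use t[OF that] in \<open>simp add: scaleR_left_distrib[symmetric] field_simps power2_eq_square power3_eq_cube\<close>)
    qed
    then have "\<exists>c. \<forall>s\<in>{0..}. (1 / (t s)\<^sup>2) *\<^sub>R a s = c"
      using has_vector_derivative_zero_constant[of "{0..}" "\<lambda>s. (1 / (t s)\<^sup>2) *\<^sub>R a s"] by (metis atLeast_iff convex_real_interval(1))
    then show ?thesis using that by force
  qed
  have "a s = ((snd (\<gamma> s))\<^sup>2 / (snd q)\<^sup>2) *\<^sub>R fst v"
  proof -
    have "a s = (t s)\<^sup>2 *\<^sub>R ((1 / (t s)\<^sup>2) *\<^sub>R a s)" using t[OF s] by simp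
    also have "\<dots> = (t s)\<^sup>2 *\<^sub>R ((1 / (t 0)\<^sup>2) *\<^sub>R a 0)" using mom[OF s] by simp
    finally show ?thesis by (simp add: t_def a_def \<gamma>0)
  qed
  with dx[OF s] show "((\<lambda>s. fst (\<gamma> s)) has_vector_derivative ((snd (\<gamma> s))\<^sup>2 / (snd q)\<^sup>2) *\<^sub>R fst v) (at s within {0..})"
    by simp
  have "((\<lambda>s. (1 / t s - b s / (t s)\<^sup>2) * exp (- s)) has_real_derivative 0) (at s within {0..})" if "s \<ge> 0" for s
    using t[OF that] by (auto intro!: derivative_eq_intros db2[OF that] dt[OF that] simp: field_simps power2_eq_square)
  from const[OF this s] have 1: "(1 / t s - b s / (t s)\<^sup>2) * exp (- s) = 1 / snd q - snd v / (snd q)\<^sup>2"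
    by (simp add: t_def b_def \<gamma>0)
  have "((\<lambda>s. (1 / t s + b s / (t s)\<^sup>2) * exp s) has_real_derivative 0) (at s within {0..})" if "s \<ge> 0" for s
    using t[OF that] by (auto intro!: derivative_eq_intros db2[OF that] dt[OF that] simp: field_simps power2_eq_square)
  from const[OF this s] have 2: "(1 / t s + b s / (t s)\<^sup>2) * exp s = 1 / snd q + snd v / (snd q)\<^sup>2"
    by (simp add: t_def b_def \<gamma>0)
  have ee: "exp (- s) * exp s = 1" by (simp add: exp_minus)
  have "2 / t s = (1 / t s - b s / (t s)\<^sup>2) * (exp (- s) * exp s) + (1 / t s + b s / (t s)\<^sup>2) * (exp (- s) * exp s)"
    by (simp add: ee)
  also have "\<dots> = (1 / snd q - snd v / (snd q)\<^sup>2) * exp s + (1 / snd q + snd v / (snd q)\<^sup>2) * exp (- s)"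
    unfolding 1[symmetric] 2[symmetric] by (simp add: ac_simps)
  finally show "2 / snd (\<gamma> s) = (1 / snd q - snd v / (snd q)\<^sup>2) * exp s + (1 / snd q + snd v / (snd q)\<^sup>2) * exp (- s)"
    by (simp add: t_def)
qed

lemma geodesic_ray_unique:
  assumes g1: "geodesic_ray q v \<gamma>\<^sub>1" and g2: "geodesic_ray q v \<gamma>\<^sub>2"
    and unit: "hyp_inner q v v = 1" and s: "s \<ge> 0"
  shows "\<gamma>\<^sub>1 s = \<gamma>\<^sub>2 s"
proof -
  note i1 = geodesic_ray_first_integrals[OF g1 unit] and i2 = geodesic_ray_first_integrals[OF g2 unit]
  have z: "\<gamma>\<^sub>1 0 = q" "\<gamma>\<^sub>2 0 = q" using g1 g2 unfolding geodesic_ray_def by blast+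
  have t: "snd (\<gamma>\<^sub>1 s) = snd (\<gamma>\<^sub>2 s)" if "s \<ge> 0" for s
  proof -
    have "2 / snd (\<gamma>\<^sub>1 s) = 2 / snd (\<gamma>\<^sub>2 s)" using i1(2)[OF that] i2(2)[OF that] by simp
    then show ?thesis by (metis div_by_0 divide_cancel_left zero_neq_numeral)
  qed
  have "((\<lambda>s. fst (\<gamma>\<^sub>1 s) - fst (\<gamma>\<^sub>2 s)) has_vector_derivative 0) (at s within {0..})" if "s \<ge> 0" for s
    using has_vector_derivative_diff[OF i1(1)[OF that] i2(1)[OF that]] t[OF that] by simp
  then have "\<exists>c. \<forall>s\<in>{0..}. fst (\<gamma>\<^sub>1 s) - fst (\<gamma>\<^sub>2 s) = c"
    using has_vector_derivative_zero_constant[of "{0..}" "\<lambda>s. fst (\<gamma>\<^sub>1 s) - fst (\<gamma>\<^sub>2 s)"]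
    by (metis atLeast_iff convex_real_interval(1))
  then have "fst (\<gamma>\<^sub>1 s) - fst (\<gamma>\<^sub>2 s) = fst (\<gamma>\<^sub>1 0) - fst (\<gamma>\<^sub>2 0)" using s by fastforce
  then show ?thesis using t[OF s] by (simp add: z prod_eq_iff)
qed

lemma ideal_limit_unique:
  assumes "filterlim f (ideal_nhds \<xi>) F" and "filterlim f (ideal_nhds \<eta>) F" and "F \<noteq> bot"
  shows "\<xi> = \<eta>"
proof -
  have *: "filterlim f (nhds (z, 0)) F" if "filterlim f (ideal_nhds (Some z)) F" for z
    using that by (simp add: ideal_nhds_def filterlim_inf)
  have **: "filterlim f at_infinity F" if "filterlim f (ideal_nhds None) F"
    using that by (simp add: ideal_nhds_def filterlim_inf)
  show ?thesis
    using assms * ** not_tendsto_and_filterlim_at_infinity[of F f]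
    by (cases \<xi>; cases \<eta>) (auto dest!: * ** dest: tendsto_unique[OF assms(3)])
qed

text \<open>
  The definite description in the Gauss map is resolved by existence of the ray, uniqueness of geodesics and
  uniqueness of limits at infinity.
\<close>

lemma hyperbolic_gauss_map_direction:
  assumes "q \<in> H3" and "norm (mean_curvature_vector E q) = snd q"
  shows "mean_curvature_vector E q = snd q *\<^sub>R ideal_direction (hyperbolic_gauss_map E q) q"
proof -
  define V where "V = mean_curvature_vector E q"
  obtain \<xi> where \<xi>: "V = snd q *\<^sub>R ideal_direction \<xi> q"
    using exists_ideal_direction assms unfolding V_def by blast
  have unit: "hyp_inner q V V = 1"
    using assms by (simp add: hyp_inner_def V_def H3_def power2_norm_eq_inner[symmetric])
  obtain \<gamma> where \<gamma>: "geodesic_ray q V \<gamma>" "filterlim \<gamma> (ideal_nhds \<xi>) at_top"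
    using geodesic_ray_towards[OF assms(1), of \<xi>] \<xi> by metis
  have "hyperbolic_gauss_map E q = \<xi>"
    unfolding hyperbolic_gauss_map_def V_def[symmetric]
  proof (rule the_equality)
    show "\<exists>\<gamma>. geodesic_ray q V \<gamma> \<and> filterlim \<gamma> (ideal_nhds \<xi>) at_top" using \<gamma> by blast
    fix \<eta> assume "\<exists>\<gamma>. geodesic_ray q V \<gamma> \<and> filterlim \<gamma> (ideal_nhds \<eta>) at_top"
    then obtain \<beta> where \<beta>: "geodesic_ray q V \<beta>" "filterlim \<beta> (ideal_nhds \<eta>) at_top" by blast
    have "\<forall>\<^sub>F s in at_top. \<beta> s = \<gamma> s"
      using eventually_ge_at_top[of 0] by eventually_elim (rule geodesic_ray_unique[OF \<beta>(1) \<gamma>(1) unit])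
    then have "filterlim \<gamma> (ideal_nhds \<eta>) at_top"
      using \<beta>(2) filterlim_cong[OF refl refl] by blast
    then show "\<eta> = \<xi>" using \<gamma>(2) by (rule ideal_limit_unique) simp
  qed
  with \<xi> show ?thesis by (simp add: V_def)
qed

section \<open>The phase of a closed two-sided hypersurface\<close>

text \<open>
  A defining function of the hypersurface \<open>E\<close> in \<open>B\<close> which is positive on the side of the normal \<open>N\<close>: on \<open>E\<close> its
  gradient is a positive multiple of \<open>N\<close>.
\<close>

definition local_side_function ::
  "'a::euclidean_space set \<Rightarrow> ('a \<Rightarrow> 'a) \<Rightarrow> 'a set \<Rightarrow> ('a \<Rightarrow> real) \<Rightarrow> bool" where
  "local_side_function E N B S \<longleftrightarrow>
     continuous_on B S \<and> (\<forall>y\<in>B. y \<in> E \<longleftrightarrow> S y = 0) \<and>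
     (\<forall>p\<in>E \<inter> B. N p \<noteq> 0 \<and> (\<exists>l>0. (S has_derivative (\<lambda>v. l * (v \<bullet> N p))) (at p)))"

definition crosses_upward ::
  "('a::euclidean_space \<Rightarrow> 'a) \<Rightarrow> 'a set \<Rightarrow> ('a \<Rightarrow> real) \<Rightarrow> real \<Rightarrow> bool" where
  "crosses_upward N A h k \<longleftrightarrow>
     (\<forall>c s v. c s \<in> A \<and> (c has_vector_derivative v) (at s) \<and> v \<bullet> N (c s) > 0 \<longrightarrow>
        (\<forall>\<^sub>F x in at_right s. h (c x) > k) \<and> (\<forall>\<^sub>F x in at_left s. h (c x) < k))"

lemma crosses_upwardD:
  assumes "crosses_upward N A h k" and "c s \<in> A" "(c has_vector_derivative v) (at s)" "v \<bullet> N (c s) > 0"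
  shows "\<forall>\<^sub>F x in at_right s. h (c x) > k" and "\<forall>\<^sub>F x in at_left s. h (c x) < k"
  using assms(1)[unfolded crosses_upward_def, THEN spec, THEN spec, THEN spec, of c s v] assms(2-) by simp_all

lemma side_function_crossing:
  assumes S: "local_side_function E N B S" and p: "c s \<in> E \<inter> B"
    and c: "(c has_vector_derivative v) (at s)"
  shows "v \<bullet> N (c s) > 0 \<Longrightarrow> \<forall>\<^sub>F x in at_right s. S (c x) > 0"
    and "v \<bullet> N (c s) > 0 \<Longrightarrow> \<forall>\<^sub>F x in at_left s. S (c x) < 0"
    and "v \<bullet> N (c s) < 0 \<Longrightarrow> \<forall>\<^sub>F x in at_right s. S (c x) < 0"
proof -
  obtain l where l: "l > 0" "(S has_derivative (\<lambda>v. l * (v \<bullet> N (c s)))) (at (c s))"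
    using S p unfolding local_side_function_def by blast
  have "((\<lambda>x. S (c x)) has_derivative (\<lambda>x. l * ((x *\<^sub>R v) \<bullet> N (c s)))) (at s)"
    using has_derivative_compose[OF c[unfolded has_vector_derivative_def] l(2)] .
  then have d: "((\<lambda>x. S (c x)) has_real_derivative l * (v \<bullet> N (c s))) (at s)"
    unfolding has_field_derivative_def by (rule has_derivative_eq_rhs) (simp add: fun_eq_iff)
  have S0: "S (c s) = 0" using S p unfolding local_side_function_def by blast
  { assume "v \<bullet> N (c s) > 0"
    then have pos: "0 < l * (v \<bullet> N (c s))" using l(1) by simp
    obtain e where "e > 0" "\<And>h. 0 < h \<Longrightarrow> h < e \<Longrightarrow> S (c s) < S (c (s + h))"
      using DERIV_pos_inc_right[OF d pos] by blast
    from this(1) this(2)[of "_ - s"] show "\<forall>\<^sub>F x in at_right s. S (c x) > 0"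
      by (auto simp: eventually_at_right_field S0 intro!: exI[of _ "s + e"])
    obtain e where "e > 0" "\<And>h. 0 < h \<Longrightarrow> h < e \<Longrightarrow> S (c (s - h)) < S (c s)"
      using DERIV_pos_inc_left[OF d pos] by blast
    from this(1) this(2)[of "s - _"] show "\<forall>\<^sub>F x in at_left s. S (c x) < 0"
      by (auto simp: eventually_at_left_field S0 intro!: exI[of _ "s - e"])
  }
  { assume "v \<bullet> N (c s) < 0"
    then have neg: "l * (v \<bullet> N (c s)) < 0" using l(1) by (simp add: mult_pos_neg)
    obtain e where "e > 0" "\<And>h. 0 < h \<Longrightarrow> h < e \<Longrightarrow> S (c (s + h)) < S (c s)"
      using DERIV_neg_dec_right[OF d neg] by blast
    from this(1) this(2)[of "_ - s"] show "\<forall>\<^sub>F x in at_right s. S (c x) < 0"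
      by (auto simp: eventually_at_right_field S0 intro!: exI[of _ "s + e"])
  }
qed

lemma convex_zero_between:
  fixes S :: "'a::euclidean_space \<Rightarrow> real"
  assumes "convex K" and "continuous_on K S" and "a \<in> K" "b \<in> K" and "S a \<le> 0" "S b \<ge> 0"
  obtains x where "x \<in> K" "S x = 0"
proof -
  have "connected (S ` K)"
    using assms(1,2) by (simp add: connected_continuous_image convex_connected)
  then have "0 \<in> S ` K"
    using assms(3-) unfolding connected_iff_interval by blast
  then show ?thesis using that by auto
qed

text \<open>
  The side of \<open>y\<close> can be read off at a point \<open>p\<close> of \<open>E\<close> nearest to \<open>y\<close>, and so is the same for all local side
  functions around. The open ball about \<open>y\<close> through \<open>p\<close> misses \<open>E\<close>, hence lies on one side; it contains the start of
  every ray from \<open>p\<close> that makes an acute angle with \<open>y - p\<close>. If \<open>y - p\<close> were tangent to \<open>E\<close> these rays would leave \<open>p\<close> to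
  both sides.
\<close>

lemma side_from_nearest_point:
  assumes S: "local_side_function E N (ball q r) S" and p: "p \<in> E" "p \<in> ball q r"
    and y: "y \<in> ball q r" "y \<notin> E" and near: "\<And>x. x \<in> E \<Longrightarrow> dist y p \<le> dist y x"
  shows "S y > 0 \<longleftrightarrow> (y - p) \<bullet> N p > 0"
proof -
  define v where "v = y - p"
  have v: "v \<noteq> 0" using y p by (auto simp: v_def)
  let ?K = "ball y (norm v) \<inter> ball q r"
  have cont: "continuous_on ?K S"
    using S by (auto simp: local_side_function_def intro: continuous_on_subset)
  have nz: "S x \<noteq> 0" if "x \<in> ?K" for x
    using near[of x] that S by (auto simp: local_side_function_def v_def dist_norm)
  have conv: "convex ?K" by (simp add: convex_Int)
  have same: "S a > 0 \<longleftrightarrow> S b > 0" if "a \<in> ?K" "b \<in> ?K" for a b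
  proof (rule ccontr)
    assume "\<not> ?thesis"
    then consider "S a \<le> 0" "S b \<ge> 0" | "S b \<le> 0" "S a \<ge> 0" by linarith
    then show False
      using convex_zero_between[OF conv cont] that nz by cases metis+
  qed
  have yK: "y \<in> ?K" using y v by simp
  have inK: "\<forall>\<^sub>F s in at_right 0. p + s *\<^sub>R u \<in> ?K" if u: "u \<bullet> v > 0" for u
  proof -
    have "((\<lambda>s. p + s *\<^sub>R u) \<longlongrightarrow> p + 0 *\<^sub>R u) (at_right 0)"
      by (intro tendsto_intros)
    then have 1: "\<forall>\<^sub>F s in at_right 0. p + s *\<^sub>R u \<in> ball q r"
      using p(2) by (intro topological_tendstoD) auto
    have "((\<lambda>s. s * (u \<bullet> u)) \<longlongrightarrow> 0 * (u \<bullet> u)) (at_right 0)"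
      by (intro tendsto_intros)
    then have 2: "\<forall>\<^sub>F s in at_right 0. s * (u \<bullet> u) < 2 * (u \<bullet> v)"
      using u by (intro order_tendstoD) auto
    show ?thesis using 1 2 eventually_at_right_less[of 0]
    proof eventually_elim
      case (elim s)
      have "(norm (y - (p + s *\<^sub>R u)))\<^sup>2 = (norm v)\<^sup>2 - s * (2 * (u \<bullet> v) - s * (u \<bullet> u))"
        unfolding power2_norm_eq_inner v_def by (simp add: inner_diff_left inner_diff_right inner_add_left inner_add_right inner_commute algebra_simps)
      also have "\<dots> < (norm v)\<^sup>2" using elim by simp
      finally have "norm (y - (p + s *\<^sub>R u)) < norm v" by (rule power2_less_imp_less) simp
      then show ?case using elim by (simp add: dist_norm)
    qed
  qed
  have ray: "((\<lambda>s. p + s *\<^sub>R u) has_vector_derivative u) (at 0)" for u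
    by (auto intro!: derivative_eq_intros)
  have pB: "(\<lambda>s. p + s *\<^sub>R u) 0 \<in> E \<inter> ball q r" for u using p by simp
  have pos: "S y > 0" if "u \<bullet> v > 0" "u \<bullet> N p > 0" for u
  proof -
    have "\<forall>\<^sub>F s in at_right 0. S (p + s *\<^sub>R u) > 0"
      using side_function_crossing(1)[OF S pB ray, of u] that(2) by simp
    from eventually_happens'[OF _ eventually_conj[OF this inK[OF that(1)]]]
    obtain s where "S (p + s *\<^sub>R u) > 0" "p + s *\<^sub>R u \<in> ?K" by auto
    then show ?thesis using same[OF yK] by force
  qed
  have neg: "\<not> S y > 0" if "u \<bullet> v > 0" "u \<bullet> N p < 0" for u
  proof -
    have "\<forall>\<^sub>F s in at_right 0. S (p + s *\<^sub>R u) < 0"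
      using side_function_crossing(3)[OF S pB ray, of u] that(2) by simp
    from eventually_happens'[OF _ eventually_conj[OF this inK[OF that(1)]]]
    obtain s where "S (p + s *\<^sub>R u) < 0" "p + s *\<^sub>R u \<in> ?K" by auto
    then show ?thesis using same[OF yK] by force
  qed
  have "v \<bullet> v > 0" using v by simp
  moreover have "v \<bullet> N p \<noteq> 0"
  proof
    assume 0: "v \<bullet> N p = 0"
    have "N p \<noteq> 0" using S p by (auto simp: local_side_function_def)
    have "(v + N p) \<bullet> v = v \<bullet> v" "(v - N p) \<bullet> v = v \<bullet> v"
      "(v + N p) \<bullet> N p = N p \<bullet> N p" "(v - N p) \<bullet> N p = - (N p \<bullet> N p)"
      using 0 by (simp_all add: inner_add_left inner_diff_left inner_commute[of "N p" v])
    then show False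
      using pos[of "v + N p"] neg[of "v - N p"] v \<open>N p \<noteq> 0\<close> by simp
  qed
  ultimately show ?thesis
    using pos[of v] neg[of v] by (fold v_def) linarith
qed

text \<open>
  This is the Pontryagin-Thom collapse of a closed two-sided hypersurface. Near \<open>E\<close> there is a well-defined positive
  side \<open>P\<close> and negative side \<open>Q\<close>. With \<open>s\<close> running from \<open>0\<close> on \<open>E\<close> to \<open>1\<close> outside a neighbourhood \<open>V\<close>, the map
  \<open>f = exp (\<plusminus> \<i> \<pi> s)\<close>, with the sign of the side, is continuous because both signs give \<open>1\<close> on \<open>E\<close> and \<open>- 1\<close> off \<open>V\<close>.
\<close>

lemma phase_of_two_sided_set:
  fixes E :: "'a::euclidean_space set"
  assumes M: "open M" "M \<noteq> UNIV" and E: "closedin (top_of_set M) E" "E \<noteq> {}"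
    and loc: "\<And>q. q \<in> E \<Longrightarrow> \<exists>r>0. \<exists>S. ball q r \<subseteq> M \<and> local_side_function E N (ball q r) S"
  obtains f :: "'a \<Rightarrow> complex" where "continuous_on M f" "\<And>y. y \<in> M \<Longrightarrow> norm (f y) = 1"
    "\<And>y. y \<in> M \<Longrightarrow> f y = 1 \<longleftrightarrow> y \<in> E"
    "crosses_upward N E (\<lambda>y. Im (f y)) 0"
proof -
  obtain r S where r: "\<And>q. q \<in> E \<Longrightarrow> r q > 0" "\<And>q. q \<in> E \<Longrightarrow> ball q (r q) \<subseteq> M"
    and S: "\<And>q. q \<in> E \<Longrightarrow> local_side_function E N (ball q (r q)) (S q)"
    using loc by metis
  define V where "V = (\<Union>q\<in>E. ball q (r q / 2))"
  define P where "P = (\<Union>q\<in>E. ball q (r q / 2) \<inter> S q -` {0<..})"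
  define Q where "Q = (\<Union>q\<in>E. ball q (r q / 2) \<inter> S q -` {..<0})"
  have contS: "continuous_on (ball q (r q / 2)) (S q)" if "q \<in> E" for q
    using S[OF that] r(1)[OF that] by (auto simp: local_side_function_def intro: continuous_on_subset)
  have oP: "open P" and oQ: "open Q"
    unfolding P_def Q_def using contS by (auto intro!: open_UN continuous_open_preimage)
  have oV: "open V" unfolding V_def by auto
  obtain C where C: "closed C" "E = M \<inter> C" using E(1) by (auto simp: closedin_closed)
  have EM: "E \<subseteq> M" using C by blast
  have VM: "V \<subseteq> M"
  proof
    fix y assume "y \<in> V"
    then obtain q where q: "q \<in> E" "dist q y < r q / 2" by (auto simp: V_def)
    then have "y \<in> ball q (r q)" using r(1)[of q] by auto
    then show "y \<in> M" using r(2)[OF q(1)] by blast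
  qed
  have EV: "E \<subseteq> V" using r(1) by (force simp: V_def)
  have VPQ: "V - E = P \<union> Q"
  proof -
    have "y \<in> E \<longleftrightarrow> S q y = 0" if "q \<in> E" "dist q y * 2 < r q" for q y
      using S[OF that(1)] that(2) r(1)[OF that(1)] by (auto simp: local_side_function_def)
    then show ?thesis by (force simp: V_def P_def Q_def)
  qed
  \<comment> \<open>The radii are halved so that a point of \<open>E\<close> nearest to \<open>y\<close> lies in the full ball about every centre that sees \<open>y\<close>.\<close>
  have disj: "P \<inter> Q = {}"
  proof -
    have nearest: "\<exists>p\<in>E. \<forall>x\<in>E. dist y p \<le> dist y x" if q: "q \<in> E" "y \<in> ball q (r q / 2)" for q y
    proof -
      let ?C = "E \<inter> cball y (dist q y)"
      have "cball y (dist q y) \<subseteq> ball q (r q)"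
      proof
        fix x assume "x \<in> cball y (dist q y)"
        then have "dist q x \<le> 2 * dist q y" using dist_triangle[of q x y] by simp
        then show "x \<in> ball q (r q)" using q by simp
      qed
      then have "cball y (dist q y) \<subseteq> M" using r(2)[OF q(1)] by blast
      then have "?C = cball y (dist q y) \<inter> C" using C(2) by blast
      then have "compact ?C" using C(1) by (simp add: compact_Int_closed)
      moreover have "q \<in> ?C" using q by (simp add: dist_commute)
      ultimately obtain p where p: "p \<in> ?C" "\<And>x. x \<in> ?C \<Longrightarrow> dist y p \<le> dist y x"
        using distance_attains_inf[of ?C y] compact_imp_closed by blast
      have "dist y p \<le> dist y x" if "x \<in> E" for x
        using p that by (cases "x \<in> ?C") (auto simp: dist_commute)
      then show ?thesis using p(1) by blast
    qed
    have False if y: "y \<in> P" "y \<in> Q" for y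
    proof -
      obtain q where q: "q \<in> E" "y \<in> ball q (r q / 2)" "S q y > 0" using y by (auto simp: P_def)
      obtain q' where q': "q' \<in> E" "y \<in> ball q' (r q' / 2)" "S q' y < 0" using y by (auto simp: Q_def)
      obtain p where p: "p \<in> E" "\<And>x. x \<in> E \<Longrightarrow> dist y p \<le> dist y x" using nearest[OF q(1,2)] by blast
      have pin: "p \<in> ball k (r k)" "y \<in> ball k (r k)" if "k \<in> E" "y \<in> ball k (r k / 2)" for k
        using dist_triangle[of k p y] p(2)[OF that(1)] that r(1)[OF that(1)] by (auto simp: dist_commute)
      have "y \<notin> E" using y VPQ by blast
      then show False
        using side_from_nearest_point[OF S[OF q(1)] p(1) pin(1)[OF q(1,2)] pin(2)[OF q(1,2)] _ p(2)]
          side_from_nearest_point[OF S[OF q'(1)] p(1) pin(1)[OF q'(1,2)] pin(2)[OF q'(1,2)] _ p(2)] q(3) q'(3)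
        by auto
    qed
    then show ?thesis by blast
  qed
  have "closure E \<subseteq> C" using C by (simp add: closure_minimal)
  then have clE: "closure E \<inter> M = E" using C(2) EM closure_subset[of E] by blast
  have nV: "- V \<noteq> {}" using VM M(2) by blast
  define s where "s = (\<lambda>y. infdist y E / (infdist y E + infdist y (- V)))"
  have dE: "infdist y E = 0 \<longleftrightarrow> y \<in> E" if "y \<in> M" for y
    using in_closure_iff_infdist_zero[OF E(2), of y] clE that by blast
  have dV: "infdist y (- V) = 0 \<longleftrightarrow> y \<notin> V" for y
    using in_closed_iff_infdist_zero[OF _ nV, of y] oV by auto
  have den: "infdist y E + infdist y (- V) > 0" if "y \<in> M" for y
    using dE[OF that] dV[of y] EV infdist_nonneg[of y E] infdist_nonneg[of y "- V"] by (smt (verit) subsetD)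
  have conts: "continuous_on M s"
    unfolding s_def using den by (intro continuous_intros) force
  have s01: "0 \<le> s y" "s y \<le> 1" if "y \<in> M" for y
    using den[OF that] infdist_nonneg[of y E] infdist_nonneg[of y "- V"] by (auto simp: s_def)
  have s0: "s y = 0 \<longleftrightarrow> y \<in> E" if "y \<in> M" for y
    using den[OF that] dE[OF that] by (auto simp: s_def)
  have s1: "s y = 1 \<longleftrightarrow> y \<notin> V" if "y \<in> M" for y
    using den[OF that] dV[of y] by (auto simp: s_def)
  define f where "f = (\<lambda>y. Complex (cos (pi * s y)) ((if y \<in> P then 1 else -1) * sin (pi * s y)))"
  have "continuous_on M f"
  proof -
    have cosc: "continuous_on M (\<lambda>y. cos (pi * s y))" and sinc: "continuous_on M (\<lambda>y. sin (pi * s y))"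
      by (intro continuous_intros conts)+
    have "isCont (\<lambda>y. (if y \<in> P then 1 else -1) * sin (pi * s y)) y" if y: "y \<in> M" for y
    proof (cases "y \<in> P \<union> Q")
      case True
      have sc: "isCont (\<lambda>y. sin (pi * s y)) y"
        using sinc M(1) y continuous_on_eq_continuous_at by blast
      show ?thesis
      proof (cases "y \<in> P")
        case True
        have "\<forall>\<^sub>F x in nhds y. (if x \<in> P then 1 else -1) * sin (pi * s x) = sin (pi * s x)"
          using eventually_nhds_in_open[OF oP True] by eventually_elim simp
        then show ?thesis using sc isCont_cong by fast
      next
        case False
        with True have "y \<in> Q" by blast
        have "\<forall>\<^sub>F x in nhds y. (if x \<in> P then 1 else -1) * sin (pi * s x) = - sin (pi * s x)"
          using eventually_nhds_in_open[OF oQ \<open>y \<in> Q\<close>] by eventually_elim (use disj in auto)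
        moreover have "isCont (\<lambda>y. - sin (pi * s y)) y" by (rule continuous_minus[OF sc])
        ultimately show ?thesis using isCont_cong by fast
      qed
    next
      case False
      then have "y \<notin> V \<or> y \<in> E" using VPQ by blast
      then have "s y = 1 \<or> s y = 0" using s0 s1 y by blast
      then have z: "sin (pi * s y) = 0" by auto
      have "isCont (\<lambda>y. sin (pi * s y)) y"
        using sinc M(1) y continuous_on_eq_continuous_at by blast
      then have "((\<lambda>y. sin (pi * s y)) \<longlongrightarrow> 0) (at y)" using z by (simp add: isCont_def)
      then have "((\<lambda>y. (if y \<in> P then 1 else -1) * sin (pi * s y)) \<longlongrightarrow> 0) (at y)"
        by (rule Lim_null_comparison[rotated, OF tendsto_norm_zero]) (auto intro!: always_eventually)
      then show ?thesis using z by (simp add: isCont_def)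
    qed
    then have "continuous_on M (\<lambda>y. (if y \<in> P then 1 else -1) * sin (pi * s y))"
      by (simp add: continuous_at_imp_continuous_on)
    then show ?thesis unfolding f_def Complex_eq
      by (intro continuous_on_add continuous_on_mult[OF continuous_on_const] continuous_on_of_real cosc)
  qed
  moreover have "norm (f y) = 1" if "y \<in> M" for y
    by (simp add: f_def cmod_def power_mult_distrib)
  moreover have "f y = 1 \<longleftrightarrow> y \<in> E" if "y \<in> M" for y
  proof
    assume "f y = 1"
    then have "cos (pi * s y) = cos 0" by (simp add: f_def complex_eq_iff)
    moreover have "0 \<le> pi * s y" "pi * s y \<le> pi"
      using s01[OF that] by (simp_all add: mult_left_le)
    ultimately have "pi * s y = 0"
      using cos_inj_pi[of "pi * s y" 0] by simp
    then show "y \<in> E" using s0[OF that] by simp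
  next
    assume "y \<in> E"
    then show "f y = 1" using s0[OF that] by (simp add: f_def complex_eq_iff)
  qed
  moreover have "crosses_upward N E (\<lambda>y. Im (f y)) 0"
    unfolding crosses_upward_def
  proof (intro allI impI)
    fix c t v
    assume "c t \<in> E \<and> (c has_vector_derivative v) (at t) \<and> v \<bullet> N (c t) > 0"
    then have c: "c t \<in> E" "(c has_vector_derivative v) (at t)" "v \<bullet> N (c t) > 0" by auto
    define p where "p = c t"
    have pE: "p \<in> E" using c by (simp add: p_def)
    have pB: "c t \<in> E \<inter> ball p (r p)" using r(1)[OF pE] c by (simp add: p_def)
    have "isCont c t" using c(2) has_vector_derivative_continuous by blast
    then have "(c \<longlongrightarrow> p) (at t)" by (simp add: isCont_def p_def)
    then have "\<forall>\<^sub>F x in at t. c x \<in> ball p (r p / 2)"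
      using r(1)[OF pE] by (intro topological_tendstoD) auto
    then have near: "\<forall>\<^sub>F x in at_right t. c x \<in> ball p (r p / 2)" "\<forall>\<^sub>F x in at_left t. c x \<in> ball p (r p / 2)"
      by (auto simp: eventually_at_split)
    have sgn: "Im (f y) > 0" if "y \<in> P" for y
    proof -
      have "y \<in> V" "y \<notin> E" "y \<in> M" using that VPQ VM by blast+
      then have "0 < s y" "s y < 1" using s01 s0 s1 by (metis order_less_le)+
      then have "sin (pi * s y) > 0" by (intro sin_gt_zero) (auto simp: pi_gt_zero)
      then show ?thesis using that by (simp add: f_def)
    qed
    have sgn': "Im (f y) < 0" if "y \<in> Q" for y
    proof -
      have "y \<in> V" "y \<notin> E" "y \<in> M" using that VPQ VM by blast+
      then have "0 < s y" "s y < 1" using s01 s0 s1 by (metis order_less_le)+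
      then have "sin (pi * s y) > 0" by (intro sin_gt_zero) (auto simp: pi_gt_zero)
      then show ?thesis using that disj by (auto simp: f_def)
    qed
    have "\<forall>\<^sub>F x in at_right t. Im (f (c x)) > 0"
      using near(1) side_function_crossing(1)[OF S[OF pE] pB c(2,3)]
      by eventually_elim (rule sgn, use pE in \<open>auto simp: P_def\<close>)
    moreover have "\<forall>\<^sub>F x in at_left t. Im (f (c x)) < 0"
      using near(2) side_function_crossing(2)[OF S[OF pE] pB c(2,3)]
      by eventually_elim (rule sgn', use pE in \<open>auto simp: Q_def\<close>)
    ultimately show "(\<forall>\<^sub>F x in at_right t. Im (f (c x)) > 0) \<and> (\<forall>\<^sub>F x in at_left t. Im (f (c x)) < 0)"
      by blast
  qed
  ultimately show ?thesis by (rule that)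
qed

section \<open>Logarithms off a compact set\<close>

text \<open>
  The map \<open>(z, t) \<mapsto> (z, ln t)\<close> identifies \<open>H3\<close> with Euclidean space, where \<open>K\<close> lies in a ball of radius \<open>R\<close>. The complement of
  that ball is a retract of punctured space, which is simply connected in dimension three; so \<open>f\<close> composed with the
  retraction has a logarithm.
\<close>

lemma logarithm_off_compact:
  fixes f :: "complex \<times> real \<Rightarrow> complex"
  assumes K: "compact K" "K \<subseteq> H3" and f: "continuous_on (H3 - K) f" "\<And>p. p \<in> H3 - K \<Longrightarrow> f p \<noteq> 0"
  obtains K' g where "compact K'" "K' \<subseteq> H3" "continuous_on (H3 - K') g"
    "\<And>p. p \<in> H3 - K' \<Longrightarrow> p \<notin> K \<and> f p = exp (g p)"
proof -
  define h where "h = (\<lambda>p :: complex \<times> real. (fst p, ln (snd p)))"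
  define k where "k = (\<lambda>p :: complex \<times> real. (fst p, exp (snd p)))"
  have hk: "h (k p) = p" for p by (simp add: h_def k_def)
  have kh: "k (h p) = p" if "p \<in> H3" for p using that by (simp add: h_def k_def H3_def)
  have kH: "k p \<in> H3" for p by (simp add: k_def H3_def)
  have ch: "continuous_on H3 h" unfolding h_def by (intro continuous_intros) (auto simp: H3_def)
  have ck: "continuous_on A k" for A
    unfolding k_def
    by (intro continuous_on_Pair continuous_on_fst continuous_on_exp continuous_on_snd continuous_on_id)
  have "bounded (h ` K)"
    using K ch by (intro compact_imp_bounded compact_continuous_image) (auto intro: continuous_on_subset)
  then obtain R where R: "R > 0" "\<And>p. p \<in> K \<Longrightarrow> norm (h p) < R"
    using bounded_pos_less by (metis image_eqI)
  define r where "r = (\<lambda>y :: complex \<times> real. max 1 (R / norm y) *\<^sub>R y)"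
  have rK: "k (r y) \<in> H3 - K" if "y \<noteq> 0" for y
  proof -
    have "norm (r y) = max (norm y) R"
      using that R(1) by (auto simp: r_def max_def field_simps)
    then have "k (r y) \<notin> K" using R(2)[of "k (r y)"] hk[of "r y"] by auto
    then show ?thesis using kH by blast
  qed
  have r_id: "r y = y" if "norm y > R" for y proof -
    have "R / norm y < 1" using that R(1) by (simp add: divide_less_eq)
    then show ?thesis by (simp add: r_def)
  qed
  have cr: "continuous_on (- {0}) r" 
    unfolding r_def
    by (intro continuous_on_scaleR continuous_on_max continuous_on_divide continuous_on_norm
        continuous_on_const continuous_on_id) simp
  have "continuous_on (- {0}) (\<lambda>y. f (k (r y)))"
    by (rule continuous_on_compose2[OF f(1) continuous_on_compose2[OF ck[of UNIV] cr]]) (use rK in auto)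
  moreover have "simply_connected (- {0 :: complex \<times> real})"
    by (rule simply_connected_punctured_universe) simp
  moreover have "locally path_connected (- {0 :: complex \<times> real})"
    by (rule open_imp_locally_path_connected) auto
  ultimately obtain g where g: "continuous_on (- {0}) g" "\<And>y. y \<in> - {0} \<Longrightarrow> f (k (r y)) = exp (g y)"
    using continuous_logarithm_on_simply_connected[of "- {0}" "\<lambda>y. f (k (r y))"] f(2)[OF rK] by blast
  define K' where "K' = k ` cball 0 R"
  have big: "norm (h p) > R" if "p \<in> H3 - K'" for p
  proof (rule ccontr)
    assume "\<not> ?thesis"
    then have "h p \<in> cball 0 R" by simp
    then have "k (h p) \<in> K'" unfolding K'_def by (rule imageI)
    then show False using kh[of p] that by simp
  qed
  show ?thesis
  proof (rule that)
    show "compact K'" unfolding K'_def using ck by (intro compact_continuous_image) auto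
    show "K' \<subseteq> H3" using kH by (auto simp: K'_def)
    have nz: "h p \<noteq> 0" if "p \<in> H3 - K'" for p using big[OF that] R(1) by auto
    have "continuous_on (H3 - K') h" using ch by (rule continuous_on_subset) blast
    moreover have "h ` (H3 - K') \<subseteq> - {0}"
    proof
      fix y assume "y \<in> h ` (H3 - K')"
      then obtain p where "p \<in> H3 - K'" "y = h p" by (rule imageE)
      with nz[of p] show "y \<in> - {0}" by simp
    qed
    ultimately show "continuous_on (H3 - K') (\<lambda>p. g (h p))"
      by (rule continuous_on_compose2[OF g(1)])
    fix p assume p: "p \<in> H3 - K'"
    then have "p \<notin> K" using big[OF p] R(2)[of p] by auto
    moreover have "f p = exp (g (h p))"
      using g(2)[of "h p"] nz[OF p] r_id[OF big[OF p]] kh[of p] p by simp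
    ultimately show "p \<notin> K \<and> f p = exp (g (h p))" by blast
  qed
qed

section \<open>Local sides of an embedded end\<close>

locale oriented_end = parametrized_end +
  fixes N :: "complex \<times> real \<Rightarrow> complex \<times> real"
  assumes continuous_normal: "continuous_on E N"
    and normal: "\<And>z. z \<in> interior punctured_disk \<Longrightarrow> tangent_normal z (N (\<phi> z))"
begin

text \<open>
  Sliding the surface along the fixed normal \<open>n0\<close> at \<open>\<phi> z0\<close> gives a map \<open>(z, s) \<mapsto> \<phi> z + s n0\<close> to which the inverse function
  theorem applies. The side function is the coordinate \<open>s\<close> of the inverse. Embeddedness enters here: since \<open>\<psi>\<close> is
  continuous on \<open>E\<close>, no other part of \<open>E\<close> comes close to \<open>\<phi> z0\<close>.
\<close>

lemma local_side_function_exists: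
  assumes z0: "z0 \<in> interior punctured_disk"
  shows "\<exists>r>0. \<exists>S. local_side_function E N (ball (\<phi> z0) r) S"
proof -
  let ?I = "interior punctured_disk" and ?D = "\<lambda>z. frechet_derivative \<phi> (at z)"
  note D = twice_differentiable_onD[OF twice_differentiable]
  define q where "q = \<phi> z0"
  define n0 where "n0 = N q"
  have Id: "z \<in> punctured_disk" if "z \<in> ?I" for z using that interior_subset by blast
  have tn: "?D z k \<bullet> N (\<phi> z) = 0" "N (\<phi> z) \<noteq> 0" if z: "z \<in> ?I" for z k
    using normal[OF z] \<phi>_in[OF Id[OF z]] subset_H3 by (auto simp: tangent_normal_def H3_def)
  define \<Psi> where "\<Psi> = (\<lambda>w. \<phi> (fst w) + snd w *\<^sub>R n0)"
  define A where "A = (\<lambda>(w :: complex \<times> real) (h :: complex \<times> real). ?D (fst w) (fst h) + snd h *\<^sub>R n0)"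
  define U where "U = ?I \<times> (UNIV :: real set)"
  have oU: "open U" unfolding U_def by (intro open_Times) auto
  have fstU: "fst w \<in> ?I" if "w \<in> U" for w using that by (auto simp: U_def)
  have dfst: "((\<lambda>w. \<phi> (fst w)) has_derivative (\<lambda>h. ?D (fst w) (fst h))) (at w)" if "w \<in> U" for w
    by (rule has_derivative_compose[where f = fst and g = \<phi>, OF _ D(1)[OF fstU[OF that]]])
      (auto intro!: derivative_eq_intros)
  have d\<Psi>: "(\<Psi> has_derivative A w) (at w)" if "w \<in> U" for w
    unfolding \<Psi>_def A_def by (rule derivative_eq_intros dfst[OF that] refl)+ simp
  have bA: "bounded_linear (A w)" if "w \<in> U" for w
    using d\<Psi>[OF that] by (rule has_derivative_bounded_linear)
  define f' where "f' = (\<lambda>w. Blinfun (A w))"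
  have f': "blinfun_apply (f' w) = A w" if "w \<in> U" for w
    unfolding f'_def by (rule bounded_linear_Blinfun_apply[OF bA[OF that]])
  have contA: "continuous_on U (\<lambda>w. A w h)" for h
  proof -
    have "continuous_on ?I (\<lambda>z. ?D z (fst h))"
      using D(2) by (intro continuous_at_imp_continuous_on ballI) (blast intro: has_derivative_continuous)
    then have "continuous_on U (\<lambda>w. ?D (fst w) (fst h))"
      by (rule continuous_on_compose2[OF _ continuous_on_fst[OF continuous_on_id]]) (auto simp: U_def)
    then show ?thesis unfolding A_def by (intro continuous_on_add continuous_on_const)
  qed
  have contf': "continuous_on U f'"
    by (rule continuous_on_blinfun_componentwise)
      (simp add: continuous_on_cong[OF refl fun_cong[OF f']] contA)
  have z0U: "(z0, 0) \<in> U" using z0 by (simp add: U_def)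
  have linA: "linear (A (z0, 0))" using bA[OF z0U] by (rule bounded_linear.linear)
  have "inj (A (z0, 0))"
    unfolding linear_injective_0[OF linA]
  proof (intro allI impI)
    fix h assume "A (z0, 0) h = 0"
    then have e: "?D z0 (fst h) + snd h *\<^sub>R n0 = 0" by (simp add: A_def)
    then have "(?D z0 (fst h) + snd h *\<^sub>R n0) \<bullet> n0 = 0" by simp
    then have s: "snd h = 0" using tn[OF z0] by (simp add: inner_add_left n0_def q_def)
    with e have "?D z0 (fst h) = 0" by simp
    then have "fst h = 0"
      using inj_tangent[OF z0] linear_injective_0[OF D(3)[OF z0]] by blast
    with s show "h = 0" by (simp add: prod_eq_iff)
  qed
  then obtain L where L: "linear L" "L \<circ> A (z0, 0) = id"
    using linear_injective_left_inverse[OF linA] by blast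
  have bL: "bounded_linear L" using L(1) linear_conv_bounded_linear by blast
  have invf: "Blinfun L o\<^sub>L f' (z0, 0) = id_blinfun"
    by (rule blinfun_eqI)
      (simp add: bounded_linear_Blinfun_apply[OF bL] f'[OF z0U] fun_cong[OF L(2), unfolded o_apply id_apply])
  obtain U' V g g' where U': "open U'" "U' \<subseteq> U" "(z0, 0) \<in> U'" and V: "open V" "\<Psi> (z0, 0) \<in> V"
    and hom: "homeomorphism U' V \<Psi> g"
    and dg: "\<And>y. y \<in> V \<Longrightarrow> (g has_derivative g' y) (at y)"
    and g': "\<And>y. y \<in> V \<Longrightarrow> g' y = inv (blinfun_apply (f' (g y)))"
    and bij: "\<And>y. y \<in> V \<Longrightarrow> bij (blinfun_apply (f' (g y)))"
    using inverse_function_theorem[OF oU _ contf' z0U invf, of \<Psi>] d\<Psi> f' by metis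
  have qV: "q \<in> V" using V(2) by (simp add: \<Psi>_def q_def)
  have qE: "q \<in> E" using \<phi>_in[OF Id[OF z0]] by (simp add: q_def)
  have \<psi>q: "\<psi> q = z0" using \<psi>_\<phi>[OF Id[OF z0]] by (simp add: q_def)
  obtain r1 where r1: "r1 > 0" "ball q r1 \<subseteq> V" using V(1) qV open_contains_ball by blast
  have lim\<psi>: "(\<psi> \<longlongrightarrow> z0) (at q within E)"
    using homeo qE \<psi>q by (auto simp: homeomorphism_def continuous_on_def)
  then have "((\<lambda>y. (\<psi> y, 0::real)) \<longlongrightarrow> (z0, 0)) (at q within E)" by (intro tendsto_intros)
  then have "\<forall>\<^sub>F y in at q within E. (\<psi> y, 0) \<in> U'" using U' by (intro topological_tendstoD)
  then obtain r2 where r2: "r2 > 0" "\<And>y. y \<in> E \<Longrightarrow> dist y q < r2 \<Longrightarrow> (\<psi> y, 0) \<in> U'"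
    unfolding eventually_at using U'(3) \<psi>q by metis
  have "((\<lambda>y. N y \<bullet> n0) \<longlongrightarrow> n0 \<bullet> n0) (at q within E)"
    using continuous_normal qE by (intro tendsto_intros) (auto simp: continuous_on_def n0_def)
  moreover have "n0 \<bullet> n0 > 0" using tn(2)[OF z0] by (simp add: n0_def q_def)
  ultimately have "\<forall>\<^sub>F y in at q within E. N y \<bullet> n0 > 0" by (rule order_tendstoD)
  then obtain r3 where r3: "r3 > 0" "\<And>y. y \<in> E \<Longrightarrow> dist y q < r3 \<Longrightarrow> N y \<bullet> n0 > 0"
    unfolding eventually_at using \<open>n0 \<bullet> n0 > 0\<close> n0_def by metis
  define r where "r = min r1 (min r2 r3)"
  have rr: "r > 0" "ball q r \<subseteq> V" using r1 r2(1) r3(1) by (auto simp: r_def)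
  define S where "S = (\<lambda>y. snd (g y))"
  have gE: "g y = (\<psi> y, 0)" and \<psi>I: "\<psi> y \<in> ?I" if "y \<in> E" "y \<in> ball q r" for y
  proof -
    have "(\<psi> y, 0) \<in> U'" using r2(2)[of y] that by (simp add: r_def dist_commute)
    moreover have "\<Psi> (\<psi> y, 0) = y" by (simp add: \<Psi>_def \<phi>_\<psi>[OF that(1)])
    ultimately show "g y = (\<psi> y, 0)" "\<psi> y \<in> ?I" using hom U'(2) fstU[of "(\<psi> y, 0)"] by (auto simp: homeomorphism_def)
  qed
  have "local_side_function E N (ball q r) S"
    unfolding local_side_function_def
  proof (intro conjI ballI)
    have "continuous_on V g" using hom by (simp add: homeomorphism_def)
    then show "continuous_on (ball q r) S"
      unfolding S_def using rr(2) by (intro continuous_on_snd) (rule continuous_on_subset)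
    fix y assume y: "y \<in> ball q r"
    show "y \<in> E \<longleftrightarrow> S y = 0"
    proof
      assume "y \<in> E" then show "S y = 0" using gE[OF _ y] by (simp add: S_def)
    next
      assume S0: "S y = 0"
      have yV: "y \<in> V" using y rr(2) by blast
      then have gU: "g y \<in> U'" and gy: "\<Psi> (g y) = y" using hom by (auto simp: homeomorphism_def)
      have "\<phi> (fst (g y)) = y" using gy S0 by (simp add: \<Psi>_def S_def)
      then show "y \<in> E" using \<phi>_in[OF Id[OF fstU]] gU U'(2) by (metis subsetD)
    qed
  next
    fix p assume p: "p \<in> E \<inter> ball q r"
    then have pV: "p \<in> V" and pE: "p \<in> E" and gp: "g p = (\<psi> p, 0)" and pI: "\<psi> p \<in> ?I"
      using rr(2) gE \<psi>I by auto
    have \<phi>p: "\<phi> (\<psi> p) = p" using \<phi>_\<psi>[OF pE] .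
    show "N p \<noteq> 0" using tn(2)[OF pI] by (simp add: \<phi>p)
    have pos: "N p \<bullet> n0 > 0" using r3(2)[OF pE] p by (simp add: r_def dist_commute)
    have f'p: "blinfun_apply (f' (g p)) = A (\<psi> p, 0)" using f' pI by (simp add: gp U_def)
    have "snd (g' p v) = (1 / (N p \<bullet> n0)) * (v \<bullet> N p)" for v
    proof -
      obtain h where h: "v = A (\<psi> p, 0) h" using bij[OF pV] f'p by (metis bij_pointE)
      have "g' p v = h"
        using g'[OF pV] bij[OF pV] f'p h by (simp add: bij_is_inj inv_f_f)
      moreover have "v \<bullet> N p = snd h * (n0 \<bullet> N p)"
        using tn(1)[OF pI] by (simp add: h A_def inner_add_left \<phi>p)
      ultimately show ?thesis using pos by (simp add: inner_commute)
    qed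
    moreover have "(S has_derivative (\<lambda>v. snd (g' p v))) (at p)"
      unfolding S_def by (intro has_derivative_snd dg pV)
    ultimately show "\<exists>l>0. (S has_derivative (\<lambda>v. l * (v \<bullet> N p))) (at p)"
      using pos by (intro exI[of _ "1 / (N p \<bullet> n0)"]) simp
  qed
  then show ?thesis using rr(1) by (auto simp: q_def)
qed

end

section \<open>Inversions\<close>

text \<open>
  Up to a positive factor, the differential of an inversion in a sphere centred on the boundary plane is the
  reflection in the hyperplane orthogonal to the radius vector \<open>y\<close>.
\<close>

definition reflect :: "complex \<times> real \<Rightarrow> complex \<times> real \<Rightarrow> complex \<times> real" where
  "reflect y v = v - (2 * (y \<bullet> v) / (y \<bullet> y)) *\<^sub>R y"

definition inversion :: "complex \<Rightarrow> complex \<times> real \<Rightarrow> complex \<times> real" where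
  "inversion a p = (a, 0) + inverse ((p - (a, 0)) \<bullet> (p - (a, 0))) *\<^sub>R (p - (a, 0))"

definition ideal_inversion :: "complex \<Rightarrow> sphere_at_infinity \<Rightarrow> sphere_at_infinity" where
  "ideal_inversion a \<xi> =
     (case \<xi> of None \<Rightarrow> Some a
      | Some g \<Rightarrow> if g = a then None else Some (a + inverse ((g - a) \<bullet> (g - a)) *\<^sub>R (g - a)))"

lemma reflect_inner: "reflect y v \<bullet> u = v \<bullet> reflect y u"
  by (simp add: reflect_def inner_diff_left inner_diff_right inner_commute)

lemma reflect_scaleR: "c \<noteq> 0 \<Longrightarrow> reflect (c *\<^sub>R y) v = reflect y v"
  by (simp add: reflect_def field_simps)

lemma H3_nonzero: "p \<in> H3 \<Longrightarrow> p - (a, 0) \<noteq> 0"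
  by (auto simp: H3_def prod_eq_iff)

lemma open_H3: "open H3"
  unfolding H3_def by (intro open_Collect_less continuous_intros)

lemma inversion_in_H3: "p \<in> H3 \<Longrightarrow> inversion a p \<in> H3"
  using H3_nonzero[of p a] by (simp add: H3_def inversion_def)

lemma inversion_inversion:
  assumes "p \<in> H3"
  shows "inversion a (inversion a p) = p"
proof -
  define y where "y = p - (a, 0)"
  have y: "y \<bullet> y \<noteq> 0" using H3_nonzero[OF assms, of a] by (simp add: y_def)
  have "inversion a p - (a, 0) = inverse (y \<bullet> y) *\<^sub>R y" by (simp add: inversion_def y_def)
  then have "inversion a (inversion a p) = (a, 0) + y"
    using y unfolding inversion_def[of a "inversion a p"] by simp
  then show ?thesis by (simp add: y_def)
qed

lemma inversion_derivative:
  assumes "p \<noteq> (a, 0)"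
  shows "(inversion a has_derivative
    (\<lambda>v. inverse ((p - (a, 0)) \<bullet> (p - (a, 0))) *\<^sub>R reflect (p - (a, 0)) v)) (at p)"
proof -
  define y where "y = p - (a, 0)"
  have y: "y \<bullet> y \<noteq> 0" using assms by (simp add: y_def)
  have "((\<lambda>p. p - (a, 0)) has_derivative (\<lambda>v. v)) (at p)"
    by (auto intro!: derivative_eq_intros)
  note d = this
  have di: "((\<lambda>p. (p - (a, 0)) \<bullet> (p - (a, 0))) has_derivative (\<lambda>v. y \<bullet> v + v \<bullet> y)) (at p)"
    unfolding y_def by (rule has_derivative_inner[OF d d])
  have "((\<lambda>p. inverse ((p - (a, 0)) \<bullet> (p - (a, 0)))) has_derivative
      (\<lambda>v. - (inverse (y \<bullet> y) * (y \<bullet> v + v \<bullet> y) * inverse (y \<bullet> y)))) (at p)"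
    using Deriv.has_derivative_inverse[OF _ di] y by (simp add: y_def)
  from has_derivative_add[OF has_derivative_const[of "(a, 0)"] has_derivative_scaleR[OF this d]]
  have "((\<lambda>p. (a, 0) + inverse ((p - (a, 0)) \<bullet> (p - (a, 0))) *\<^sub>R (p - (a, 0))) has_derivative
      (\<lambda>v. inverse (y \<bullet> y) *\<^sub>R v + (- (inverse (y \<bullet> y) * (y \<bullet> v + v \<bullet> y) * inverse (y \<bullet> y))) *\<^sub>R y)) (at p)"
    unfolding y_def[symmetric] by simp
  then show ?thesis
    unfolding inversion_def[abs_def]
    by (rule has_derivative_eq_rhs)
      (simp add: fun_eq_iff reflect_def y_def[symmetric] inner_commute scaleR_diff_right divide_inverse mult_ac)
qed

text \<open>
  Inversions are isometries of hyperbolic space, so they map geodesic rays to geodesic rays and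
  respect ideal endpoints. With \<open>w\<close>, \<open>y\<close> the vectors from the centre to the endpoint and to \<open>p\<close>, and \<open>e\<close> the
  vertical unit vector, both sides are combinations of \<open>e\<close>, \<open>w\<close> and \<open>y\<close> whose coefficients agree since
  \<open>w \<bullet> e = 0\<close> and \<open>y \<bullet> e = t\<close>.
\<close>

lemma reflect_ideal_direction:
  assumes p: "p \<in> H3"
  shows "reflect (p - (a, 0)) (ideal_direction \<xi> p) = ideal_direction (ideal_inversion a \<xi>) (inversion a p)"
proof -
  define y where "y = p - (a, 0)"
  define t where "t = snd p"
  define e :: "complex \<times> real" where "e = (0, 1)"
  define Y where "Y = y \<bullet> y"
  have Y: "Y > 0" using H3_nonzero[OF p, of a] by (simp add: Y_def y_def)
  have ye: "y \<bullet> e = t" by (simp add: y_def e_def t_def inner_prod_def)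
  have y': "inversion a p = (a, 0) + inverse Y *\<^sub>R y" by (simp add: inversion_def Y_def y_def)
  have t': "snd (inversion a p) = t / Y" by (simp add: y' y_def t_def field_simps)
  have r: "reflect y (e + \<alpha> *\<^sub>R w + \<beta> *\<^sub>R y)
      = e + \<alpha> *\<^sub>R w + (- \<beta> - 2 * (t + \<alpha> * (w \<bullet> y)) / Y) *\<^sub>R y" for \<alpha> \<beta> w
  proof -
    have "y \<bullet> (e + \<alpha> *\<^sub>R w + \<beta> *\<^sub>R y) = t + \<alpha> * (w \<bullet> y) + \<beta> * Y"
      by (simp add: inner_add_right ye Y_def inner_commute[of w])
    then have "reflect y (e + \<alpha> *\<^sub>R w + \<beta> *\<^sub>R y)
        = e + \<alpha> *\<^sub>R w + (\<beta> - 2 * (t + \<alpha> * (w \<bullet> y) + \<beta> * Y) / Y) *\<^sub>R y"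
      unfolding reflect_def by (simp add: Y_def[symmetric] scaleR_diff_left)
    also have "\<beta> - 2 * (t + \<alpha> * (w \<bullet> y) + \<beta> * Y) / Y = - \<beta> - 2 * (t + \<alpha> * (w \<bullet> y)) / Y"
      using Y by (simp add: field_simps)
    finally show ?thesis .
  qed
  show ?thesis
  proof (cases \<xi>)
    case None
    have n: "(norm ((a, 0) - inversion a p))\<^sup>2 = 1 / Y"
    proof -
      have "(norm ((a, 0) - inversion a p))\<^sup>2 = inverse Y * (inverse Y * (y \<bullet> y))"
        unfolding power2_norm_eq_inner by (simp add: y')
      then show ?thesis using Y by (simp add: Y_def[symmetric] field_simps)
    qed
    have "ideal_direction (ideal_inversion a \<xi>) (inversion a p) = e + (2 * (t / Y) / (1 / Y)) *\<^sub>R (- (inverse Y *\<^sub>R y))"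
      unfolding None ideal_inversion_def ideal_direction_def option.case n t' by (simp add: e_def y')
    also have "\<dots> = e + (- 2 * t / Y) *\<^sub>R y" using Y by (simp add: field_simps)
    also have "\<dots> = reflect y e" using r[of 0 0 0] by simp
    finally show ?thesis by (simp add: None ideal_direction_def e_def y_def)
  next
    case (Some g)
    define w :: "complex \<times> real" where "w = (g - a, 0)"
    define W where "W = w \<bullet> w"
    define D where "D = (norm (w - y))\<^sup>2"
    have gp: "(g, 0) - p = w - y" by (simp add: w_def y_def prod_eq_iff)
    have D: "D = W - 2 * (w \<bullet> y) + Y"
      by (simp add: D_def power2_norm_eq_inner W_def Y_def inner_diff_left inner_diff_right inner_commute)
    have "snd (w - y) \<noteq> 0" using p by (simp add: w_def y_def H3_def)
    then have "w - y \<noteq> 0" by auto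
    then have Dpos: "D > 0" by (simp add: D_def)
    have lhs: "reflect (p - (a, 0)) (ideal_direction \<xi> p) = e + (2 * t / D) *\<^sub>R w + (- 2 * t * W / (D * Y)) *\<^sub>R y"
    proof -
      have "ideal_direction \<xi> p = e + (2 * t / D) *\<^sub>R w + (- 2 * t / D) *\<^sub>R y"
        unfolding Some ideal_direction_def option.case gp by (simp add: e_def t_def D_def scaleR_diff_right)
      then have "reflect (p - (a, 0)) (ideal_direction \<xi> p)
          = e + (2 * t / D) *\<^sub>R w + (- (- 2 * t / D) - 2 * (t + 2 * t / D * (w \<bullet> y)) / Y) *\<^sub>R y"
        unfolding y_def[symmetric] by (simp only: r)
      also have "- (- 2 * t / D) - 2 * (t + 2 * t / D * (w \<bullet> y)) / Y = - 2 * t * W / (D * Y)"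
      proof -
        have W: "W = D + 2 * (w \<bullet> y) - Y" using D by simp
        show ?thesis unfolding W using Y Dpos by (simp add: field_simps)
      qed
      finally show ?thesis .
    qed
    show ?thesis
    proof (cases "g = a")
      case True
      then have "w = 0" "W = 0" by (simp_all add: w_def W_def zero_prod_def)
      then show ?thesis unfolding lhs using True
        by (simp add: Some ideal_inversion_def ideal_direction_def e_def)
    next
      case False
      have W: "W > 0" using False by (simp add: W_def w_def)
      have W': "(g - a) \<bullet> (g - a) = W" by (simp add: W_def w_def)
      have gp': "(a + inverse W *\<^sub>R (g - a), 0) - inversion a p = inverse W *\<^sub>R w - inverse Y *\<^sub>R y"
        by (simp add: y' w_def prod_eq_iff)
      have D': "(norm (inverse W *\<^sub>R w - inverse Y *\<^sub>R y))\<^sup>2 = D / (W * Y)"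
      proof -
        have "(norm (inverse W *\<^sub>R w - inverse Y *\<^sub>R y))\<^sup>2
            = inverse W * (inverse W * W) - 2 * (inverse W * (inverse Y * (w \<bullet> y))) + inverse Y * (inverse Y * Y)"
          by (simp add: power2_norm_eq_inner inner_diff_left inner_diff_right inner_commute W_def Y_def)
        also have "\<dots> = D / (W * Y)" unfolding D using W Y by (simp add: field_simps)
        finally show ?thesis .
      qed
      have "ideal_direction (ideal_inversion a \<xi>) (inversion a p)
          = e + (2 * (t / Y) / (D / (W * Y))) *\<^sub>R (inverse W *\<^sub>R w - inverse Y *\<^sub>R y)"
        unfolding Some ideal_inversion_def ideal_direction_def option.case using False
        by (simp add: W' gp' D' t' e_def)
      also have "\<dots> = e + (2 * (t / Y) / (D / (W * Y)) * inverse W) *\<^sub>R w + (- (2 * (t / Y) / (D / (W * Y)) * inverse Y)) *\<^sub>R y"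
        by (simp add: scaleR_diff_right)
      also have "2 * (t / Y) / (D / (W * Y)) * inverse W = 2 * t / D"
        using W Y Dpos by (simp add: field_simps)
      also have "- (2 * (t / Y) / (D / (W * Y)) * inverse Y) = - 2 * t * W / (D * Y)"
        using W Y Dpos by (simp add: field_simps)
      finally show ?thesis unfolding lhs by simp
    qed
  qed
qed

lemma inversion_derivative_ideal_direction:
  assumes p: "p \<in> H3"
  shows "(inverse ((inversion a p - (a, 0)) \<bullet> (inversion a p - (a, 0))) *\<^sub>R reflect (inversion a p - (a, 0)) v) \<bullet> ideal_direction \<xi> p
     = ((p - (a, 0)) \<bullet> (p - (a, 0))) * (v \<bullet> ideal_direction (ideal_inversion a \<xi>) (inversion a p))"
proof -
  define y where "y = p - (a, 0)"
  have y: "y \<noteq> 0" using H3_nonzero[OF p, of a] by (simp add: y_def)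
  have y': "inversion a p - (a, 0) = inverse (y \<bullet> y) *\<^sub>R y" by (simp add: inversion_def y_def)
  have "inverse ((inverse (y \<bullet> y) *\<^sub>R y) \<bullet> (inverse (y \<bullet> y) *\<^sub>R y)) = y \<bullet> y"
    using y by simp
  moreover have "reflect (inverse (y \<bullet> y) *\<^sub>R y) v = reflect y v"
    by (rule reflect_scaleR) (use y in simp)
  ultimately show ?thesis
    unfolding y' by (simp add: reflect_inner reflect_ideal_direction[OF p] y_def[symmetric]
        reflect_ideal_direction[OF p, of a, folded y_def])
qed

section \<open>The phase of a properly embedded end\<close>

text \<open>
  Just after \<open>0\<close> the function is above \<open>c\<close> and stays there until it next takes the value \<open>c\<close>, at the latest
  at \<open>1\<close>; but just before that it would have to be below \<open>c\<close>.
\<close>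

lemma no_two_upward_crossings:
  fixes u :: "real \<Rightarrow> real"
  assumes cont: "continuous_on {0..1} u" and ends: "u 0 = c" "u 1 = c"
    and up: "\<And>x. x \<in> {0..1} \<Longrightarrow> u x = c \<Longrightarrow> (\<forall>\<^sub>F y in at_right x. u y > c) \<and> (\<forall>\<^sub>F y in at_left x. u y < c)"
  shows False
proof -
  obtain d where d: "d > 0" "\<And>y. 0 < y \<Longrightarrow> y < d \<Longrightarrow> u y > c"
    using up[of 0] ends by (auto simp: eventually_at_right_field)
  define a where "a = min (d / 2) (1 / 2)"
  have a: "0 < a" "a < 1" "u a > c" using d by (auto simp: a_def)
  define Z where "Z = {x \<in> {a..1}. u x = c}"
  have "continuous_on {a..1} u" using cont a by (auto intro: continuous_on_subset)
  then have "closed Z" unfolding Z_def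
    by (rule continuous_closed_preimage_constant) simp
  moreover have "Z = {a..1} \<inter> Z" by (auto simp: Z_def)
  ultimately have "compact Z" by (metis compact_Icc compact_Int_closed)
  moreover have "1 \<in> Z" using a ends by (simp add: Z_def)
  ultimately obtain m where m: "m \<in> Z" "\<And>x. x \<in> Z \<Longrightarrow> m \<le> x"
    using compact_attains_inf[of Z] by blast
  have ma: "a < m" "m \<le> 1" "u m = c" using m(1) a by (auto simp: Z_def le_less)
  have above: "u y > c" if "a \<le> y" "y < m" for y
  proof (rule ccontr)
    assume "\<not> u y > c"
    then have "\<exists>x\<ge>a. x \<le> y \<and> u x = c"
      using that a ma cont by (intro IVT2') (auto intro: continuous_on_subset)
    then obtain x where "a \<le> x" "x \<le> y" "u x = c" by blast
    then show False using m(2)[of x] that ma by (simp add: Z_def)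
  qed
  obtain b where "b < m" "\<And>y. b < y \<Longrightarrow> y < m \<Longrightarrow> u y < c"
    using up[of m] ma a by (auto simp: eventually_at_left_field)
  then have "u ((max a b + m) / 2) < c" using ma by (auto simp: max_def)
  moreover have "u ((max a b + m) / 2) > c" using ma \<open>b < m\<close> by (intro above) (auto simp: max_def)
  ultimately show False by simp
qed

lemma local_side_function_subset:
  assumes "local_side_function E N B S" and "B' \<subseteq> B" and "E' \<inter> B' = E \<inter> B'"
  shows "local_side_function E' N B' S"
  using assms unfolding local_side_function_def by (blast intro: continuous_on_subset)

lemma ideal_direction_near_vertical:
  assumes g: "case \<xi> of None \<Rightarrow> True | Some g \<Rightarrow> norm ((g, 0) - p) \<ge> 16" and p: "p \<in> H3"
  shows "norm (ideal_direction \<xi> p - (0, 1)) \<le> snd p / 8"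
proof (cases \<xi>)
  case None
  then show ?thesis using p by (simp add: ideal_direction_def H3_def)
next
  case (Some g)
  define n where "n = norm ((g, 0) - p)"
  have n: "n \<ge> 16" using g Some by (simp add: n_def)
  have "norm (ideal_direction \<xi> p - (0, 1)) = 2 * snd p / n\<^sup>2 * n"
    using p unfolding Some ideal_direction_def n_def by (simp add: H3_def)
  also have "\<dots> = 2 * snd p / n" using n by (simp add: power2_eq_square)
  also have "\<dots> \<le> 2 * snd p / 16" using n p by (intro divide_left_mono) (auto simp: H3_def)
  finally show ?thesis by simp
qed

locale proper_end = oriented_end +
  fixes G :: "complex \<Rightarrow> sphere_at_infinity"
  assumes proper: "\<And>K. compact K \<Longrightarrow> K \<subseteq> H3 \<Longrightarrow> compact (E \<inter> K)"
    and gauss: "\<And>z. z \<in> interior punctured_disk \<Longrightarrow> N (\<phi> z) = snd (\<phi> z) *\<^sub>R ideal_direction (G z) (\<phi> z)"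
begin

text \<open>
  The parameters of \<open>E \<inter> K\<close> form a compact subset of the disk which does not contain the puncture.
\<close>

lemma leaves_compact:
  assumes "compact K" "K \<subseteq> H3"
  obtains e where "e > 0" "e \<le> 1" "\<And>z. 0 < norm z \<Longrightarrow> norm z < e \<Longrightarrow> \<phi> z \<notin> K"
proof -
  have "continuous_on (E \<inter> K) \<psi>"
    using homeo by (auto simp: homeomorphism_def intro: continuous_on_subset)
  then have "compact (\<psi> ` (E \<inter> K))"
    using proper[OF assms] by (rule compact_continuous_image)
  then have "closed (\<psi> ` (E \<inter> K))" by (rule compact_imp_closed)
  moreover have "0 \<notin> \<psi> ` (E \<inter> K)" using \<psi>_in by (force simp: punctured_disk_def)
  ultimately obtain e where e: "e > 0" "ball 0 e \<subseteq> - (\<psi> ` (E \<inter> K))"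
    using open_contains_ball[of "- (\<psi> ` (E \<inter> K))"] by (metis ComplI open_Compl)
  show ?thesis
  proof (rule that[of "min e 1"])
    fix z :: complex assume z: "0 < norm z" "norm z < min e 1"
    then have zd: "z \<in> punctured_disk" by (simp add: punctured_disk_def)
    show "\<phi> z \<notin> K"
    proof
      assume "\<phi> z \<in> K"
      then have "\<psi> (\<phi> z) \<in> \<psi> ` (E \<inter> K)" using \<phi>_in[OF zd] by blast
      then show False using e(2) z \<psi>_\<phi>[OF zd] by auto
    qed
  qed (use e in auto)
qed

lemma closed_in_H3: "closedin (top_of_set H3) E"
proof -
  have "y \<in> E" if y: "y \<in> H3" "y islimpt E" for y
  proof -
    obtain r where r: "r > 0" "cball y r \<subseteq> H3" using open_H3 y(1) open_contains_cball by blast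
    obtain f where f: "\<And>n. f n \<in> E - {y}" "f \<longlonglongrightarrow> y" using y(2) islimpt_sequential by blast
    have "\<forall>\<^sub>F n in sequentially. f n \<in> ball y r" using f(2) r(1) by (intro topological_tendstoD) auto
    then have "\<forall>\<^sub>F n in sequentially. f n \<in> E \<inter> cball y r"
      by eventually_elim (use f(1) in auto)
    moreover have "closed (E \<inter> cball y r)"
      by (rule compact_imp_closed[OF proper[OF compact_cball r(2)]])
    ultimately have "y \<in> E \<inter> cball y r"
      using Lim_in_closed_set[OF _ _ trivial_limit_sequentially f(2)] by blast
    then show ?thesis by blast
  qed
  then show ?thesis using subset_H3 by (auto simp: closedin_limpt)
qed

text \<open>
  The phase of the end off the image of the unit circle has an argument \<open>h\<close> off a
  compact set. On the end its values are multiples of \<open>2 \<pi>\<close>, so it has a single value \<open>c\<close> on the image of a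
  punctured disk, which is connected.
\<close>

lemma end_phase:
  obtains K e h c where "compact K" "K \<subseteq> H3" "e > 0" "e \<le> 1" "continuous_on (H3 - K) h"
    "\<And>z. 0 < norm z \<Longrightarrow> norm z < e \<Longrightarrow> \<phi> z \<notin> K \<and> h (\<phi> z) = (c :: real)"
    "\<And>y. y \<in> H3 - K \<Longrightarrow> h y = c \<Longrightarrow> y \<in> E"
    "crosses_upward N (\<phi> ` {z. 0 < norm z \<and> norm z < e}) h c"
proof -
  define K where "K = \<phi> ` sphere 0 1"
  have cont\<phi>: "continuous_on punctured_disk \<phi>" using homeo by (simp add: homeomorphism_def)
  have K: "compact K" unfolding K_def
    using cont\<phi> by (intro compact_continuous_image) (auto simp: punctured_disk_def intro: continuous_on_subset)
  have KE: "K \<subseteq> E"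
    unfolding K_def by (intro image_subsetI \<phi>_in) (auto simp: punctured_disk_def)
  then have KH: "K \<subseteq> H3" using subset_H3 by blast
  define M where "M = H3 - K"
  have M: "open M" "M \<noteq> UNIV"
  proof -
    show "open M" unfolding M_def using open_H3 K by (intro open_Diff compact_imp_closed)
    have "(0, 0) \<notin> M" by (simp add: M_def H3_def)
    then show "M \<noteq> UNIV" by blast
  qed
  define E' where "E' = E - K"
  have E': "closedin (top_of_set M) E'"
  proof -
    obtain C where "closed C" "E = H3 \<inter> C" using closed_in_H3 by (auto simp: closedin_closed)
    then show ?thesis unfolding closedin_closed by (intro exI[of _ C]) (auto simp: E'_def M_def)
  qed
  have int: "z \<in> interior punctured_disk \<longleftrightarrow> 0 < norm z \<and> norm z < 1" for z
    by (simp add: interior_punctured_disk)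
  have E'D: "\<exists>z \<in> interior punctured_disk. q = \<phi> z" if "q \<in> E'" for q
  proof (intro bexI)
    show "q = \<phi> (\<psi> q)" using that \<phi>_\<psi> by (simp add: E'_def)
    have qE: "q \<in> E" "q \<notin> K" using that by (simp_all add: E'_def)
    have "norm (\<psi> q) \<noteq> 1"
    proof
      assume "norm (\<psi> q) = 1"
      then have "\<phi> (\<psi> q) \<in> K" unfolding K_def by (intro imageI) simp
      then show False using qE \<phi>_\<psi>[OF qE(1)] by simp
    qed
    moreover have "0 < norm (\<psi> q)" "norm (\<psi> q) \<le> 1"
      using \<psi>_in[OF qE(1)] by (simp_all add: punctured_disk_def)
    ultimately show "\<psi> q \<in> interior punctured_disk" unfolding int by simp
  qed
  have inE': "\<phi> z \<in> E'" if "z \<in> interior punctured_disk" for z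
  proof -
    have z: "z \<in> punctured_disk" using that interior_subset by blast
    have "\<phi> z \<notin> K"
    proof
      assume "\<phi> z \<in> K"
      then obtain w where w: "norm w = 1" "\<phi> z = \<phi> w" by (auto simp: K_def)
      have "w \<in> punctured_disk" unfolding punctured_disk_def using w(1) by auto
      then have "w = z" by (metis \<psi>_\<phi> z w(2))
      then show False using that[unfolded int] w(1) by simp
    qed
    then show ?thesis using \<phi>_in[OF z] by (simp add: E'_def)
  qed
  have ne: "E' \<noteq> {}" using inE'[of "1 / 2"] by (auto simp: int)
  have loc: "\<exists>r>0. \<exists>S. ball q r \<subseteq> M \<and> local_side_function E' N (ball q r) S" if q: "q \<in> E'" for q
  proof -
    obtain z where z: "z \<in> interior punctured_disk" "q = \<phi> z" using E'D[OF q] by blast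
    obtain r S where r: "r > 0" "local_side_function E N (ball q r) S"
      using local_side_function_exists[OF z(1)] z(2) by blast
    have "q \<in> M" using q E' closedin_imp_subset by blast
    then obtain r' where r': "r' > 0" "ball q r' \<subseteq> M" using M(1) open_contains_ball by blast
    have "local_side_function E' N (ball q (min r r')) S"
      by (rule local_side_function_subset[OF r(2)]) (use r'(2) in \<open>auto simp: E'_def M_def subset_iff\<close>)
    then show ?thesis using r r' by (intro exI[of _ "min r r'"]) auto
  qed
  obtain f where f: "continuous_on M f" "\<And>y. y \<in> M \<Longrightarrow> norm (f y) = 1" "\<And>y. y \<in> M \<Longrightarrow> f y = 1 \<longleftrightarrow> y \<in> E'"
    and cross: "crosses_upward N E' (\<lambda>y. Im (f y)) 0"
    using phase_of_two_sided_set[OF M E' ne loc] by blast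
  have f0: "f p \<noteq> 0" if "p \<in> H3 - K" for p using f(2)[of p] that by (auto simp: M_def)
  obtain K' g where K': "compact K'" "K' \<subseteq> H3" and g: "continuous_on (H3 - K') g"
    "\<And>p. p \<in> H3 - K' \<Longrightarrow> p \<notin> K \<and> f p = exp (g p)"
    using logarithm_off_compact[OF K KH f(1)[unfolded M_def] f0] by blast
  define h where "h = (\<lambda>p. Im (g p))"
  have conth: "continuous_on (H3 - K') h" unfolding h_def using g(1) by (rule continuous_on_Im)
  have inM: "p \<in> M" if "p \<in> H3 - K'" for p using g(2)[OF that] that by (simp add: M_def)
  have fh: "f p = cis (h p)" if "p \<in> H3 - K'" for p
  proof -
    have "norm (exp (g p)) = 1" using f(2)[OF inM[OF that]] g(2)[OF that] by simp
    then have "Re (g p) = 0" by simp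
    then show ?thesis using g(2)[OF that] by (simp add: h_def exp_eq_polar)
  qed
  obtain e where e: "e > 0" "e \<le> 1" "\<And>z. 0 < norm z \<Longrightarrow> norm z < e \<Longrightarrow> \<phi> z \<notin> K'"
    using leaves_compact[OF K'] by blast
  define D where "D = ball 0 e - {0 :: complex}"
  have D: "z \<in> D \<longleftrightarrow> 0 < norm z \<and> norm z < e" for z by (auto simp: D_def)
  have Dint: "D \<subseteq> interior punctured_disk" using e(2) by (auto simp: D int)
  have \<phi>D: "\<phi> z \<in> H3 - K'" "f (\<phi> z) = 1" if "z \<in> D" for z
  proof -
    have "z \<in> interior punctured_disk" using that Dint by blast
    then have E: "\<phi> z \<in> E'" by (rule inE')
    then show H: "\<phi> z \<in> H3 - K'" using e(3) that D subset_H3 by (auto simp: E'_def)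
    show "f (\<phi> z) = 1" using f(3)[OF inM[OF H]] E by simp
  qed
  have "(\<lambda>z. h (\<phi> z)) constant_on D"
  proof (rule continuous_discrete_range_constant)
    show "connected D" unfolding D_def by (rule connected_punctured_ball) simp
    have "continuous_on D \<phi>" using cont\<phi> Dint interior_subset by (metis continuous_on_subset)
    then show "continuous_on D (\<lambda>z. h (\<phi> z))"
      by (rule continuous_on_compose2[OF conth]) (use \<phi>D in auto)
    fix z assume z: "z \<in> D"
    have "2 * pi \<le> norm (h (\<phi> w) - h (\<phi> z))" if w: "w \<in> D" "h (\<phi> w) \<noteq> h (\<phi> z)" for w
    proof -
      have "cis (h (\<phi> w) - h (\<phi> z)) = 1"
        using fh[OF \<phi>D(1)[OF z]] fh[OF \<phi>D(1)[OF w(1)]] \<phi>D(2)[OF z] \<phi>D(2)[OF w(1)]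
        by (simp add: cis_divide[symmetric])
      then have "cos (h (\<phi> w) - h (\<phi> z)) = 1" by (metis cis.simps(1) one_complex.simps(1))
      then obtain n :: int where n: "h (\<phi> w) - h (\<phi> z) = of_int n * 2 * pi"
        using cos_one_2pi_int by blast
      then have "n \<noteq> 0" using w by auto
      then have "1 \<le> \<bar>real_of_int n\<bar>" by linarith
      then have "1 * (2 * pi) \<le> \<bar>real_of_int n\<bar> * (2 * pi)" by (intro mult_right_mono) auto
      then show ?thesis unfolding n by (simp add: abs_mult)
    qed
    then show "\<exists>e>0. \<forall>y. y \<in> D \<and> h (\<phi> y) \<noteq> h (\<phi> z) \<longrightarrow> e \<le> norm (h (\<phi> y) - h (\<phi> z))"
      by (intro exI[of _ "2 * pi"]) auto
  qed
  then obtain c where c: "\<And>z. z \<in> D \<Longrightarrow> h (\<phi> z) = c" unfolding constant_on_def by blast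
  have D0: "of_real (e / 2) \<in> D" using e(1) by (simp add: D)
  have cis_c: "cis c = 1" using fh[OF \<phi>D(1)[OF D0]] \<phi>D(2)[OF D0] c[OF D0] by simp
  show ?thesis
  proof (rule that[OF K' e(1,2) conth, of c])
    fix z :: complex assume "0 < norm z" "norm z < e"
    then show "\<phi> z \<notin> K' \<and> h (\<phi> z) = c" using e(3) c D by blast
  next
    fix y assume y: "y \<in> H3 - K'" "h y = c"
    then have "f y = 1" using fh[OF y(1)] cis_c by simp
    then show "y \<in> E" using f(3)[OF inM[OF y(1)]] by (simp add: E'_def)
  next
    show "crosses_upward N (\<phi> ` {z. 0 < norm z \<and> norm z < e}) h c"
      unfolding crosses_upward_def
    proof (intro allI impI)
      fix \<gamma> s v
      assume "\<gamma> s \<in> \<phi> ` {z. 0 < norm z \<and> norm z < e} \<and> (\<gamma> has_vector_derivative v) (at s) \<and> v \<bullet> N (\<gamma> s) > 0"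
      then obtain z where z: "z \<in> D" "\<gamma> s = \<phi> z" and dv: "(\<gamma> has_vector_derivative v) (at s)" "v \<bullet> N (\<gamma> s) > 0"
        using D by blast
      have \<gamma>E: "\<gamma> s \<in> E'" using inE' Dint z by auto
      have oK: "open (H3 - K')" using open_H3 K' by (intro open_Diff compact_imp_closed)
      have \<gamma>s: "\<gamma> s \<in> H3 - K'" "h (\<gamma> s) = c" using z \<phi>D(1)[OF z(1)] c[OF z(1)] by simp_all
      have "isCont \<gamma> s" using dv(1) has_vector_derivative_continuous by blast
      then have lim: "(\<gamma> \<longlongrightarrow> \<gamma> s) (at s)" by (simp add: isCont_def)
      then have ev1: "\<forall>\<^sub>F x in at s. \<gamma> x \<in> H3 - K'" using oK \<gamma>s(1) by (intro topological_tendstoD)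
      have "isCont h (\<gamma> s)" using conth oK \<gamma>s(1) continuous_on_eq_continuous_at by blast
      then have "((\<lambda>x. h (\<gamma> x)) \<longlongrightarrow> h (\<gamma> s)) (at s)" using lim by (rule isCont_tendsto_compose)
      then have ev2: "\<forall>\<^sub>F x in at s. dist (h (\<gamma> x)) c < pi" unfolding \<gamma>s(2) by (rule tendstoD) simp
      have Imf: "Im (f (\<gamma> x)) = sin (h (\<gamma> x) - c)" if "\<gamma> x \<in> H3 - K'" for x
      proof -
        have "cis (h (\<gamma> x) - c) = f (\<gamma> x)" using fh[OF that] cis_c by (simp add: cis_divide[symmetric])
        then show ?thesis by (metis cis.simps(2))
      qed
      note ev = crosses_upwardD[OF cross \<gamma>E dv]
      have "\<forall>\<^sub>F x in at_right s. h (\<gamma> x) > c"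
        using ev(1) ev1[THEN eventually_at_split[THEN iffD1], THEN conjunct2] ev2[THEN eventually_at_split[THEN iffD1], THEN conjunct2]
      proof eventually_elim
        case (elim x)
        then have "sin (h (\<gamma> x) - c) > 0" "\<bar>h (\<gamma> x) - c\<bar> < pi" using Imf[of x] by (auto simp: dist_real_def)
        moreover have "sin (h (\<gamma> x) - c) = - sin (c - h (\<gamma> x))"
          using sin_minus[of "c - h (\<gamma> x)"] by (simp only: minus_diff_eq)
        ultimately show ?case using sin_ge_zero[of "c - h (\<gamma> x)"] by linarith
      qed
      moreover have "\<forall>\<^sub>F x in at_left s. h (\<gamma> x) < c"
        using ev(2) ev1[THEN eventually_at_split[THEN iffD1], THEN conjunct1] ev2[THEN eventually_at_split[THEN iffD1], THEN conjunct1]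
      proof eventually_elim
        case (elim x)
        then have "sin (h (\<gamma> x) - c) < 0" "\<bar>h (\<gamma> x) - c\<bar> < pi" using Imf[of x] by (auto simp: dist_real_def)
        then show ?case using sin_ge_zero[of "h (\<gamma> x) - c"] by linarith
      qed
      ultimately show "(\<forall>\<^sub>F x in at_right s. h (\<gamma> x) > c) \<and> (\<forall>\<^sub>F x in at_left s. h (\<gamma> x) < c)" by blast
    qed
  qed
qed

end

section \<open>Accumulation at infinity\<close>

context proper_end
begin

text \<open>
  The map \<open>T\<close> is the isometry which moves the limit of the Gauss map to \<open>\<infinity>\<close>, with differential \<open>T'\<close> and action \<open>\<sigma>\<close> on ideal
  points; it is the identity or an inversion. The segment is drawn in the image of \<open>T\<close>, where the normals are nearly
  vertical, and pulled back by the involution \<open>T\<close> to a curve whose crossings with \<open>E\<close> are detected by \<open>h\<close>.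
\<close>

lemma no_accumulation_away_from_gauss_limit:
  fixes T :: "complex \<times> real \<Rightarrow> complex \<times> real" and b :: complex
  assumes T_H3: "\<And>p. p \<in> H3 \<Longrightarrow> T p \<in> H3" and TT: "\<And>p. p \<in> H3 \<Longrightarrow> T (T p) = p"
    and dT: "\<And>p. p \<in> H3 \<Longrightarrow> (T has_derivative T' p) (at p)"
    and conj: "\<And>p v \<xi>. p \<in> H3 \<Longrightarrow>
      \<exists>l>0. T' (T p) v \<bullet> ideal_direction \<xi> p = l * (v \<bullet> ideal_direction (\<sigma> \<xi>) (T p))"
    and far: "\<And>R. \<exists>e>0. \<forall>z. 0 < norm z \<and> norm z < e \<longrightarrow>
      (case \<sigma> (G z) of None \<Rightarrow> True | Some g \<Rightarrow> norm g \<ge> R)"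
    and acc: "\<And>d. d > 0 \<Longrightarrow> \<exists>p\<in>E. dist (T p) (b, 0) < d"
  shows False
proof -
  obtain K e h c where K: "compact K" "K \<subseteq> H3" and e: "e > 0" "e \<le> 1" and conth: "continuous_on (H3 - K) h"
    and hc: "\<And>z. 0 < norm z \<Longrightarrow> norm z < e \<Longrightarrow> \<phi> z \<notin> K \<and> h (\<phi> z) = (c :: real)"
    and hE: "\<And>y. y \<in> H3 - K \<Longrightarrow> h y = c \<Longrightarrow> y \<in> E"
    and cross: "crosses_upward N (\<phi> ` {z. 0 < norm z \<and> norm z < e}) h c"
    using end_phase by blast
  \<comment> \<open>With endpoints of modulus at least \<open>|b| + 17\<close>, points within distance \<open>1\<close> of \<open>(b, 0)\<close> are at distance at least \<open>16\<close> from them.\<close>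
  obtain e' where e': "e' > 0" and far': "\<And>z. 0 < norm z \<Longrightarrow> norm z < e' \<Longrightarrow>
      (case \<sigma> (G z) of None \<Rightarrow> True | Some g \<Rightarrow> norm g \<ge> norm b + 17)"
    using far[of "norm b + 17"] by blast
  define e0 where "e0 = min e e'"
  have e0: "e0 > 0" "e0 \<le> 1" using e e' by (simp_all add: e0_def)
  define A where "A = {z :: complex. e0 \<le> norm z \<and> norm z \<le> 1}"
  have Apd: "A \<subseteq> punctured_disk" using e0 by (auto simp: A_def punctured_disk_def)
  define K1 where "K1 = K \<union> \<phi> ` A"
  have "A = cball 0 1 - ball 0 e0" by (auto simp: A_def)
  then have "compact A" by (simp add: compact_diff)
  then have "compact (\<phi> ` A)"
    using homeo Apd by (intro compact_continuous_image) (auto simp: homeomorphism_def intro: continuous_on_subset)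
  then have K1: "compact K1" unfolding K1_def using K(1) by (rule compact_Un[rotated])
  have K1H: "K1 \<subseteq> H3"
    unfolding K1_def using K(2) \<phi>_in Apd subset_H3 by blast
  have K1ne: "K1 \<noteq> {}" using e0 by (auto simp: K1_def A_def intro!: exI[of _ 1])
  have contT: "continuous_on H3 T"
    using dT has_derivative_continuous by (intro continuous_at_imp_continuous_on ballI) blast
  have "compact ((\<lambda>p. snd (T p)) ` K1)"
    using contT K1H by (intro compact_continuous_image continuous_on_snd K1) (rule continuous_on_subset)
  then obtain t0 where t0: "t0 \<in> (\<lambda>p. snd (T p)) ` K1" "\<And>p. p \<in> K1 \<Longrightarrow> t0 \<le> snd (T p)"
    using compact_attains_inf[of "(\<lambda>p. snd (T p)) ` K1"] K1ne by blast
  have t0pos: "t0 > 0" using t0(1) T_H3 K1H by (auto simp: H3_def)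
  have avoid: "T p \<notin> K1" if "p \<in> H3" "snd p < t0" for p
    using t0(2)[of "T p"] TT[OF that(1)] that(2) by auto
  have near: "\<exists>z. 0 < norm z \<and> norm z < e0 \<and> p = \<phi> z" if p: "p \<in> E" "p \<notin> K1" for p
  proof -
    have "\<psi> p \<in> punctured_disk" "p = \<phi> (\<psi> p)" using \<psi>_in \<phi>_\<psi> p by auto
    moreover from this have "\<psi> p \<notin> A" using p(2) by (metis K1_def UnI2 imageI)
    ultimately show ?thesis by (intro exI[of _ "\<psi> p"]) (auto simp: A_def punctured_disk_def)
  qed
  define \<delta> where "\<delta> = min 1 t0"
  have \<delta>: "\<delta> > 0" "\<delta> \<le> 1" "\<delta> \<le> t0" using t0pos by (simp_all add: \<delta>_def)
  have snd_dist: "snd p \<le> dist p (b, 0)" for p :: "complex \<times> real"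
  proof -
    have "p - (b, 0) = (fst p - b, snd p)" by (simp add: prod_eq_iff)
    then show ?thesis using norm_snd_le[of "snd p" "fst p - b"] by (simp add: dist_norm)
  qed
  obtain p1 where p1: "p1 \<in> E" "dist (T p1) (b, 0) < \<delta>" using acc[OF \<delta>(1)] by blast
  define y1 where "y1 = T p1"
  have y1: "y1 \<in> H3" unfolding y1_def using p1(1) subset_H3 T_H3 by blast
  define t1 where "t1 = snd y1"
  have t1: "t1 > 0" using y1 by (simp add: t1_def H3_def)
  \<comment> \<open>More than half of the height \<open>t1\<close> is gained along the segment from \<open>y2\<close> to \<open>y1\<close>.\<close>
  have "min \<delta> (t1 / 2) > 0" using \<delta>(1) t1 by simp
  from acc[OF this] obtain p2 where p2: "p2 \<in> E" "dist (T p2) (b, 0) < min \<delta> (t1 / 2)" by blast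
  define y2 where "y2 = T p2"
  have y2: "y2 \<in> H3" unfolding y2_def using p2(1) subset_H3 T_H3 by blast
  have t2: "snd y2 > 0" "snd y2 < t1 / 2"
    using y2 p2(2) snd_dist[of y2] by (auto simp: H3_def y2_def)
  define v where "v = y1 - y2"
  define y where "y = (\<lambda>x::real. y2 + x *\<^sub>R v)"
  have yend: "y 0 = y2" "y 1 = y1" by (simp_all add: y_def v_def)
  have y12: "y1 \<in> ball (b, 0) \<delta>" "y2 \<in> ball (b, 0) \<delta>"
    using p1(2) p2(2) by (auto simp: y1_def y2_def dist_commute)
  have seg: "y x \<in> ball (b, 0) \<delta>" "y x \<in> H3" "snd (y x) \<le> t1" if x: "x \<in> {0..1}" for x
  proof -
    have eq: "y x = (1 - x) *\<^sub>R y2 + x *\<^sub>R y1" by (simp add: y_def v_def algebra_simps)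
    show "y x \<in> ball (b, 0) \<delta>"
      unfolding eq using x by (intro convexD[OF convex_ball y12(2,1)]) auto
    have "snd (y x) = (1 - x) * snd y2 + x * t1" by (simp add: eq t1_def)
    moreover have "(1 - x) * snd y2 \<ge> 0" "x * t1 \<ge> 0" using x t1 t2 by simp_all
    moreover have "(1 - x) * snd y2 > 0 \<or> x * t1 > 0" using x t1 t2 by (cases "x = 0") auto
    moreover have "(1 - x) * snd y2 \<le> (1 - x) * t1" using x t2 t1 by (intro mult_left_mono) auto
    ultimately show "y x \<in> H3" "snd (y x) \<le> t1" by (auto simp: H3_def algebra_simps)
  qed
  have off: "T (y x) \<in> H3 - K1" if x: "x \<in> {0..1}" for x
  proof -
    have "snd (y x) < t0"
      using snd_dist[of "y x"] seg(1)[OF x] \<delta>(3) by (auto simp: dist_commute)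
    then show ?thesis using avoid seg(2)[OF x] T_H3 by blast
  qed
  define \<gamma> where "\<gamma> = (\<lambda>x. T (y x))"
  have d\<gamma>: "(\<gamma> has_vector_derivative T' (y x) v) (at x)" if x: "x \<in> {0..1}" for x
  proof -
    have dy: "(y has_derivative (\<lambda>s. s *\<^sub>R v)) (at x)"
      unfolding y_def by (auto intro!: derivative_eq_intros)
    have dTx: "(T has_derivative T' (y x)) (at (y x))" by (rule dT[OF seg(2)[OF x]])
    have "(\<gamma> has_derivative (\<lambda>s. T' (y x) (s *\<^sub>R v))) (at x)"
      unfolding \<gamma>_def by (rule has_derivative_compose[OF dy dTx])
    then show ?thesis
      unfolding has_vector_derivative_def
      by (rule has_derivative_eq_rhs)
        (simp add: fun_eq_iff linear_cmul[OF bounded_linear.linear[OF has_derivative_bounded_linear[OF dTx]]])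
  qed
  have vnorm: "norm v \<le> 2"
  proof -
    have "norm v \<le> dist y1 (b, 0) + dist y2 (b, 0)"
      unfolding v_def dist_norm by norm
    then show ?thesis using y12 \<delta>(2) by (simp add: dist_commute)
  qed
  \<comment> \<open>The tilt of the normal costs at most \<open>2 * (t1 / 8)\<close>, which is less than the height gained.\<close>
  have steep: "v \<bullet> ideal_direction \<xi> (y x) > 0"
    if x: "x \<in> {0..1}" and \<xi>: "case \<xi> of None \<Rightarrow> True | Some g \<Rightarrow> norm g \<ge> norm b + 17" for x \<xi>
  proof -
    have yb: "norm (y x - (b, 0)) < 1"
      using seg(1)[OF x] \<delta>(2) by (simp add: dist_norm norm_minus_commute)
    have "case \<xi> of None \<Rightarrow> True | Some g \<Rightarrow> norm ((g, 0) - y x) \<ge> 16"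
    proof (cases \<xi>)
      case (Some g)
      have "norm g = norm ((g, 0::real))" "norm b = norm ((b, 0::real))" by (simp_all add: norm_Pair)
      moreover have "norm ((g, 0::real)) \<le> norm ((g, 0) - y x) + norm (y x - (b, 0)) + norm ((b, 0::real))" by norm
      ultimately have "norm g \<le> norm ((g, 0) - y x) + 1 + norm b" using yb by linarith
      then show ?thesis using Some \<xi> by simp
    qed simp
    from ideal_direction_near_vertical[OF this seg(2)[OF x]]
    have "norm (ideal_direction \<xi> (y x) - (0, 1)) \<le> t1 / 8" using seg(3)[OF x] by linarith
    then have "norm v * norm (ideal_direction \<xi> (y x) - (0, 1)) \<le> 2 * (t1 / 8)"
      using vnorm by (intro mult_mono) auto
    then have "\<bar>v \<bullet> (ideal_direction \<xi> (y x) - (0, 1))\<bar> \<le> t1 / 4"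
      using Cauchy_Schwarz_ineq2[of v "ideal_direction \<xi> (y x) - (0, 1)"] by linarith
    moreover have "v \<bullet> (0, 1) = t1 - snd y2" by (simp add: v_def t1_def inner_prod_def)
    ultimately show ?thesis using t2 t1 unfolding inner_diff_right by linarith
  qed
  show False
  proof (rule no_two_upward_crossings[of "\<lambda>x. h (\<gamma> x)" c])
    have "continuous_on {0..1} \<gamma>"
      using d\<gamma> has_vector_derivative_continuous by (intro continuous_at_imp_continuous_on ballI) blast
    moreover have "\<gamma> ` {0..1} \<subseteq> H3 - K" using off by (auto simp: \<gamma>_def K1_def)
    ultimately show "continuous_on {0..1} (\<lambda>x. h (\<gamma> x))"
      by (rule continuous_on_compose2[OF conth])
    have onE: "h p = c" if "p \<in> E" "p \<notin> K1" for p
      using near[OF that] hc by (auto simp: e0_def)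
    have g0: "\<gamma> 0 = p2" using TT[of p2] p2(1) subset_H3 by (simp add: \<gamma>_def yend y2_def subsetD)
    have g1: "\<gamma> 1 = p1" using TT[of p1] p1(1) subset_H3 by (simp add: \<gamma>_def yend y1_def subsetD)
    show "h (\<gamma> 0) = c" using onE[of p2] p2(1) off[of 0] g0 by (simp add: \<gamma>_def)
    show "h (\<gamma> 1) = c" using onE[of p1] p1(1) off[of 1] g1 by (simp add: \<gamma>_def)
    fix x :: real assume x: "x \<in> {0..1}" and hx: "h (\<gamma> x) = c"
    have \<gamma>x: "\<gamma> x \<in> H3 - K1" using off[OF x] by (simp add: \<gamma>_def)
    have "\<gamma> x \<in> E" using hE[OF _ hx] \<gamma>x by (simp add: K1_def)
    then obtain z where z: "0 < norm z" "norm z < e0" "\<gamma> x = \<phi> z" using near \<gamma>x by blast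
    have zi: "z \<in> interior punctured_disk" using z e0 by (simp add: interior_punctured_disk)
    have "case \<sigma> (G z) of None \<Rightarrow> True | Some g \<Rightarrow> norm g \<ge> norm b + 17"
      using far' z by (simp add: e0_def)
    from steep[OF x this] have pos: "v \<bullet> ideal_direction (\<sigma> (G z)) (y x) > 0" .
    have Ty: "T (\<gamma> x) = y x" using TT[OF seg(2)[OF x]] by (simp add: \<gamma>_def)
    obtain l where l: "l > 0"
      "T' (T (\<gamma> x)) v \<bullet> ideal_direction (G z) (\<gamma> x) = l * (v \<bullet> ideal_direction (\<sigma> (G z)) (T (\<gamma> x)))"
      using conj[of "\<gamma> x" v "G z"] \<gamma>x by blast
    have "T' (y x) v \<bullet> N (\<gamma> x) = snd (\<gamma> x) * (l * (v \<bullet> ideal_direction (\<sigma> (G z)) (y x)))"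
      using l(2) gauss[OF zi] by (simp add: Ty z(3)[symmetric])
    moreover have "snd (\<gamma> x) > 0" using \<gamma>x by (simp add: H3_def)
    ultimately have "T' (y x) v \<bullet> N (\<gamma> x) > 0" using l(1) pos by simp
    moreover have "\<gamma> x \<in> \<phi> ` {z. 0 < norm z \<and> norm z < e}" using z by (auto simp: e0_def)
    ultimately show "(\<forall>\<^sub>F x in at_right x. h (\<gamma> x) > c) \<and> (\<forall>\<^sub>F x in at_left x. h (\<gamma> x) < c)"
      using crosses_upwardD[OF cross _ d\<gamma>[OF x]] by blast
  qed
qed

end

section \<open>The ideal boundary\<close>

lemma sphere_meromorphic_limit_infinity:
  assumes G: "sphere_meromorphic_at G 0" and G0: "G 0 = None"
  shows "\<exists>e>0. \<forall>z. 0 < norm z \<and> norm z < e \<longrightarrow> (case G z of None \<Rightarrow> True | Some g \<Rightarrow> norm g \<ge> R)"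
  using G unfolding sphere_meromorphic_at_def
proof
  assume "\<forall>\<^sub>F w in nhds 0. G w = None"
  then obtain e where "e > 0" "\<And>w. norm w < e \<Longrightarrow> G w = None"
    by (auto simp: eventually_nhds_metric)
  then show ?thesis by (intro exI[of _ e]) auto
next
  assume "\<exists>r>0. \<exists>g. g nicely_meromorphic_on ball 0 r \<and> (\<forall>w\<in>ball 0 r. G w = (if is_pole g w then None else Some (g w)))"
  then obtain r g where r: "r > 0" and Gg: "\<And>w. w \<in> ball 0 r \<Longrightarrow> G w = (if is_pole g w then None else Some (g w))"
    by blast
  have "is_pole g 0" using Gg[of 0] G0 r by (simp split: if_splits)
  then have "\<forall>\<^sub>F w in at 0. norm (g w) \<ge> R"
    unfolding is_pole_def filterlim_at_infinity_conv_norm_at_top filterlim_at_top by blast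
  then obtain d where d: "d > 0" "\<And>w. w \<noteq> 0 \<Longrightarrow> norm w < d \<Longrightarrow> norm (g w) \<ge> R"
    by (auto simp: eventually_at)
  show ?thesis
  proof (intro exI[of _ "min r d"] conjI allI impI)
    fix z :: complex assume z: "0 < norm z \<and> norm z < min r d"
    then have "G z = (if is_pole g z then None else Some (g z))" by (intro Gg) simp
    then show "case G z of None \<Rightarrow> True | Some g \<Rightarrow> norm g \<ge> R" using d(2)[of z] z by simp
  qed (use r d in simp)
qed

lemma sphere_meromorphic_limit_finite:
  assumes G: "sphere_meromorphic_at G 0" and G0: "G 0 = Some a" and d: "d > 0"
  shows "\<exists>e>0. \<forall>z. norm z < e \<longrightarrow> (\<exists>g. G z = Some g \<and> dist g a < d)"
  using G unfolding sphere_meromorphic_at_def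
proof
  assume "\<forall>\<^sub>F w in nhds 0. G w = None"
  then have "G 0 = None" by (rule eventually_nhds_x_imp_x)
  then show ?thesis using G0 by simp
next
  assume "\<exists>r>0. \<exists>g. g nicely_meromorphic_on ball 0 r \<and> (\<forall>w\<in>ball 0 r. G w = (if is_pole g w then None else Some (g w)))"
  then obtain r g where r: "r > 0" and g: "g nicely_meromorphic_on ball 0 r"
    and Gg: "\<And>w. w \<in> ball 0 r \<Longrightarrow> G w = (if is_pole g w then None else Some (g w))"
    by blast
  have np: "\<not> is_pole g 0" and ga: "g 0 = a" using Gg[of 0] G0 r by (simp_all split: if_splits)
  have "g analytic_on {0}" by (rule nicely_meromorphic_on_imp_analytic_at[OF g _ np]) (use r in simp)
  then obtain s where s: "s > 0" "g holomorphic_on ball 0 s" by (auto simp: analytic_on_def)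
  have "isCont g 0"
    using holomorphic_on_imp_continuous_on[OF s(2)] s(1) by (simp add: continuous_on_eq_continuous_at)
  then have "(g \<longlongrightarrow> a) (at 0)" by (simp add: isCont_def ga)
  then have "\<forall>\<^sub>F w in at 0. dist (g w) a < d" using d by (rule tendstoD)
  then obtain \<delta> where \<delta>: "\<delta> > 0" "\<And>w. w \<noteq> 0 \<Longrightarrow> norm w < \<delta> \<Longrightarrow> dist (g w) a < d"
    by (auto simp: eventually_at)
  show ?thesis
  proof (intro exI[of _ "min r (min s \<delta>)"] conjI allI impI)
    fix z :: complex assume z: "norm z < min r (min s \<delta>)"
    have "\<not> is_pole g z" by (rule not_is_pole_holomorphic[OF open_ball _ s(2)]) (use z in simp)
    moreover have "G z = (if is_pole g z then None else Some (g z))" using z by (intro Gg) simp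
    moreover have "dist (g z) a < d" using \<delta>(2)[of z] z ga d by (cases "z = 0") auto
    ultimately show "\<exists>g. G z = Some g \<and> dist g a < d" by simp
  qed (use r s \<delta> in simp)
qed

lemma norm_inversion_vector:
  fixes x :: "'a::real_inner"
  shows "norm (inverse (x \<bullet> x) *\<^sub>R x) = 1 / norm x"
proof -
  have "norm (inverse (x \<bullet> x) *\<^sub>R x) = inverse ((norm x)\<^sup>2) * norm x"
    by (simp add: dot_square_norm)
  then show ?thesis by (cases "x = 0") (simp_all add: power2_eq_square divide_inverse)
qed

text \<open>
  Inversion in a sphere about \<open>a\<close> sends endpoints that tend to \<open>a\<close> to infinity.
\<close>

lemma ideal_inversion_far:
  fixes G :: "complex \<Rightarrow> sphere_at_infinity"
  assumes "\<And>d. d > 0 \<Longrightarrow> \<exists>e>0. \<forall>z. norm z < e \<longrightarrow> (\<exists>g. G z = Some g \<and> dist g a < d)"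
  shows "\<exists>e>0. \<forall>z. 0 < norm z \<and> norm z < e \<longrightarrow>
    (case ideal_inversion a (G z) of None \<Rightarrow> True | Some g \<Rightarrow> norm g \<ge> R)"
proof -
  define d where "d = 1 / (\<bar>R\<bar> + norm a + 1)"
  have d: "d > 0" by (simp add: d_def add_nonneg_pos)
  obtain e where e: "e > 0" "\<And>z. norm z < e \<Longrightarrow> \<exists>g. G z = Some g \<and> dist g a < d" using assms[OF d] by blast
  have far: "norm (a + inverse ((g - a) \<bullet> (g - a)) *\<^sub>R (g - a)) \<ge> R" if "g \<noteq> a" "dist g a < d" for g
  proof -
    have n: "norm (g - a) > 0" "norm (g - a) < d" using that by (simp_all add: dist_norm)
    have "norm (inverse ((g - a) \<bullet> (g - a)) *\<^sub>R (g - a)) = 1 / norm (g - a)"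
      by (rule norm_inversion_vector)
    moreover have "1 / norm (g - a) \<ge> 1 / d" using n d by (simp add: frac_le)
    moreover have "1 / d = \<bar>R\<bar> + norm a + 1" by (simp add: d_def)
    moreover have "norm (inverse ((g - a) \<bullet> (g - a)) *\<^sub>R (g - a))
        \<le> norm (a + inverse ((g - a) \<bullet> (g - a)) *\<^sub>R (g - a)) + norm a"
      by (rule order_trans[OF _ norm_triangle_ineq4]) simp
    ultimately show ?thesis by linarith
  qed
  show ?thesis
  proof (intro exI[of _ e] conjI allI impI e(1))
    fix z :: complex assume "0 < norm z \<and> norm z < e"
    then obtain g where "G z = Some g" "dist g a < d" using e(2) by blast
    then show "case ideal_inversion a (G z) of None \<Rightarrow> True | Some g \<Rightarrow> norm g \<ge> R"
      using far[of g] by (simp add: ideal_inversion_def)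
  qed
qed

lemma boundary_at_infinity_Some:
  assumes "E \<subseteq> H3"
  shows "Some b \<in> boundary_at_infinity E \<longleftrightarrow> (b, 0) \<in> closure E"
proof -
  have "(\<exists>\<^sub>F p in ideal_nhds (Some b). p \<in> E) \<longleftrightarrow> (\<exists>\<^sub>F p in nhds (b, 0). p \<in> E)"
    using assms unfolding frequently_def ideal_nhds_def option.case eventually_inf_principal
    by (intro arg_cong[of _ _ Not] eventually_subst) (auto intro!: always_eventually)
  also have "\<dots> \<longleftrightarrow> (b, 0) \<in> closure E"
    unfolding frequently_def eventually_nhds closure_iff_nhds_not_empty
    by (metis disjoint_iff subset_refl subset_iff)
  finally show ?thesis by (simp add: boundary_at_infinity_def)
qed

lemma boundary_at_infinity_None:
  assumes "E \<subseteq> H3"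
  shows "None \<in> boundary_at_infinity E \<longleftrightarrow> \<not> bounded E"
proof -
  have "(\<exists>\<^sub>F p in ideal_nhds None. p \<in> E) \<longleftrightarrow> (\<exists>\<^sub>F p in at_infinity. p \<in> E)"
    using assms unfolding frequently_def ideal_nhds_def option.case eventually_inf_principal
    by (intro arg_cong[of _ _ Not] eventually_subst) (auto intro!: always_eventually)
  also have "\<dots> \<longleftrightarrow> \<not> bounded E"
  proof -
    have "(\<exists>k. \<forall>p. k \<le> norm p \<longrightarrow> p \<notin> E) \<longleftrightarrow> (\<exists>k. \<forall>p\<in>E. norm p \<le> k)"
    proof
      assume "\<exists>k. \<forall>p. k \<le> norm p \<longrightarrow> p \<notin> E"
      then obtain k where "\<And>p. p \<in> E \<Longrightarrow> norm p < k" by (meson not_le)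
      then show "\<exists>k. \<forall>p\<in>E. norm p \<le> k" using less_imp_le by blast
    next
      assume "\<exists>k. \<forall>p\<in>E. norm p \<le> k"
      then obtain k where "\<And>p. p \<in> E \<Longrightarrow> norm p \<le> k" by blast
      then show "\<exists>k. \<forall>p. k \<le> norm p \<longrightarrow> p \<notin> E" by (intro exI[of _ "k + 1"]) force
    qed
    then show ?thesis unfolding frequently_def eventually_at_infinity bounded_iff not_not by simp
  qed
  finally show ?thesis by (simp add: boundary_at_infinity_def)
qed

context proper_end
begin

text \<open>
  Otherwise \<open>E\<close> is bounded and has no limit points on the boundary plane, so it is compact; but the end leaves
  every compact set.
\<close>

lemma boundary_nonempty: "boundary_at_infinity E \<noteq> {}"
proof
  assume empty: "boundary_at_infinity E = {}"
  then have "bounded E" using boundary_at_infinity_None[OF subset_H3] by blast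
  have "closure E \<subseteq> E"
  proof
    fix y assume y: "y \<in> closure E"
    have "closed {p :: complex \<times> real. 0 \<le> snd p}" by (intro closed_Collect_le continuous_intros)
    then have "closure E \<subseteq> {p. 0 \<le> snd p}"
      using subset_H3 by (intro closure_minimal) (auto simp: H3_def)
    then have "0 \<le> snd y" using y by blast
    moreover have "snd y \<noteq> 0"
    proof
      assume "snd y = 0"
      then have "y = (fst y, 0)" by (simp add: prod_eq_iff)
      then have "Some (fst y) \<in> boundary_at_infinity E"
        using boundary_at_infinity_Some[OF subset_H3] y by metis
      then show False using empty by blast
    qed
    ultimately have "y \<in> H3" by (simp add: H3_def)
    obtain C where C: "closed C" "E = H3 \<inter> C" using closed_in_H3 by (auto simp: closedin_closed)
    then have "closure E \<subseteq> C" by (simp add: closure_minimal)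
    then show "y \<in> E" using C(2) y \<open>y \<in> H3\<close> by blast
  qed
  then have "closed E" using closure_subset_eq by blast
  then have "compact E" using \<open>bounded E\<close> by (simp add: compact_eq_bounded_closed)
  then obtain e where e: "e > 0" "e \<le> 1" "\<And>z. 0 < norm z \<Longrightarrow> norm z < e \<Longrightarrow> \<phi> z \<notin> E"
    using leaves_compact[OF _ subset_H3] by blast
  have "of_real (e / 2) \<in> punctured_disk" using e by (simp add: punctured_disk_def)
  then have "\<phi> (of_real (e / 2)) \<in> E" by (rule \<phi>_in)
  moreover have "\<phi> (of_real (e / 2)) \<notin> E" using e by (intro e(3)) auto
  ultimately show False by blast
qed

text \<open>
  When \<open>G 0 = \<infinity>\<close> any other ideal point is already finite. When \<open>G 0 = a\<close>, inversion in a sphere about \<open>a\<close> exchanges \<open>a\<close>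
  and \<open>\<infinity>\<close> and makes every other ideal point finite.
\<close>

lemma boundary_subset:
  assumes G: "sphere_meromorphic_at G 0" and \<xi>: "\<xi> \<in> boundary_at_infinity E"
  shows "\<xi> = G 0"
proof (rule ccontr)
  assume neq: "\<xi> \<noteq> G 0"
  show False
  proof (cases "G 0")
    case None
    then obtain b where b: "\<xi> = Some b" using neq by (cases \<xi>) auto
    have "(b, 0) \<in> closure E" using \<xi> b boundary_at_infinity_Some[OF subset_H3] by simp
    then have acc: "\<exists>p\<in>E. dist p (b, 0) < d" if "d > 0" for d
      using that closure_approachable by blast
    show False
    proof (rule no_accumulation_away_from_gauss_limit[where T = "\<lambda>p. p" and T' = "\<lambda>p v. v" and \<sigma> = "\<lambda>\<xi>. \<xi>" and b = b])
      show "\<exists>e>0. \<forall>z. 0 < norm z \<and> norm z < e \<longrightarrow> (case G z of None \<Rightarrow> True | Some g \<Rightarrow> norm g \<ge> R)" for R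
        by (rule sphere_meromorphic_limit_infinity[OF G None])
      show "\<exists>l>0. v \<bullet> ideal_direction \<xi> p = l * (v \<bullet> ideal_direction \<xi> p)" for p v \<xi>
        by (intro exI[of _ 1]) simp
    qed (use acc in auto)
  next
    case (Some a)
    have acc: "\<exists>b. \<forall>d>0. \<exists>p\<in>E. dist (inversion a p) (b, 0) < d"
    proof (cases \<xi>)
      case None
      then have unb: "\<not> bounded E" using \<xi> boundary_at_infinity_None[OF subset_H3] by simp
      have "\<exists>p\<in>E. dist (inversion a p) (a, 0) < d" if d: "d > 0" for d
      proof -
        obtain p where p: "p \<in> E" "norm p > norm (a, 0::real) + 1 / d"
          using unb unfolding bounded_iff by (meson not_le)
        have "norm p \<le> norm (p - (a, 0)) + norm (a, 0::real)" by norm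
        then have n: "norm (p - (a, 0)) > 1 / d" using p(2) by linarith
        moreover have "1 / d > 0" using d by simp
        ultimately have n0: "norm (p - (a, 0)) > 0" by linarith
        have "dist (inversion a p) (a, 0) = norm (inverse ((p - (a, 0)) \<bullet> (p - (a, 0))) *\<^sub>R (p - (a, 0)))"
          by (simp add: inversion_def dist_norm)
        also have "\<dots> = 1 / norm (p - (a, 0))"
          by (rule norm_inversion_vector)
        also have "\<dots> < d" using n n0 d by (simp add: field_simps)
        finally show ?thesis using p(1) by blast
      qed
      then show ?thesis by blast
    next
      case (Some b')
      have ba: "(b', 0) \<noteq> (a, 0::real)" using neq Some \<open>G 0 = Some a\<close> by simp
      define b where "b = a + inverse ((b' - a) \<bullet> (b' - a)) *\<^sub>R (b' - a)"
      have inv: "inversion a (b', 0) = (b, 0)" by (simp add: inversion_def b_def)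
      have "isCont (inversion a) (b', 0)" by (rule has_derivative_continuous[OF inversion_derivative[OF ba]])
      have "(b', 0) \<in> closure E" using \<xi> Some boundary_at_infinity_Some[OF subset_H3] by simp
      then obtain f where f: "\<And>n. f n \<in> E" "f \<longlonglongrightarrow> (b', 0)" unfolding closure_sequential by blast
      have lim: "(\<lambda>n. inversion a (f n)) \<longlonglongrightarrow> (b, 0)"
        using isCont_tendsto_compose[OF \<open>isCont (inversion a) (b', 0)\<close> f(2)] by (simp add: inv)
      have "\<exists>p\<in>E. dist (inversion a p) (b, 0) < d" if d: "d > 0" for d
      proof -
        obtain n where "dist (inversion a (f n)) (b, 0) < d"
          using eventually_happens[OF tendstoD[OF lim d]] by auto
        then show ?thesis using f(1) by blast
      qed
      then show ?thesis by blast
    qed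
    then obtain b where b: "\<And>d. d > 0 \<Longrightarrow> \<exists>p\<in>E. dist (inversion a p) (b, 0) < d" by blast
    show False
    proof (rule no_accumulation_away_from_gauss_limit[where T = "inversion a" and \<sigma> = "ideal_inversion a" and b = b
        and T' = "\<lambda>p v. inverse ((p - (a, 0)) \<bullet> (p - (a, 0))) *\<^sub>R reflect (p - (a, 0)) v"])
      fix p :: "complex \<times> real" assume p: "p \<in> H3"
      show "inversion a p \<in> H3" "inversion a (inversion a p) = p"
        using p by (rule inversion_in_H3, rule inversion_inversion)
      show "(inversion a has_derivative (\<lambda>v. inverse ((p - (a, 0)) \<bullet> (p - (a, 0))) *\<^sub>R reflect (p - (a, 0)) v)) (at p)"
        by (rule inversion_derivative) (use H3_nonzero[OF p, of a] in auto)
      show "\<exists>l>0. (inverse ((inversion a p - (a, 0)) \<bullet> (inversion a p - (a, 0))) *\<^sub>R reflect (inversion a p - (a, 0)) v) \<bullet> ideal_direction \<xi> p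
          = l * (v \<bullet> ideal_direction (ideal_inversion a \<xi>) (inversion a p))" for v \<xi>
        using inversion_derivative_ideal_direction[OF p, of a v \<xi>] H3_nonzero[OF p, of a]
        by (intro exI[of _ "(p - (a, 0)) \<bullet> (p - (a, 0))"] conjI) simp_all
    next
      show "\<exists>e>0. \<forall>z. 0 < norm z \<and> norm z < e \<longrightarrow>
          (case ideal_inversion a (G z) of None \<Rightarrow> True | Some g \<Rightarrow> norm g \<ge> R)" for R
        by (rule ideal_inversion_far) (rule sphere_meromorphic_limit_finite[OF G Some])
    qed (rule b)
  qed
qed

end

theorem theorem2:
  fixes E :: "(complex \<times> real) set"
    and \<phi> :: "complex \<Rightarrow> complex \<times> real"
    and G :: "complex \<Rightarrow> sphere_at_infinity"
  assumes "bryant_annular_end E"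
    and "conformal_parametrization E \<phi>"
    and "\<And>z. z \<in> punctured_disk \<Longrightarrow> G z = hyperbolic_gauss_map E (\<phi> z)"
    and "sphere_meromorphic_at G 0"
  shows "boundary_at_infinity E = {G 0}"
proof -
  have bs: "bryant_surface E" and proper': "\<forall>K. compact K \<and> K \<subseteq> H3 \<longrightarrow> compact (E \<inter> K)"
    using assms(1) unfolding bryant_annular_end_def by simp_all
  have proper: "compact (E \<inter> K)" if "compact K" "K \<subseteq> H3" for K
    using proper' that by blast
  have E: "E \<subseteq> H3" and "\<exists>N. continuous_on E N \<and> (\<forall>q\<in>E. has_mean_curvature E q (N q) 1)"
    using bs unfolding bryant_surface_def embedded_surface_def by simp_all
  then obtain N where N: "continuous_on E N" "\<forall>q\<in>E. has_mean_curvature E q (N q) 1"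
    by (elim exE conjE)
  obtain \<psi> where \<psi>: "homeomorphism punctured_disk E \<phi> \<psi>"
    using assms(2) unfolding conformal_parametrization_def by blast
  interpret parametrized_end E \<phi> \<psi>
    using E \<psi> assms(2) by unfold_locales (auto simp: conformal_parametrization_def)
  have mc: "has_mean_curvature E (\<phi> z) (N (\<phi> z)) 1" if "z \<in> interior punctured_disk" for z
    by (rule bspec[OF N(2)]) (use \<phi>_in that interior_subset in blast)
  have tn: "tangent_normal z (N (\<phi> z))" if "z \<in> interior punctured_disk" for z
    by (rule has_mean_curvatureD(1)[OF that mc[OF that]])
  interpret proper_end E \<phi> \<psi> N G
  proof unfold_locales
    show "continuous_on E N" by (rule N(1))
    show "compact (E \<inter> K)" if "compact K" "K \<subseteq> H3" for K by (rule proper[OF that])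
    fix z assume z: "z \<in> interior punctured_disk"
    show "tangent_normal z (N (\<phi> z))" by (rule tn[OF z])
    have zd: "z \<in> punctured_disk" using z interior_subset by blast
    have V: "mean_curvature_vector E (\<phi> z) = N (\<phi> z)"
      using mean_curvature_vector_eq[OF z mc[OF z]] by simp
    have "mean_curvature_vector E (\<phi> z)
        = snd (\<phi> z) *\<^sub>R ideal_direction (hyperbolic_gauss_map E (\<phi> z)) (\<phi> z)"
    proof (rule hyperbolic_gauss_map_direction)
      show "\<phi> z \<in> H3" using \<phi>_in[OF zd] E by blast
      show "norm (mean_curvature_vector E (\<phi> z)) = snd (\<phi> z)"
        using tn[OF z] by (simp add: V tangent_normal_def)
    qed
    then show "N (\<phi> z) = snd (\<phi> z) *\<^sub>R ideal_direction (G z) (\<phi> z)"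
      by (simp only: V assms(3)[OF zd])
  qed
  show ?thesis using boundary_nonempty boundary_subset[OF assms(4)] by blast
qed

end
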